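(* Let $\Gamma$ be a non-elementary Gromov hyperbolic group acting properly, cocompactly and by isometries on a roughly geodesic, strongly hyperbolic metric space $(X,\rho)$ with parameter $\epsilon>0$. Fix $o\in X$, let $Z=\partial X$ with the metric $d(\xi,\eta)=\exp(-\epsilon\langle\xi,\eta\rangle_o)$, let $D$ be the Hausdorff dimension of $(Z,d)$ and $\nu$ the $D$-dimensional Hausdorff measure on $(Z,d)$, which is Ahlfors--David $D$-regular. Then: (a) for any $1<p<\infty$ and $t\in\mathbb{R}$, the representation $\pi^{(p)}_{it}$ of $\Gamma$ is mixing on $L^p(\partial X,\nu)$; (b) the representation $\pi^{(1)}_0$ is weakly mixing on the subspace $L^1_0=\{\phi\in L^1(\partial X,\nu):\int_{\partial X}\phi\,\mathrm{d}\nu=0\}$.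
   Context: Gromov product: $\langle x,y\rangle_o=\frac12(\rho(o,x)+\rho(o,y)-\rho(x,y))$. $(X,\rho)$ is roughly geodesic if there is $C_0\ge0$ such that for all $x,y\in X$ there is $\gamma:[a,b]\to X$ with $\gamma(a)=x$, $\gamma(b)=y$ and $|s-s'|-C_0\le\rho(\gamma(s),\gamma(s'))\le|s-s'|+C_0$ for all $s,s'\in[a,b]$. $(X,\rho)$ is strongly hyperbolic with parameter $\epsilon>0$ if $e^{-\epsilon\langle x,y\rangle_o}\le e^{-\epsilon\langle x,z\rangle_o}+e^{-\epsilon\langle z,y\rangle_o}$ for all $x,y,z,o\in X$; then the Gromov product extends continuously to $X\cup\partial X$ and $d$ above is a metric on $\partial X$. Ahlfors--David $D$-regular: $\nu(B(\xi,r))\asymp r^D$ for all $\xi\in Z$, $0\le r\le\operatorname{diam}(Z)$ (closed balls). $\Gamma$ acts on $Z$ by the boundary extension of its isometric action on $X$. The metric derivative of $g\in\Gamma$ is $|g'|(\xi)=\exp(2\epsilon\langle\xi,go\rangle_o-\epsilon\rho(go,o))$, $\xi\in Z$; it satisfies $\mathrm{d}\nu(g\xi)=|g'|^D(\xi)\,\mathrm{d}\nu(\xi)$. For $\psi:Z\to\mathbb{C}$, $\pi^{(p)}_{it}(g)\psi(\xi)=|(g^{-1})'|^{\frac Dp-it}(\xi)\,\psi(g^{-1}\xi)$; this is isometric on $L^p(\nu)$, and $\pi^{(1)}_0$ preserves $L^1_0$. A representation $\pi:\Gamma\to\mathcal{B}(V)$ on a Banach space $V$ is weakly mixing if for any $\theta\in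 V^*$ (topological dual), any $v\in V$ and any $\varepsilon>0$ there exists $g\in\Gamma$ with $|\theta(\pi(g)v)|<\varepsilon$. It is mixing if $|\Gamma|=\infty$ and for any $\theta\in V^*$ and $v\in V$, $\lim_{g\to\infty}\theta(\pi(g)v)=0$, where $g\to\infty$ means that $g$ leaves every finite subset of $\Gamma$.
   Formalization: The metric derivative is taken as |g'|(ξ)=exp(2ε⟨ξ,g⁻¹o⟩_o − ερ(g⁻¹o,o)), with g⁻¹o in place of the printed go, since the printed formula contradicts dν(gξ)=|g'|^D(ξ)dν(ξ) and makes π neither multiplicative nor isometric. *)

theory Defs
  imports
    "HOL-Analysis.Analysis"
    "HOL-Algebra.Group_Action"
    "HOL-Algebra.Generated_Groups"
begin

section \<open>Hyperbolic metric spaces and groups\<close>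

definition gromov_product :: "('a \<Rightarrow> 'a \<Rightarrow> real) \<Rightarrow> 'a \<Rightarrow> 'a \<Rightarrow> 'a \<Rightarrow> real" where
  "gromov_product \<rho> w x y = (\<rho> w x + \<rho> w y - \<rho> x y) / 2"

abbreviation gp :: "'x::metric_space \<Rightarrow> 'x \<Rightarrow> 'x \<Rightarrow> real" where
  "gp \<equiv> gromov_product dist"

definition roughly_geodesic :: "'x::metric_space itself \<Rightarrow> bool" where
  "roughly_geodesic _ \<longleftrightarrow>
     (\<exists>C\<ge>0. \<forall>x y :: 'x. \<exists>a b :: real. \<exists>\<gamma> :: real \<Rightarrow> 'x. a \<le> b \<and> \<gamma> a = x \<and> \<gamma> b = y \<and>
       (\<forall>s\<in>{a..b}. \<forall>s'\<in>{a..b}.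
          \<bar>s - s'\<bar> - C \<le> dist (\<gamma> s) (\<gamma> s') \<and> dist (\<gamma> s) (\<gamma> s') \<le> \<bar>s - s'\<bar> + C))"

definition strongly_hyperbolic :: "'x::metric_space itself \<Rightarrow> real \<Rightarrow> bool" where
  "strongly_hyperbolic _ \<epsilon> \<longleftrightarrow>
     (\<forall>x y z w :: 'x. exp (- \<epsilon> * gp w x y) \<le> exp (- \<epsilon> * gp w x z) + exp (- \<epsilon> * gp w z y))"

definition word_length :: "('g, 'm) monoid_scheme \<Rightarrow> 'g set \<Rightarrow> 'g \<Rightarrow> nat" where
  "word_length G S g = (LEAST n. \<exists>ws. length ws = n \<and> set ws \<subseteq> S \<union> m_inv G ` S \<and>
      foldr (mult G) ws (one G) = g)"

definition word_dist :: "('g, 'm) monoid_scheme \<Rightarrow> 'g set \<Rightarrow> 'g \<Rightarrow> 'g \<Rightarrow> real" where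
  "word_dist G S g h = real (word_length G S (inv\<^bsub>G\<^esub> g \<otimes>\<^bsub>G\<^esub> h))"

text \<open>Gromov's four-point condition for the word metric of a finite generating set.\<close>

definition hyperbolic_group :: "('g, 'm) monoid_scheme \<Rightarrow> bool" where
  "hyperbolic_group G \<longleftrightarrow> group G \<and>
     (\<exists>S. finite S \<and> S \<subseteq> carrier G \<and> generate G S = carrier G \<and>
       (\<exists>\<delta>. \<forall>x\<in>carrier G. \<forall>y\<in>carrier G. \<forall>z\<in>carrier G. \<forall>w\<in>carrier G.
          gromov_product (word_dist G S) w x y \<ge>
            min (gromov_product (word_dist G S) w x z) (gromov_product (word_dist G S) w z y) - \<delta>))"

text \<open>Elementary means virtually cyclic; this includes the finite groups.\<close>

definition elementary_group :: "('g, 'm) monoid_scheme \<Rightarrow> bool" where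
  "elementary_group G \<longleftrightarrow>
     (\<exists>H. subgroup H G \<and> finite (rcosets\<^bsub>G\<^esub> H) \<and> (\<exists>a\<in>carrier G. H = generate G {a}))"

definition isometric_action :: "('g, 'm) monoid_scheme \<Rightarrow> ('g \<Rightarrow> 'x::metric_space \<Rightarrow> 'x) \<Rightarrow> bool" where
  "isometric_action G \<phi> \<longleftrightarrow> group_action G UNIV \<phi> \<and>
     (\<forall>g\<in>carrier G. \<forall>x y. dist (\<phi> g x) (\<phi> g y) = dist x y)"

text \<open>Properness is metric properness, the notion appropriate to spaces that are not
  assumed to be length spaces.\<close>

definition proper_action :: "('g, 'm) monoid_scheme \<Rightarrow> ('g \<Rightarrow> 'x::metric_space \<Rightarrow> 'x) \<Rightarrow> bool" where
  "proper_action G \<phi> \<longleftrightarrow> (\<forall>B. bounded B \<longrightarrow> finite {g \<in> carrier G. \<phi> g ` B \<inter> B \<noteq> {}})"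

definition cocompact_action :: "('g, 'm) monoid_scheme \<Rightarrow> ('g \<Rightarrow> 'x::metric_space \<Rightarrow> 'x) \<Rightarrow> bool" where
  "cocompact_action G \<phi> \<longleftrightarrow> (\<exists>K. compact K \<and> (\<Union>g\<in>carrier G. \<phi> g ` K) = UNIV)"


section \<open>The Gromov boundary\<close>

text \<open>Boundary points are equivalence classes of sequences converging to infinity. Neither this
  notion nor the equivalence depends on the base point \<open>w\<close>, since changing it alters Gromov
  products by a bounded amount.\<close>

definition converges_to_infinity :: "'x::metric_space \<Rightarrow> (nat \<Rightarrow> 'x) \<Rightarrow> bool" where
  "converges_to_infinity w u \<longleftrightarrow>
     filterlim (\<lambda>(i, j). gp w (u i) (u j)) at_top (sequentially \<times>\<^sub>F sequentially)"

definition boundary_rel :: "'x::metric_space \<Rightarrow> ((nat \<Rightarrow> 'x) \<times> (nat \<Rightarrow> 'x)) set" where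
  "boundary_rel w = {(u, v). converges_to_infinity w u \<and> converges_to_infinity w v \<and>
     filterlim (\<lambda>n. gp w (u n) (v n)) at_top sequentially}"

definition gromov_boundary :: "'x::metric_space \<Rightarrow> (nat \<Rightarrow> 'x) set set" where
  "gromov_boundary w = {u. converges_to_infinity w u} // boundary_rel w"

text \<open>The continuous extension of the Gromov product. On two boundary points it takes the value
  \<open>\<infinity>\<close> exactly on the diagonal; against a point of the space it is finite.\<close>

definition gp_boundary :: "'x::metric_space \<Rightarrow> (nat \<Rightarrow> 'x) set \<Rightarrow> (nat \<Rightarrow> 'x) set \<Rightarrow> ereal" where
  "gp_boundary w \<xi> \<eta> = (THE L. \<forall>u\<in>\<xi>. \<forall>v\<in>\<eta>. (\<lambda>n. ereal (gp w (u n) (v n))) \<longlonglongrightarrow> L)"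

definition gp_boundary_point :: "'x::metric_space \<Rightarrow> (nat \<Rightarrow> 'x) set \<Rightarrow> 'x \<Rightarrow> real" where
  "gp_boundary_point w \<xi> x = (THE L. \<forall>u\<in>\<xi>. (\<lambda>n. gp w (u n) x) \<longlonglongrightarrow> L)"

definition boundary_dist ::
    "real \<Rightarrow> 'x::metric_space \<Rightarrow> (nat \<Rightarrow> 'x) set \<Rightarrow> (nat \<Rightarrow> 'x) set \<Rightarrow> real" where
  "boundary_dist \<epsilon> w \<xi> \<eta> =
     (if gp_boundary w \<xi> \<eta> = \<infinity> then 0 else exp (- \<epsilon> * real_of_ereal (gp_boundary w \<xi> \<eta>)))"

definition boundary_map :: "('x \<Rightarrow> 'x) \<Rightarrow> (nat \<Rightarrow> 'x) set \<Rightarrow> (nat \<Rightarrow> 'x) set" where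
  "boundary_map f \<xi> = (\<lambda>u n. f (u n)) ` \<xi>"

text \<open>The metric derivative is \<open>lim d(g\<xi>, g\<eta>) / d(\<xi>, \<eta>)\<close> as \<open>\<eta> \<rightarrow> \<xi>\<close>. Since
  \<open>\<langle>g\<xi>, g\<eta>\<rangle>\<^sub>w\<close> is \<open>\<langle>\<xi>, \<eta>\<rangle>\<close> based at \<open>g\<inverse>w\<close>, the orbit point in the closed
  formula is \<open>g\<inverse>w\<close>. With \<open>gw\<close> in its place (a formula for the derivative of
  \<open>g\<inverse>\<close>) the change of variables \<open>d\<nu>(g\<xi>) = |g'|\<^sup>D(\<xi>) d\<nu>(\<xi>)\<close> and the chain rule fail.\<close>

definition metric_derivative ::
    "('g, 'm) monoid_scheme \<Rightarrow> ('g \<Rightarrow> 'x::metric_space \<Rightarrow> 'x) \<Rightarrow> real \<Rightarrow> 'x \<Rightarrow> 'g \<Rightarrow> (nat \<Rightarrow> 'x) set \<Rightarrow> real" where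
  "metric_derivative G \<phi> \<epsilon> w g \<xi> =
     exp (2 * \<epsilon> * gp_boundary_point w \<xi> (\<phi> (inv\<^bsub>G\<^esub> g) w) - \<epsilon> * dist (\<phi> (inv\<^bsub>G\<^esub> g) w) w)"


section \<open>Hausdorff measure and dimension of a metric space given by a carrier and a distance\<close>

text \<open>\<open>diam(U)\<^sup>s\<close> with the conventions \<open>0\<^sup>0 = 1\<close> for nonempty \<open>U\<close> and value \<open>0\<close> for the empty set.\<close>

definition diam_pow :: "('a \<Rightarrow> 'a \<Rightarrow> real) \<Rightarrow> real \<Rightarrow> 'a set \<Rightarrow> real" where
  "diam_pow d s U =
     (if U = {} then 0 else if s = 0 then 1 else (SUP (x, y)\<in>U \<times> U. d x y) powr s)"

definition hausdorff_content ::
    "'a set \<Rightarrow> ('a \<Rightarrow> 'a \<Rightarrow> real) \<Rightarrow> real \<Rightarrow> real \<Rightarrow> 'a set \<Rightarrow> ennreal" where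
  "hausdorff_content M d s \<delta> A =
     (INF U\<in>{U :: nat \<Rightarrow> 'a set. A \<subseteq> (\<Union>i. U i) \<and>
                (\<forall>i. U i \<subseteq> M \<and> (\<forall>x\<in>U i. \<forall>y\<in>U i. d x y \<le> \<delta>))}.
        \<Sum>i. ennreal (diam_pow d s (U i)))"

definition hausdorff_outer :: "'a set \<Rightarrow> ('a \<Rightarrow> 'a \<Rightarrow> real) \<Rightarrow> real \<Rightarrow> 'a set \<Rightarrow> ennreal" where
  "hausdorff_outer M d s A = (SUP \<delta>\<in>{0<..}. hausdorff_content M d s \<delta> A)"

definition hausdorff_dim :: "'a set \<Rightarrow> ('a \<Rightarrow> 'a \<Rightarrow> real) \<Rightarrow> ereal" where
  "hausdorff_dim M d = Inf {ereal s | s. s \<ge> 0 \<and> hausdorff_outer M d s M = 0}"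

text \<open>The Hausdorff measure as a measure on the Borel sets of the metric space.\<close>

definition hausdorff_measure :: "'a set \<Rightarrow> ('a \<Rightarrow> 'a \<Rightarrow> real) \<Rightarrow> real \<Rightarrow> 'a measure" where
  "hausdorff_measure M d s =
     measure_of M {U. openin (Metric_space.mtopology M d) U} (hausdorff_outer M d s)"

definition ahlfors_regular ::
    "'a set \<Rightarrow> ('a \<Rightarrow> 'a \<Rightarrow> real) \<Rightarrow> real \<Rightarrow> 'a measure \<Rightarrow> bool" where
  "ahlfors_regular M d D \<nu> \<longleftrightarrow>
     (\<exists>c>0. \<forall>\<xi>\<in>M. \<forall>r. 0 \<le> r \<and> r \<le> (SUP (x, y)\<in>M \<times> M. d x y) \<longrightarrow>
        ennreal (r powr D / c) \<le> emeasure \<nu> (Metric_space.mcball M d \<xi> r) \<and>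
        emeasure \<nu> (Metric_space.mcball M d \<xi> r) \<le> ennreal (c * r powr D))"


section \<open>Representations on Banach spaces\<close>

record 'v cnormed = "'v partial_object" +
  vadd :: "'v \<Rightarrow> 'v \<Rightarrow> 'v"
  vscale :: "complex \<Rightarrow> 'v \<Rightarrow> 'v"
  vnorm :: "'v \<Rightarrow> real"

definition bounded_operators :: "('v, 'm) cnormed_scheme \<Rightarrow> ('v \<Rightarrow> 'v) set" where
  "bounded_operators V = {T.
     (\<forall>v\<in>carrier V. T v \<in> carrier V) \<and>
     (\<forall>v\<in>carrier V. \<forall>w\<in>carrier V. T (vadd V v w) = vadd V (T v) (T w)) \<and>
     (\<forall>c. \<forall>v\<in>carrier V. T (vscale V c v) = vscale V c (T v)) \<and>
     (\<exists>C. \<forall>v\<in>carrier V. vnorm V (T v) \<le> C * vnorm V v)}"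

definition topological_dual :: "('v, 'm) cnormed_scheme \<Rightarrow> ('v \<Rightarrow> complex) set" where
  "topological_dual V = {\<theta>.
     (\<forall>v\<in>carrier V. \<forall>w\<in>carrier V. \<theta> (vadd V v w) = \<theta> v + \<theta> w) \<and>
     (\<forall>c. \<forall>v\<in>carrier V. \<theta> (vscale V c v) = c * \<theta> v) \<and>
     (\<exists>C. \<forall>v\<in>carrier V. cmod (\<theta> v) \<le> C * vnorm V v)}"

definition representation ::
    "('g, 'm) monoid_scheme \<Rightarrow> ('v, 'n) cnormed_scheme \<Rightarrow> ('g \<Rightarrow> 'v \<Rightarrow> 'v) \<Rightarrow> bool" where
  "representation G V \<pi> \<longleftrightarrow>
     (\<forall>g\<in>carrier G. \<pi> g \<in> bounded_operators V) \<and>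
     (\<forall>v\<in>carrier V. \<pi> \<one>\<^bsub>G\<^esub> v = v) \<and>
     (\<forall>g\<in>carrier G. \<forall>h\<in>carrier G. \<forall>v\<in>carrier V. \<pi> (g \<otimes>\<^bsub>G\<^esub> h) v = \<pi> g (\<pi> h v))"

definition weakly_mixing ::
    "('g, 'm) monoid_scheme \<Rightarrow> ('v, 'n) cnormed_scheme \<Rightarrow> ('g \<Rightarrow> 'v \<Rightarrow> 'v) \<Rightarrow> bool" where
  "weakly_mixing G V \<pi> \<longleftrightarrow> representation G V \<pi> \<and>
     (\<forall>\<theta>\<in>topological_dual V. \<forall>v\<in>carrier V. \<forall>e>0. \<exists>g\<in>carrier G. cmod (\<theta> (\<pi> g v)) < e)"

definition mixing ::
    "('g, 'm) monoid_scheme \<Rightarrow> ('v, 'n) cnormed_scheme \<Rightarrow> ('g \<Rightarrow> 'v \<Rightarrow> 'v) \<Rightarrow> bool" where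
  "mixing G V \<pi> \<longleftrightarrow> representation G V \<pi> \<and> infinite (carrier G) \<and>
     (\<forall>\<theta>\<in>topological_dual V. \<forall>v\<in>carrier V.
        ((\<lambda>g. \<theta> (\<pi> g v)) \<longlongrightarrow> 0) (inf cofinite (principal (carrier G))))"


section \<open>Lebesgue spaces and the boundary representations\<close>

definition ae_class :: "'a measure \<Rightarrow> ('a \<Rightarrow> complex) \<Rightarrow> ('a \<Rightarrow> complex) set" where
  "ae_class \<nu> f = {h \<in> borel_measurable \<nu>. AE x in \<nu>. h x = f x}"

definition lp_functions :: "real \<Rightarrow> 'a measure \<Rightarrow> ('a \<Rightarrow> complex) set" where
  "lp_functions p \<nu> = {f \<in> borel_measurable \<nu>. integrable \<nu> (\<lambda>x. cmod (f x) powr p)}"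

definition lp_norm :: "real \<Rightarrow> 'a measure \<Rightarrow> ('a \<Rightarrow> complex) \<Rightarrow> real" where
  "lp_norm p \<nu> f = (\<integral>x. cmod (f x) powr p \<partial>\<nu>) powr (1 / p)"

text \<open>Elements are almost-everywhere classes. Operations are defined by ranging over all
  representatives; all members of the unions below coincide, and the norm is constant
  on each class.\<close>

definition Lp_space :: "real \<Rightarrow> 'a measure \<Rightarrow> ('a \<Rightarrow> complex) set cnormed" where
  "Lp_space p \<nu> = \<lparr>
     carrier = ae_class \<nu> ` lp_functions p \<nu>,
     vadd = (\<lambda>A B. \<Union>f\<in>A. \<Union>g\<in>B. ae_class \<nu> (\<lambda>x. f x + g x)),
     vscale = (\<lambda>c A. \<Union>f\<in>A. ae_class \<nu> (\<lambda>x. c * f x)),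
     vnorm = (\<lambda>A. the_elem (lp_norm p \<nu> ` A))\<rparr>"

definition L1_zero_space :: "'a measure \<Rightarrow> ('a \<Rightarrow> complex) set cnormed" where
  "L1_zero_space \<nu> = (Lp_space 1 \<nu>)
     \<lparr>carrier := {A \<in> carrier (Lp_space 1 \<nu>). \<forall>f\<in>A. (\<integral>x. f x \<partial>\<nu>) = 0}\<rparr>"

text \<open>The exponent \<open>D/p - it\<close> is applied to a positive real, so the complex power is unambiguous.\<close>

definition boundary_rep_fun ::
    "('g, 'm) monoid_scheme \<Rightarrow> ('g \<Rightarrow> 'x::metric_space \<Rightarrow> 'x) \<Rightarrow> real \<Rightarrow> 'x \<Rightarrow> real \<Rightarrow> real \<Rightarrow> real \<Rightarrow>
     'g \<Rightarrow> ((nat \<Rightarrow> 'x) set \<Rightarrow> complex) \<Rightarrow> (nat \<Rightarrow> 'x) set \<Rightarrow> complex" where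
  "boundary_rep_fun G \<phi> \<epsilon> w D p t g \<psi> \<xi> =
     complex_of_real (metric_derivative G \<phi> \<epsilon> w (inv\<^bsub>G\<^esub> g) \<xi>)
       powr (complex_of_real (D / p) - \<i> * complex_of_real t)
     * \<psi> (boundary_map (\<phi> (inv\<^bsub>G\<^esub> g)) \<xi>)"

definition boundary_rep ::
    "('g, 'm) monoid_scheme \<Rightarrow> ('g \<Rightarrow> 'x::metric_space \<Rightarrow> 'x) \<Rightarrow> real \<Rightarrow> 'x \<Rightarrow> real \<Rightarrow>
     (nat \<Rightarrow> 'x) set measure \<Rightarrow> real \<Rightarrow> real \<Rightarrow>
     'g \<Rightarrow> ((nat \<Rightarrow> 'x) set \<Rightarrow> complex) set \<Rightarrow> ((nat \<Rightarrow> 'x) set \<Rightarrow> complex) set" where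
  "boundary_rep G \<phi> \<epsilon> w D \<nu> p t g A =
     (\<Union>\<psi>\<in>A. ae_class \<nu> (boundary_rep_fun G \<phi> \<epsilon> w D p t g \<psi>))"

end

theory Submission
  imports Defs
begin

text \<open>On the boundary, \<open>d(g\<xi>, g\<eta>)\<^sup>2 = |g'|(\<xi>) |g'|(\<eta>) d(\<xi>, \<eta>)\<^sup>2\<close> holds exactly, which gives the change of
  variables for the Hausdorff measure and makes the representations isometric. A point of the
  boundary is either close to \<open>g w\<close>, as measured by \<open>exp (-\<epsilon>\<langle>\<xi>, g w\<rangle>)\<close>, or its image under \<open>g\<inverse>\<close> is close
  to \<open>g\<inverse> w\<close>; either condition defines a set of small diameter, hence of small measure, when \<open>g\<close> is
  large. So \<open>\<pi>(g)v\<close> is, up to a small error in norm, supported on a set of small measure, and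
  bounded functionals on \<open>L\<^sup>p\<close> with \<open>p > 1\<close> are uniformly small on such functions of bounded norm.
  For \<open>p = 1\<close>, a functional on \<open>L\<^sup>1\<^sub>0\<close> nearly vanishes on the functions supported on a suitable set \<open>E\<close> of
  positive measure (a level set of a representing density); a suitable \<open>g\<close> expands \<open>E\<close> to almost all of the
  boundary, so that \<open>\<pi>(g)v\<close> nearly lives on \<open>E\<close>.\<close>

section \<open>Hausdorff measures of bounded metric spaces\<close>

text \<open>The obstacle at p = 1 is concentration: a vector can keep its norm while its support
  shrinks, and a functional with a merely bounded density does not notice small supports. Mean zero
  is the remedy. On a set where the density is nearly a constant c, integrating a mean-zero function
  against c gives 0, so only the oscillation of the density counts. The group element has to be
  adapted to that set, hence one g for each error instead of a limit. The geometry rests on the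
  kernel exp (-\<epsilon><x,y>): strong hyperbolicity is its triangle inequality, and moving the
  base point multiplies it by a constant, a factor depending on x and a factor depending on y,
  exactly. In the limit, the kernel of g\<inverse>\<xi> and g\<inverse>w times the kernel of \<xi>
  and g w equals exp (-\<epsilon> d(w, g w)) for every boundary point \<xi>. By properness this
  product tends to 0 as g leaves finite sets, so both small sets of the dichotomy can be given sizes
  fixed in advance, independently of g.\<close>

context Metric_space
begin

text \<open>Stated symmetrically in \<open>A\<close> and \<open>M - A\<close>: both get open
  neighbourhoods whose overlap has small measure. Closure under complements is then an exchange of
  \<open>U\<close> and \<open>V\<close>, whereas plain outer regularity would not pass through that
  induction step.\<close>

lemma borel_outer_regular_aux:
  assumes fin: "finite_measure N" and sets: "sets N = sigma_sets M {U. openin mtopology U}"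
    and space: "space N = M" and A: "A \<in> sigma_sets M {U. openin mtopology U}" and e: "e > 0"
  shows "\<exists>U V. openin mtopology U \<and> openin mtopology V \<and> A \<subseteq> U \<and> M - A \<subseteq> V \<and> measure N (U \<inter> V) < e"
  using A e
proof (induction arbitrary: e rule: sigma_sets.induct)
  case (Basic a)
  interpret finite_measure N by (rule fin)
  have a: "openin mtopology a" using Basic by simp
  \<comment> \<open>Open collars of width \<open>1 / (n + 1)\<close> around the closed set
    \<open>M - a\<close>. A point of the open set \<open>a\<close> leaves them once the width drops
    below the radius of a ball contained in \<open>a\<close>, so continuity from above makes some
    \<open>a \<inter> V n\<close> small.\<close>
  define V where "V n = (\<Union>y\<in>M - a. mball y (1 / real (Suc n)))" for n
  have V: "openin mtopology (V n)" for n unfolding V_def by blast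
  have meas: "U \<in> sets N" if "openin mtopology U" for U
    using that sets by auto
  have dec: "decseq (\<lambda>n. a \<inter> V n)"
  proof (rule decseq_SucI)
    fix n
    have "mball y (1 / real (Suc (Suc n))) \<subseteq> mball y (1 / real (Suc n))" for y
      by (rule mball_subset_concentric) (simp add: field_simps)
    then show "a \<inter> V (Suc n) \<subseteq> a \<inter> V n" unfolding V_def by blast
  qed
  have "(\<Inter>n. a \<inter> V n) = {}"
  proof (rule ccontr)
    assume "(\<Inter>n. a \<inter> V n) \<noteq> {}"
    then obtain x where x: "x \<in> a" "\<And>n. x \<in> V n" by auto
    then obtain r where r: "r > 0" "mball x r \<subseteq> a" using a unfolding openin_mtopology by blast
    then obtain n where n: "1 / real (Suc n) < r" using nat_approx_posE by blast
    obtain y where y: "y \<in> M - a" "x \<in> mball y (1 / real (Suc n))"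
      using x(2)[of n] unfolding V_def by blast
    then have "y \<in> mball x r" using n by (auto simp: commute)
    then show False using r y by blast
  qed
  then have "(\<lambda>n. measure N (a \<inter> V n)) \<longlonglongrightarrow> 0"
    using finite_Lim_measure_decseq[OF _ dec] meas a V by auto
  then obtain n where n: "measure N (a \<inter> V n) < e"
    using order_tendstoD(2)[of _ 0 sequentially e] Basic.prems by (meson eventually_sequentially order_refl)
  have "M - a \<subseteq> V n"
  proof
    fix y assume "y \<in> M - a"
    then show "y \<in> V n" unfolding V_def
      by (intro UN_I[of y]) (auto simp del: of_nat_Suc)
  qed
  then show ?case using a V n by blast
next
  case Empty
  then show ?case by (intro exI[of _ "{}"] exI[of _ M]) auto
next
  case (Compl a)
  obtain U V where UV: "openin mtopology U" "openin mtopology V" "a \<subseteq> U" "M - a \<subseteq> V"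
    "measure N (U \<inter> V) < e" using Compl.IH[OF Compl.prems] by blast
  have "M - (M - a) \<subseteq> U" using UV(3) by blast
  moreover have "measure N (V \<inter> U) < e" using UV(5) by (subst Int_commute)
  ultimately show ?case using UV(1,2,4) by (intro exI[of _ V] exI[of _ U] conjI)
next
  case (Union a)
  interpret finite_measure N by (rule fin)
  \<comment> \<open>Half of the error \<open>e\<close> is spread geometrically over the overlaps;
    the other half pays for cutting the union off at a finite stage.\<close>
  have "\<exists>U V. openin mtopology U \<and> openin mtopology V \<and> a n \<subseteq> U \<and> M - a n \<subseteq> V \<and>
      measure N (U \<inter> V) < e / 2 * (1 / 2) ^ Suc n" for n
    using Union.IH[of "e / 2 * (1 / 2) ^ Suc n" n] Union.prems by simp
  then obtain U V where U: "\<And>n. openin mtopology (U n)" and V: "\<And>n. openin mtopology (V n)"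
    and aU: "\<And>n. a n \<subseteq> U n" and aV: "\<And>n. M - a n \<subseteq> V n"
    and UV: "\<And>n. measure N (U n \<inter> V n) < e / 2 * (1 / 2) ^ Suc n"
    by metis
  have meas: "U \<in> sets N" if "openin mtopology U" for U
    using that sets by auto
  have mU: "range U \<subseteq> sets N" using U meas by blast
  have "(\<lambda>n. measure N (\<Union>i\<le>n. U i)) \<longlonglongrightarrow> measure N (\<Union>n. \<Union>i\<le>n. U i)"
    using U by (intro finite_Lim_measure_incseq incseq_SucI UN_mono) (auto intro!: meas)
  also have "(\<Union>n. \<Union>i\<le>n. U i) = (\<Union>n. U n)" by auto
  finally have "\<forall>\<^sub>F n in sequentially. measure N (\<Union>n. U n) - e / 2 < measure N (\<Union>i\<le>n. U i)"
    using Union.prems by (intro order_tendstoD(1)) auto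
  then obtain n where n: "measure N (\<Union>n. U n) - e / 2 < measure N (\<Union>i\<le>n. U i)"
    by (meson eventually_sequentially order_refl)
  \<comment> \<open>Infinitely many \<open>V i\<close> need not have an open intersection. With only
    \<open>i \<le> n\<close>, the overlap also picks up what the union of all \<open>U i\<close>
    adds to the first ones, a set of measure below \<open>e / 2\<close>.\<close>
  define W where "W = (\<Inter>i\<le>n. V i)"
  have W: "openin mtopology W" unfolding W_def by (intro openin_INT2) (auto simp: V)
  have sums: "sum (\<lambda>i. (1 / 2 :: real) ^ Suc i) {..n} \<le> 1"
    using sum_le_suminf[OF sums_summable[OF power_half_series], of "{..n}"]
      sums_unique[OF power_half_series] by simp
  have "measure N (\<Union>i\<le>n. U i \<inter> V i) \<le> (\<Sum>i\<le>n. measure N (U i \<inter> V i))"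
    using U V meas by (intro finite_measure_subadditive_finite) auto
  also have "\<dots> \<le> (\<Sum>i\<le>n. e / 2 * (1 / 2) ^ Suc i)"
    by (intro sum_mono less_imp_le UV)
  also have "\<dots> = e / 2 * (\<Sum>i\<le>n. (1 / 2) ^ Suc i)"
    by (simp only: sum_distrib_left)
  also have "\<dots> \<le> e / 2 * 1"
    using Union.prems by (intro mult_left_mono sums) auto
  finally have 1: "measure N (\<Union>i\<le>n. U i \<inter> V i) \<le> e / 2" by simp
  have "measure N ((\<Union>n. U n) - (\<Union>i\<le>n. U i)) = measure N (\<Union>n. U n) - measure N (\<Union>i\<le>n. U i)"
    using U meas by (intro finite_measure_Diff) auto
  then have 2: "measure N ((\<Union>n. U n) - (\<Union>i\<le>n. U i)) < e / 2" using n by simp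
  have "measure N ((\<Union>n. U n) \<inter> W)
      \<le> measure N ((\<Union>i\<le>n. U i \<inter> V i) \<union> ((\<Union>n. U n) - (\<Union>i\<le>n. U i)))"
    using U V meas by (intro finite_measure_mono) (auto simp: W_def)
  also have "\<dots> \<le> measure N (\<Union>i\<le>n. U i \<inter> V i) + measure N ((\<Union>n. U n) - (\<Union>i\<le>n. U i))"
    using U V meas by (intro measure_Un_le) auto
  finally have "measure N ((\<Union>n. U n) \<inter> W) < e" using 1 2 by simp
  moreover have "M - (\<Union>i. a i) \<subseteq> W" using aV by (auto simp: W_def)
  moreover have "openin mtopology (\<Union>n. U n)" using U by blast
  moreover have "(\<Union>i. a i) \<subseteq> (\<Union>n. U n)" using aU by blast
  ultimately show ?case using W by blast
qed

lemma borel_outer_regular: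
  assumes "finite_measure N" and "sets N = sigma_sets M {U. openin mtopology U}"
    and "space N = M" and "A \<in> sets N" and "e > 0"
  shows "\<exists>U. openin mtopology U \<and> A \<subseteq> U \<and> measure N (U - A) < e"
proof -
  obtain U V where UV: "openin mtopology U" "openin mtopology V" "A \<subseteq> U" "M - A \<subseteq> V"
    "measure N (U \<inter> V) < e"
    using borel_outer_regular_aux[OF assms(1-3) _ assms(5)] assms(2,4) by metis
  have "U - A \<subseteq> U \<inter> V" using UV openin_subset[OF UV(1)] by auto
  then have "measure N (U - A) \<le> measure N (U \<inter> V)"
    using UV assms(1,2) by (intro finite_measure.finite_measure_mono) auto
  then show ?thesis using UV by (intro exI[of _ U]) auto
qed

section \<open>Hausdorff outer measure under Lipschitz maps\<close>

lemma diam_pow_lipschitz: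
  assumes bnd: "\<And>x y. x \<in> M \<Longrightarrow> y \<in> M \<Longrightarrow> d x y \<le> B" and s: "s \<ge> 0" and L: "L > 0"
    and f: "\<And>x y. x \<in> A \<Longrightarrow> y \<in> A \<Longrightarrow> d (f x) (f y) \<le> L * d x y"
    and U: "U \<subseteq> M"
  shows "diam_pow d s (f ` (U \<inter> A)) \<le> L powr s * diam_pow d s U"
proof (cases "U \<inter> A = {} \<or> s = 0")
  case True
  then show ?thesis using L by (auto simp: diam_pow_def)
next
  case False
  then have ne: "U \<inter> A \<noteq> {}" "U \<noteq> {}" "s \<noteq> 0" by auto
  define D where "D = (SUP (x, y)\<in>U \<times> U. d x y)"
  \<comment> \<open>\<open>SUP\<close> over an unbounded set of reals is an unspecified value, so
    the distances in \<open>U\<close>, and below those in its image, are shown to be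
    bounded.\<close>
  have bdd: "bdd_above ((\<lambda>(x, y). d x y) ` (U \<times> U))"
    using bnd U by (auto simp: bdd_above_def)
  have upper: "d x y \<le> D" if "x \<in> U" "y \<in> U" for x y
    unfolding D_def using cSUP_upper[OF _ bdd, of "(x, y)"] that by simp
  have D0: "0 \<le> D" using ne upper nonneg by (meson all_not_in_conv order_trans)
  let ?V = "f ` (U \<inter> A)"
  have Vne: "?V \<times> ?V \<noteq> {}" using ne by auto
  have le: "(SUP (x, y)\<in>?V \<times> ?V. d x y) \<le> L * D"
  proof (rule cSUP_least[OF Vne], clarify)
    fix x y assume "x \<in> U" "x \<in> A" "y \<in> U" "y \<in> A"
    then have "d (f x) (f y) \<le> L * d x y" "L * d x y \<le> L * D"
      using f upper L by (auto intro!: mult_left_mono)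
    then show "d (f x) (f y) \<le> L * D" by linarith
  qed
  have "bdd_above ((\<lambda>(x, y). d x y) ` (?V \<times> ?V))"
    unfolding bdd_above_def
  proof (intro exI ballI)
    fix z assume "z \<in> (\<lambda>(x, y). d x y) ` (?V \<times> ?V)"
    then obtain x y where xy: "z = d (f x) (f y)" "x \<in> U" "x \<in> A" "y \<in> U" "y \<in> A" by auto
    then have "z \<le> L * d x y" "L * d x y \<le> L * D" using f upper L by (auto intro!: mult_left_mono)
    then show "z \<le> L * D" by linarith
  qed
  moreover obtain v where "v \<in> ?V" using ne by blast
  ultimately have ge: "0 \<le> (SUP (x, y)\<in>?V \<times> ?V. d x y)"
    by (intro cSUP_upper2[where x = "(v, v)"]) auto
  have "(SUP (x, y)\<in>?V \<times> ?V. d x y) powr s \<le> (L * D) powr s"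
    using le ge s by (intro powr_mono2) auto
  also have "\<dots> = L powr s * D powr s" using L D0 by (simp add: powr_mult)
  finally show ?thesis using ne by (simp add: diam_pow_def D_def)
qed

text \<open>A cover of \<open>A\<close> by sets \<open>U i\<close> is carried to the images of
  \<open>U i \<inter> A\<close>. Diameters up to \<open>\<delta>\<close> become diameters up to
  \<open>L * \<delta>\<close>, a change of scale that the supremum over all scales absorbs.\<close>

lemma hausdorff_outer_lipschitz:
  assumes bnd: "\<And>x y. x \<in> M \<Longrightarrow> y \<in> M \<Longrightarrow> d x y \<le> B" and s: "s \<ge> 0" and L: "L > 0"
    and f: "\<And>x y. x \<in> A \<Longrightarrow> y \<in> A \<Longrightarrow> d (f x) (f y) \<le> L * d x y"
    and fM: "f ` A \<subseteq> M"
  shows "hausdorff_outer M d s (f ` A) \<le> ennreal (L powr s) * hausdorff_outer M d s A"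
proof -
  \<comment> \<open>The estimate on contents carries \<open>?c'\<close>, the inverse of
    \<open>?c\<close>, on its left side, so that the infimum over covers stands alone on the right
    and \<open>INF_greatest\<close> applies.\<close>
  let ?c = "ennreal (L powr s)" and ?c' = "ennreal (L powr - s)"
  have cc: "?c' * ?c = 1"
    using L by (simp add: powr_minus flip: ennreal_mult)
  have content: "?c' * hausdorff_content M d s (L * \<delta>) (f ` A) \<le> hausdorff_content M d s \<delta> A" for \<delta>
    unfolding hausdorff_content_def[of _ _ _ \<delta>]
  proof (rule INF_greatest)
    fix U :: "nat \<Rightarrow> 'a set"
    assume "U \<in> {U. A \<subseteq> (\<Union>i. U i) \<and> (\<forall>i. U i \<subseteq> M \<and> (\<forall>x\<in>U i. \<forall>y\<in>U i. d x y \<le> \<delta>))}"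
    then have U: "A \<subseteq> (\<Union>i. U i)" "\<And>i. U i \<subseteq> M" "\<And>i x y. x \<in> U i \<Longrightarrow> y \<in> U i \<Longrightarrow> d x y \<le> \<delta>"
      by auto
    define V where "V i = f ` (U i \<inter> A)" for i
    have "V \<in> {V. f ` A \<subseteq> (\<Union>i. V i) \<and> (\<forall>i. V i \<subseteq> M \<and> (\<forall>x\<in>V i. \<forall>y\<in>V i. d x y \<le> L * \<delta>))}"
    proof (intro CollectI conjI allI ballI)
      show "f ` A \<subseteq> (\<Union>i. V i)" using U(1) unfolding V_def by blast
      show "V i \<subseteq> M" for i using fM unfolding V_def by blast
      fix i x y assume "x \<in> V i" "y \<in> V i"
      then obtain x' y' where "x = f x'" "y = f y'" "x' \<in> U i" "x' \<in> A" "y' \<in> U i" "y' \<in> A"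
        unfolding V_def by blast
      moreover then have "L * d x' y' \<le> L * \<delta>" using U(3) L by (auto intro!: mult_left_mono)
      ultimately show "d x y \<le> L * \<delta>" using f[of x' y'] by auto
    qed
    then have "hausdorff_content M d s (L * \<delta>) (f ` A) \<le> (\<Sum>i. ennreal (diam_pow d s (V i)))"
      unfolding hausdorff_content_def by (rule INF_lower)
    also have "\<dots> \<le> (\<Sum>i. ?c * ennreal (diam_pow d s (U i)))"
    proof (intro suminf_le allI)
      fix i
      have "ennreal (diam_pow d s (V i)) \<le> ennreal (L powr s * diam_pow d s (U i))"
        unfolding V_def by (intro ennreal_leI diam_pow_lipschitz[OF bnd s L f U(2)])
      then show "ennreal (diam_pow d s (V i)) \<le> ?c * ennreal (diam_pow d s (U i))"
        by (simp add: ennreal_mult' )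
    qed auto
    also have "\<dots> = ?c * (\<Sum>i. ennreal (diam_pow d s (U i)))" by simp
    finally have "?c' * hausdorff_content M d s (L * \<delta>) (f ` A)
        \<le> ?c' * (?c * (\<Sum>i. ennreal (diam_pow d s (U i))))"
      by (rule mult_left_mono) simp
    then show "?c' * hausdorff_content M d s (L * \<delta>) (f ` A) \<le> (\<Sum>i. ennreal (diam_pow d s (U i)))"
      by (simp only: mult.assoc[symmetric] cc mult_1)
  qed
  show ?thesis
    unfolding hausdorff_outer_def[of _ _ _ "f ` A"]
  proof (rule SUP_least)
    fix \<delta> :: real assume \<delta>: "\<delta> \<in> {0<..}"
    have "?c' * hausdorff_content M d s \<delta> (f ` A) \<le> hausdorff_content M d s (\<delta> / L) A"
      using content[of "\<delta> / L"] L by simp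
    also have "\<dots> \<le> hausdorff_outer M d s A"
      unfolding hausdorff_outer_def using \<delta> L by (intro SUP_upper) auto
    finally have "?c * (?c' * hausdorff_content M d s \<delta> (f ` A)) \<le> ?c * hausdorff_outer M d s A"
      by (rule mult_left_mono) simp
    then show "hausdorff_content M d s \<delta> (f ` A) \<le> ?c * hausdorff_outer M d s A"
      by (simp only: mult.assoc[symmetric] mult.commute[of ?c ?c'] cc mult_1)
  qed
qed

section \<open>Hausdorff measure on the Borel sets\<close>

lemma openin_Pow: "{U. openin mtopology U} \<subseteq> Pow M"
  using openin_subset by fastforce

lemma sets_hausdorff_measure: "sets (hausdorff_measure M d s) = sigma_sets M {U. openin mtopology U}"
  unfolding hausdorff_measure_def using openin_Pow by (simp add: sets_measure_of)

lemma space_hausdorff_measure [simp]: "space (hausdorff_measure M d s) = M"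
  unfolding hausdorff_measure_def using openin_Pow by (simp add: space_measure_of)

lemma openin_hausdorff_measure: "openin mtopology U \<Longrightarrow> U \<in> sets (hausdorff_measure M d s)"
  by (simp add: sets_hausdorff_measure)

lemma measurable_hausdorff_measureI:
  assumes "f \<in> M \<rightarrow> M" "\<And>U. openin mtopology U \<Longrightarrow> openin mtopology (f -` U \<inter> M)"
  shows "f \<in> measurable (hausdorff_measure M d s) (hausdorff_measure M d s)"
proof (subst (2) hausdorff_measure_def, rule measurable_measure_of)
  show "f \<in> space (hausdorff_measure M d s) \<rightarrow> M" using assms(1) by simp
  fix U assume "U \<in> {U. openin mtopology U}"
  then show "f -` U \<inter> space (hausdorff_measure M d s) \<in> sets (hausdorff_measure M d s)"
    using assms(2) by (simp add: openin_hausdorff_measure)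
qed (rule openin_Pow)

text \<open>If the Hausdorff outer measure failed to be additive on Borel sets, \<^const>\<open>measure_of\<close> would
  return the zero measure. No appeal to Caratheodory's theorem is needed, because both alternatives
  satisfy all that is used below.\<close>

lemma emeasure_hausdorff_measure_cases:
  "(\<forall>A\<in>sets (hausdorff_measure M d s). emeasure (hausdorff_measure M d s) A = hausdorff_outer M d s A) \<or>
   (\<forall>A. emeasure (hausdorff_measure M d s) A = 0)"
proof (cases "measure_space M (sigma_sets M {U. openin mtopology U}) (hausdorff_outer M d s)")
  case True
  then show ?thesis
    unfolding sets_hausdorff_measure
    unfolding hausdorff_measure_def emeasure_measure_of_conv by simp
next
  case False
  then show ?thesis unfolding hausdorff_measure_def emeasure_measure_of_conv by simp
qed

lemma emeasure_hausdorff_measure_lipschitz: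
  assumes "\<And>x y. x \<in> M \<Longrightarrow> y \<in> M \<Longrightarrow> d x y \<le> B" and "s \<ge> 0" and "L > 0"
    and "\<And>x y. x \<in> A \<Longrightarrow> y \<in> A \<Longrightarrow> d (f x) (f y) \<le> L * d x y"
    and A: "A \<in> sets (hausdorff_measure M d s)" and fA: "f ` A \<in> sets (hausdorff_measure M d s)"
  shows "emeasure (hausdorff_measure M d s) (f ` A)
    \<le> ennreal (L powr s) * emeasure (hausdorff_measure M d s) A"
proof -
  have "f ` A \<subseteq> M" using sets.sets_into_space[OF fA] by simp
  then show ?thesis
    using emeasure_hausdorff_measure_cases[of s] hausdorff_outer_lipschitz[OF assms(1-4)] A fA by auto
qed

text \<open>Every nonempty member of a cover weighs 1 at exponent 0. This later excludes
  \<open>D = 0\<close>, where a point would have positive measure.\<close>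

lemma hausdorff_outer_0_ge_1:
  assumes "A \<noteq> {}" shows "1 \<le> hausdorff_outer M d 0 A"
proof -
  have "1 \<le> hausdorff_content M d 0 1 A"
    unfolding hausdorff_content_def
  proof (rule INF_greatest)
    fix U :: "nat \<Rightarrow> 'a set"
    assume "U \<in> {U. A \<subseteq> (\<Union>i. U i) \<and> (\<forall>i. U i \<subseteq> M \<and> (\<forall>x\<in>U i. \<forall>y\<in>U i. d x y \<le> 1))}"
    then obtain i where "U i \<noteq> {}" using assms by blast
    then have "1 = ennreal (diam_pow d 0 (U i))" by (simp add: diam_pow_def)
    also have "\<dots> \<le> (\<Sum>i. ennreal (diam_pow d 0 (U i)))"
      using sum_le_suminf[of "\<lambda>i. ennreal (diam_pow d 0 (U i))" "{i}"] by simp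
    finally show "1 \<le> (\<Sum>i. ennreal (diam_pow d 0 (U i)))" .
  qed
  also have "\<dots> \<le> hausdorff_outer M d 0 A"
    unfolding hausdorff_outer_def by (intro SUP_upper) auto
  finally show ?thesis .
qed

end

lemma emeasure_le_by_partition:
  fixes A :: "nat \<Rightarrow> 'a set"
  assumes A: "\<And>n. A n \<in> sets N" and sets: "sets N' = sets N" and dis: "disjoint_family A"
    and le: "\<And>n. emeasure N (A n) \<le> c * emeasure N' (A n)"
  shows "emeasure N (\<Union>n. A n) \<le> c * emeasure N' (\<Union>n. A n)"
proof -
  have "emeasure N (\<Union>n. A n) = (\<Sum>n. emeasure N (A n))"
    using A dis by (intro suminf_emeasure[symmetric]) auto
  also have "\<dots> \<le> (\<Sum>n. c * emeasure N' (A n))" by (intro suminf_le le) auto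
  also have "\<dots> = c * (\<Sum>n. emeasure N' (A n))" by simp
  also have "(\<Sum>n. emeasure N' (A n)) = emeasure N' (\<Union>n. A n)"
    using A dis sets by (intro suminf_emeasure) auto
  finally show ?thesis .
qed

lemma ennreal_le_if_le_powr:
  fixes a b :: ennreal
  assumes "\<And>l::real. l > 1 \<Longrightarrow> a \<le> ennreal (l powr s) * b"
  shows "a \<le> b"
proof (rule LIMSEQ_le_const)
  have "(\<lambda>n. (1 + 1 / real (Suc n)) powr s) \<longlonglongrightarrow> (1 + 0) powr s"
    using LIMSEQ_inverse_real_of_nat by (intro tendsto_intros) (auto simp: inverse_eq_divide)
  then have "(\<lambda>n. ennreal ((1 + 1 / real (Suc n)) powr s)) \<longlonglongrightarrow> ennreal 1"
    by (intro tendsto_ennrealI) simp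
  then have "(\<lambda>n. ennreal ((1 + 1 / real (Suc n)) powr s) * b) \<longlonglongrightarrow> ennreal 1 * b"
    by (intro tendsto_mult_ennreal tendsto_const) auto
  then show "(\<lambda>n. ennreal ((1 + 1 / real (Suc n)) powr s) * b) \<longlonglongrightarrow> b" by simp
  show "\<exists>N. \<forall>n\<ge>N. a \<le> ennreal ((1 + 1 / real (Suc n)) powr s) * b"
    using assms by (auto simp del: of_nat_Suc)
qed

context Metric_space
begin

text \<open>On \<open>{b l\<^sup>n \<le> j < b l\<^sup>n\<^sup>+\<^sup>1}\<close> the map is a similarity up to a factor \<open>l\<close>; then \<open>l\<close> tends to \<open>1\<close>.\<close>

lemma hausdorff_measure_conformal:
  fixes s B b :: real
  defines "N \<equiv> hausdorff_measure M d s"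
  assumes bnd: "\<And>x y. x \<in> M \<Longrightarrow> y \<in> M \<Longrightarrow> d x y \<le> B" and s: "s \<ge> 0"
    and S: "S \<in> measurable N N" and T: "T \<in> measurable N N"
    and TS: "\<And>x. x \<in> M \<Longrightarrow> T (S x) = x" and ST: "\<And>x. x \<in> M \<Longrightarrow> S (T x) = x"
    and j: "j \<in> borel_measurable N" and b: "b > 0" and jb: "\<And>x. x \<in> M \<Longrightarrow> b \<le> j x"
    and conf: "\<And>x y. x \<in> M \<Longrightarrow> y \<in> M \<Longrightarrow> d (S x) (S y) = sqrt (j x) * sqrt (j y) * d x y"
  shows "distr N N T = density N (\<lambda>x. ennreal (j x powr s))"
proof (rule measure_eqI)
  show "sets (distr N N T) = sets (density N (\<lambda>x. ennreal (j x powr s)))" by simp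
  fix A assume "A \<in> sets (distr N N T)"
  then have A: "A \<in> sets N" by simp
  have sp: "space N = M" by (simp add: N_def)
  have SM: "S x \<in> M" if "x \<in> M" for x using measurable_space[OF S] that sp by auto
  have TM: "T x \<in> M" if "x \<in> M" for x using measurable_space[OF T] that sp by auto
  have img: "S ` E = T -` E \<inter> M" if "E \<subseteq> M" for E
  proof
    show "S ` E \<subseteq> T -` E \<inter> M" using that SM TS by auto
    show "T -` E \<inter> M \<subseteq> S ` E" using ST by force
  qed
  have sub: "E \<subseteq> M" if "E \<in> sets N" for E using sets.sets_into_space[OF that] sp by simp
  have SE: "S ` E \<in> sets N" if "E \<in> sets N" for E
    using measurable_sets[OF T that] img[OF sub[OF that]] sp by simp
  have distr: "emeasure (distr N N T) E = emeasure N (S ` E)" if "E \<in> sets N" for E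
    using that T img[OF sub[OF that]] by (simp add: emeasure_distr sp)
  have dens: "emeasure (density N (\<lambda>x. ennreal (j x powr s))) E =
      (\<integral>\<^sup>+x. ennreal (j x powr s) * indicator E x \<partial>N)" if "E \<in> sets N" for E
    using that j by (intro emeasure_density) auto
  \<comment> \<open>On \<open>E\<close> the factor \<open>sqrt (j x) * sqrt (j y)\<close> lies
    between \<open>a\<close> and \<open>a * l\<close>, so \<open>S\<close> is
    \<open>a * l\<close>-Lipschitz there and \<open>T\<close> is \<open>1 / a\<close>-Lipschitz on
    the image. The density lies between \<open>a powr s\<close> and \<open>(a * l) powr s\<close>,
    so either comparison loses only \<open>l powr s\<close>.\<close>
  have slice: "emeasure (distr N N T) E \<le> ennreal (l powr s) * emeasure (density N (\<lambda>x. ennreal (j x powr s))) E \<and>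
      emeasure (density N (\<lambda>x. ennreal (j x powr s))) E \<le> ennreal (l powr s) * emeasure (distr N N T) E"
    if E: "E \<in> sets N" and a: "a > 0" and l: "l > 1"
      and jE: "\<And>x. x \<in> E \<Longrightarrow> a \<le> j x \<and> j x < a * l" for E a l
  proof
    have "d (S x) (S y) \<le> a * l * d x y" if "x \<in> E" "y \<in> E" for x y
    proof -
      have "sqrt (j x) * sqrt (j y) \<le> sqrt (a * l) * sqrt (a * l)"
        using jE[OF that(1)] jE[OF that(2)] a by (intro mult_mono) auto
      then have "sqrt (j x) * sqrt (j y) \<le> a * l" using a l by simp
      then show ?thesis using conf[of x y] sub[OF E] that nonneg[of x y]
        by (metis mult_right_mono subsetD)
    qed
    then have "emeasure N (S ` E) \<le> ennreal ((a * l) powr s) * emeasure N E"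
      unfolding N_def using bnd s a l E SE[OF E]
      by (intro emeasure_hausdorff_measure_lipschitz) (auto simp: N_def)
    also have "\<dots> = ennreal (l powr s) * (\<integral>\<^sup>+x. ennreal (a powr s) * indicator E x \<partial>N)"
      unfolding nn_integral_cmult_indicator[OF E] using a l by (simp add: powr_mult ennreal_mult mult_ac)
    also have "\<dots> \<le> ennreal (l powr s) * (\<integral>\<^sup>+x. ennreal (j x powr s) * indicator E x \<partial>N)"
      using jE a s by (intro mult_left_mono nn_integral_mono)
        (auto split: split_indicator intro!: ennreal_leI powr_mono2)
    finally show "emeasure (distr N N T) E
        \<le> ennreal (l powr s) * emeasure (density N (\<lambda>x. ennreal (j x powr s))) E"
      by (simp add: distr[OF E] dens[OF E])
    have "d (T x) (T y) \<le> (1 / a) * d x y" if xy: "x \<in> S ` E" "y \<in> S ` E" for x y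
    proof -
      obtain x' y' where *: "x = S x'" "y = S y'" "x' \<in> E" "y' \<in> E" using xy by blast
      have "sqrt a * sqrt a \<le> sqrt (j x') * sqrt (j y')"
        using jE[OF *(3)] jE[OF *(4)] a by (intro mult_mono) auto
      then have "a * d x' y' \<le> sqrt (j x') * sqrt (j y') * d x' y'"
        using a by (intro mult_right_mono) auto
      moreover have "x' \<in> M" "y' \<in> M" using sub[OF E] * by auto
      ultimately have "a * d x' y' \<le> d x y" using conf[of x' y'] * by simp
      moreover have "T x = x'" "T y = y'" using TS \<open>x' \<in> M\<close> \<open>y' \<in> M\<close> * by auto
      ultimately show ?thesis using a by (simp add: field_simps)
    qed
    then have "emeasure N (T ` S ` E) \<le> ennreal ((1 / a) powr s) * emeasure N (S ` E)"
      unfolding N_def using bnd s a E SE[OF E] TS sub[OF E]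
      by (intro emeasure_hausdorff_measure_lipschitz) (auto simp: N_def image_image subset_eq)
    moreover have "T ` S ` E = E" using TS sub[OF E] by (force simp: image_image)
    ultimately have le: "emeasure N E \<le> ennreal ((1 / a) powr s) * emeasure N (S ` E)" by simp
    have "(\<integral>\<^sup>+x. ennreal (j x powr s) * indicator E x \<partial>N)
        \<le> (\<integral>\<^sup>+x. ennreal ((a * l) powr s) * indicator E x \<partial>N)"
      using jE a s by (intro nn_integral_mono)
        (force split: split_indicator intro!: ennreal_leI powr_mono2)
    also have "\<dots> = ennreal ((a * l) powr s) * emeasure N E"
      using E by (simp add: nn_integral_cmult_indicator)
    also have "\<dots> \<le> ennreal ((a * l) powr s) * (ennreal ((1 / a) powr s) * emeasure N (S ` E))"
      by (intro mult_left_mono le) simp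
    also have "\<dots> = ennreal ((a * l) powr s * (1 / a) powr s) * emeasure N (S ` E)"
      by (simp add: ennreal_mult mult.assoc)
    also have "(a * l) powr s * (1 / a) powr s = l powr s"
      using a l by (simp add: powr_mult powr_divide)
    finally show "emeasure (density N (\<lambda>x. ennreal (j x powr s))) E
        \<le> ennreal (l powr s) * emeasure (distr N N T) E"
      by (simp add: distr[OF E] dens[OF E])
  qed
  have both: "emeasure (distr N N T) A \<le> ennreal (l powr s) * emeasure (density N (\<lambda>x. ennreal (j x powr s))) A \<and>
      emeasure (density N (\<lambda>x. ennreal (j x powr s))) A \<le> ennreal (l powr s) * emeasure (distr N N T) A"
    if l: "l > 1" for l
  proof -
    \<comment> \<open>Geometric slices of the values of \<open>j\<close>. Because \<open>j\<close>
      is bounded below by \<open>b > 0\<close>, natural exponents suffice and \<open>A\<close> is a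
      countable disjoint union of slices.\<close>
    define E where "E n = {x \<in> space N. x \<in> A \<and> b * l ^ n \<le> j x \<and> j x < b * l ^ n * l}" for n :: nat
    have E: "E n \<in> sets N" for n unfolding E_def using A j by measurable
    have UE: "(\<Union>n. E n) = A"
    proof
      show "A \<subseteq> (\<Union>n. E n)"
      proof
        fix x assume x: "x \<in> A"
        obtain m where "j x / b < l ^ m" using real_arch_pow[OF l] by blast
        then have ex: "j x < b * l ^ m" using b by (simp add: field_simps)
        define k where "k = (LEAST m. j x < b * l ^ m)"
        have k: "j x < b * l ^ k" unfolding k_def by (rule LeastI) (rule ex)
        have "k \<noteq> 0"
        proof
          assume "k = 0"
          then show False using k jb[of x] x sub[OF A] by auto
        qed
        then obtain n where n: "k = Suc n" using not0_implies_Suc by blast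
        have "\<not> j x < b * l ^ n"
          using not_less_Least[of n "\<lambda>m. j x < b * l ^ m"] n by (simp add: k_def)
        then have "x \<in> E n" using x k n sub[OF A] sp by (auto simp: E_def mult_ac)
        then show "x \<in> (\<Union>n. E n)" by blast
      qed
    qed (auto simp: E_def)
    have dis: "disjoint_family E"
      unfolding disjoint_family_on_def
    proof (intro ballI impI)
      have "E m \<inter> E n = {}" if "m < n" for m n
      proof -
        have "b * l ^ m * l \<le> b * l ^ n"
          using b l power_increasing[of "Suc m" n l] that by (simp add: mult_ac)
        then show ?thesis by (auto simp: E_def)
      qed
      then show "E m \<inter> E n = {}" if "m \<noteq> n" for m n
        using that by (metis Int_commute nat_neq_iff)
    qed
    have sl: "emeasure (distr N N T) (E n) \<le> ennreal (l powr s) * emeasure (density N (\<lambda>x. ennreal (j x powr s))) (E n)"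
      "emeasure (density N (\<lambda>x. ennreal (j x powr s))) (E n) \<le> ennreal (l powr s) * emeasure (distr N N T) (E n)" for n
      using slice[OF E, of "b * l ^ n" l n] b l by (auto simp: E_def)
    show ?thesis
      using emeasure_le_by_partition[of E "distr N N T" "density N (\<lambda>x. ennreal (j x powr s))"]
        emeasure_le_by_partition[of E "density N (\<lambda>x. ennreal (j x powr s))" "distr N N T"]
        E dis sl UE by auto
  qed
  show "emeasure (distr N N T) A = emeasure (density N (\<lambda>x. ennreal (j x powr s))) A"
    using ennreal_le_if_le_powr[of "emeasure (distr N N T) A" s]
      ennreal_le_if_le_powr[of "emeasure (density N (\<lambda>x. ennreal (j x powr s))) A" s] both
    by (meson antisym)
qed

end

section \<open>Functionals on Lebesgue spaces\<close>

text \<open>Absolute continuity of the integral. Dominated convergence makes the part of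
  \<open>u\<close> above some level \<open>n\<close> smaller than \<open>e / 2\<close>; below this
  level a set of measure less than \<open>r\<close> contributes at most
  \<open>n * r\<close>.\<close>

lemma integral_small_sets:
  fixes u :: "'a \<Rightarrow> real"
  assumes u: "integrable N u" and pos: "\<And>x. 0 \<le> u x" and e: "e > 0"
  shows "\<exists>r>0. \<forall>A\<in>sets N. emeasure N A < ennreal r \<longrightarrow> (\<integral>x. indicator A x * u x \<partial>N) < e"
proof -
  have "(\<lambda>n. \<integral>x. u x - min (u x) (real n) \<partial>N) \<longlonglongrightarrow> (\<integral>x. 0 \<partial>N)"
  proof (rule integral_dominated_convergence[where w = u])
    show "AE x in N. (\<lambda>n. u x - min (u x) (real n)) \<longlonglongrightarrow> 0"
    proof (rule AE_I2)
      fix x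
      obtain m where "u x \<le> real m" using real_arch_simple by blast
      then have "\<forall>n\<ge>m. u x - min (u x) (real n) = 0" by (auto simp: min_def)
      then show "(\<lambda>n. u x - min (u x) (real n)) \<longlonglongrightarrow> 0"
        by (intro tendsto_eventually) (auto simp: eventually_sequentially)
    qed
  qed (use u pos in \<open>auto intro!: AE_I2 simp: min_def\<close>)
  then obtain n where n: "(\<integral>x. u x - min (u x) (real n) \<partial>N) < e / 2"
    using order_tendstoD(2)[of "\<lambda>n. \<integral>x. u x - min (u x) (real n) \<partial>N" 0 sequentially "e / 2"] e
    by (auto simp: eventually_sequentially)
  \<comment> \<open>Gives \<open>n * r \<le> e / 2\<close>; the added 1 covers
    \<open>n = 0\<close>.\<close>
  define r where "r = e / (2 * (real n + 1))"
  have r: "r > 0" using e by (simp add: r_def)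
  have "(\<integral>x. indicator A x * u x \<partial>N) < e" if A: "A \<in> sets N" and small: "emeasure N A < ennreal r" for A
  proof -
    have fin: "emeasure N A < \<infinity>" using small by (metis ennreal_less_top infinity_ennreal_def order_less_trans)
    then have m: "measure N A < r"
      using small r by (simp add: emeasure_eq_ennreal_measure ennreal_less_iff less_top)
    have int: "integrable N (\<lambda>x. u x - min (u x) (real n))"
      by (rule Bochner_Integration.integrable_bound[OF u]) (use u pos in \<open>auto simp: min_def\<close>)
    have "(\<integral>x. indicator A x * u x \<partial>N)
        \<le> (\<integral>x. (u x - min (u x) (real n)) + real n * indicator A x \<partial>N)"
    proof (rule integral_mono)
      show "integrable N (\<lambda>x. indicator A x * u x)"
        using integrable_mult_indicator[OF A u] by simp
      show "integrable N (\<lambda>x. (u x - min (u x) (real n)) + real n * indicator A x)"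
        using int A fin by (intro Bochner_Integration.integrable_add integrable_mult_right) auto
    qed (use pos in \<open>auto split: split_indicator simp: min_def\<close>)
    also have "\<dots> = (\<integral>x. u x - min (u x) (real n) \<partial>N) + real n * measure N A"
      using int A fin by (subst Bochner_Integration.integral_add) auto
    also have "\<dots> < e / 2 + e / 2"
    proof (rule add_less_le_mono[OF n])
      have "real n * measure N A \<le> real n * r" using m by (intro mult_left_mono) auto
      also have "\<dots> \<le> e / 2" using e by (simp add: r_def field_simps)
      finally show "real n * measure N A \<le> e / 2" .
    qed
    finally show ?thesis by simp
  qed
  then show ?thesis using r by blast
qed

section \<open>Lebesgue functions and absolute continuity of functionals\<close>

lemma lp_functionsD:
  assumes "f \<in> lp_functions p N"
  shows "f \<in> borel_measurable N" "integrable N (\<lambda>x. cmod (f x) powr p)"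
  using assms by (auto simp: lp_functions_def)

lemma lp_norm_nonneg: "0 \<le> lp_norm p N f"
  by (simp add: lp_norm_def)

lemma lp_norm_powr: "p > 0 \<Longrightarrow> lp_norm p N f powr p = (\<integral>x. cmod (f x) powr p \<partial>N)"
  by (simp add: lp_norm_def powr_powr)

lemma lp_norm_le_iff:
  assumes "p > 0" "R \<ge> 0"
  shows "lp_norm p N f \<le> R \<longleftrightarrow> (\<integral>x. cmod (f x) powr p \<partial>N) \<le> R powr p"
  unfolding lp_norm_powr[OF assms(1), symmetric]
  using assms lp_norm_nonneg[of p N f] by (metis less_imp_le not_le powr_less_mono2 powr_mono2)

lemma lp_functions_cmult:
  assumes "f \<in> lp_functions p N"
  shows "(\<lambda>x. c * f x) \<in> lp_functions p N"
  using lp_functionsD[OF assms] by (auto simp: lp_functions_def norm_mult powr_mult)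

lemma lp_norm_cmult:
  assumes "p > 0"
  shows "lp_norm p N (\<lambda>x. c * f x) = cmod c * lp_norm p N f"
  using assms by (simp add: lp_norm_def norm_mult powr_mult powr_powr)

lemma lp_functions_add:
  assumes p: "p > 0" and f: "f \<in> lp_functions p N" and g: "g \<in> lp_functions p N"
  shows "(\<lambda>x. f x + g x) \<in> lp_functions p N"
proof -
  note [measurable] = lp_functionsD(1)[OF f] lp_functionsD(1)[OF g]
  have "integrable N (\<lambda>x. cmod (f x + g x) powr p)"
  proof (rule Bochner_Integration.integrable_bound)
    show "integrable N (\<lambda>x. 2 powr p * (cmod (f x) powr p + cmod (g x) powr p))"
      using lp_functionsD(2)[OF f] lp_functionsD(2)[OF g] by auto
    show "AE x in N. norm (cmod (f x + g x) powr p)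
        \<le> norm (2 powr p * (cmod (f x) powr p + cmod (g x) powr p))"
    proof (rule AE_I2)
      fix x
      let ?m = "max (cmod (f x)) (cmod (g x))"
      have "cmod (f x + g x) \<le> 2 * ?m"
        using norm_triangle_ineq[of "f x" "g x"] by linarith
      then have "cmod (f x + g x) powr p \<le> (2 * ?m) powr p"
        using p by (intro powr_mono2) auto
      also have "\<dots> = 2 powr p * ?m powr p" by (simp add: powr_mult)
      also have "\<dots> \<le> 2 powr p * (cmod (f x) powr p + cmod (g x) powr p)"
        by (intro mult_left_mono) (auto simp: max_def)
      finally show "norm (cmod (f x + g x) powr p)
          \<le> norm (2 powr p * (cmod (f x) powr p + cmod (g x) powr p))" by simp
    qed
  qed measurable
  then show ?thesis by (simp add: lp_functions_def)
qed

lemma lp_functions_indicator: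
  assumes p: "p > 0" and f: "f \<in> lp_functions p N" and A: "A \<in> sets N"
  shows "(\<lambda>x. indicator A x * f x) \<in> lp_functions p N"
proof -
  note [measurable] = lp_functionsD(1)[OF f] A
  have "integrable N (\<lambda>x. cmod (indicator A x * f x) powr p)"
    by (rule Bochner_Integration.integrable_bound[OF lp_functionsD(2)[OF f]])
      (auto split: split_indicator)
  then show ?thesis by (simp add: lp_functions_def)
qed

text \<open>Two values of a functional will be rotated onto the positive real axis, so that their
  real parts add without cancellation.\<close>

lemma rotate_to_real: "\<exists>c. cmod c = 1 \<and> c * z = complex_of_real (cmod z)"
proof (cases "z = 0")
  case False
  have "z * cnj z / complex_of_real (cmod z) = complex_of_real (cmod z)"
    using False by (simp add: complex_norm_square[symmetric] power2_eq_square)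
  then show ?thesis
    using False by (intro exI[of _ "cnj z / complex_of_real (cmod z)"]) (auto simp: norm_divide mult.commute)
qed (auto intro: exI[of _ 1])

text \<open>A functional on \<open>L\<^sup>p\<close>, \<open>p > 1\<close>, is absolutely continuous, without appeal to duality: perturb
  a near-maximizer \<open>f\<close> of unit norm to \<open>f 1\<^bsub>-A\<^esub> + l h\<close> with \<open>h\<close> supported on a small set \<open>A\<close>. The norm grows by
  at most \<open>l\<^sup>p\<close>, so the linear gain \<open>l |F h|\<close> must be \<open>O(l\<^sup>p)\<close>.\<close>

lemma lp_functional_small_sets:
  fixes F :: "('a \<Rightarrow> complex) \<Rightarrow> complex"
  assumes p: "p > 1"
    and add: "\<And>f g. f \<in> lp_functions p N \<Longrightarrow> g \<in> lp_functions p N \<Longrightarrow> F (\<lambda>x. f x + g x) = F f + F g"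
    and scale: "\<And>c f. f \<in> lp_functions p N \<Longrightarrow> F (\<lambda>x. c * f x) = c * F f"
    and bound: "\<And>f. f \<in> lp_functions p N \<Longrightarrow> cmod (F f) \<le> C * lp_norm p N f"
    and e: "e > 0"
  shows "\<exists>r>0. \<forall>A\<in>sets N. \<forall>h\<in>lp_functions p N. emeasure N A < ennreal r \<longrightarrow>
    (\<forall>x\<in>space N - A. h x = 0) \<longrightarrow> lp_norm p N h \<le> 1 \<longrightarrow> cmod (F h) \<le> e"
proof -
  have p0: "p > 0" using p by simp
  define S where "S = {cmod (F f) | f. f \<in> lp_functions p N \<and> lp_norm p N f \<le> 1}"
  \<comment> \<open>\<open>K\<close> is the operator norm of \<open>F\<close>, as \<open>FK\<close>
    shows below. A near-maximizer exploits that this constant is sharp, which the given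
    \<open>C\<close> may not be.\<close>
  define K where "K = Sup S"
  have zero: "(\<lambda>x. 0) \<in> lp_functions p N" by (simp add: lp_functions_def)
  have "F (\<lambda>x. 0) = 0" using scale[OF zero, of 0] by simp
  then have S0: "0 \<in> S"
    unfolding S_def using zero by (intro CollectI exI[of _ "\<lambda>x. 0"]) (auto simp: lp_norm_def)
  have bdd: "bdd_above S"
    unfolding bdd_above_def
  proof (intro exI ballI)
    fix s assume "s \<in> S"
    then obtain f where f: "s = cmod (F f)" "f \<in> lp_functions p N" "lp_norm p N f \<le> 1"
      unfolding S_def by blast
    have "s \<le> C * lp_norm p N f" using bound f by simp
    also have "\<dots> \<le> \<bar>C\<bar> * lp_norm p N f" by (intro mult_right_mono lp_norm_nonneg) auto
    also have "\<dots> \<le> \<bar>C\<bar> * 1" using f by (intro mult_left_mono) auto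
    finally show "s \<le> \<bar>C\<bar>" by simp
  qed
  have K0: "0 \<le> K" unfolding K_def using S0 bdd by (rule cSup_upper)
  have FK: "cmod (F f) \<le> K * lp_norm p N f" if f: "f \<in> lp_functions p N" for f
  proof (cases "lp_norm p N f = 0")
    case True
    then show ?thesis using bound[OF f] by simp
  next
    case False
    define a where "a = lp_norm p N f"
    have a: "a > 0" using False lp_norm_nonneg[of p N f] by (simp add: a_def)
    have "lp_norm p N (\<lambda>x. complex_of_real (1 / a) * f x) = cmod (complex_of_real (1 / a)) * a"
      unfolding a_def by (rule lp_norm_cmult[OF p0])
    then have "lp_norm p N (\<lambda>x. complex_of_real (1 / a) * f x) \<le> 1"
      using a by (simp add: norm_divide)
    then have "cmod (F (\<lambda>x. complex_of_real (1 / a) * f x)) \<in> S"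
      unfolding S_def using lp_functions_cmult[OF f] by blast
    then have "cmod (F (\<lambda>x. complex_of_real (1 / a) * f x)) \<le> K"
      unfolding K_def using bdd by (rule cSup_upper)
    then have "cmod (complex_of_real (1 / a) * F f) \<le> K" by (simp only: scale[OF f])
    then show ?thesis using a by (simp add: norm_mult norm_divide field_simps flip: a_def)
  qed
  \<comment> \<open>Solves \<open>(K + 1) * l powr (p - 1) = e / 3\<close>, so that the growth of
    the norm costs \<open>K * l powr p \<le> e / 3 * l\<close>. This is where \<open>p > 1\<close>
    enters: the exponent \<open>p - 1\<close> has to be positive.\<close>
  define l where "l = (e / (3 * (K + 1))) powr (1 / (p - 1))"
  have l: "l > 0" using e K0 by (simp add: l_def)
  have "l powr (p - 1) = e / (3 * (K + 1))"
    using e K0 p by (simp add: l_def powr_powr)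
  then have "(K + 1) * l powr (p - 1) = e / 3" using K0 by (simp add: field_simps)
  then have "K * l powr (p - 1) \<le> e / 3"
    using powr_ge_zero[of l "p - 1"] unfolding distrib_right by linarith
  then have "K * l powr (p - 1) * l \<le> e / 3 * l"
    using l by (intro mult_right_mono) auto
  moreover have "l powr (p - 1) * l = l powr p"
    using l powr_add[of l "p - 1" 1] by simp
  ultimately have Kl: "K * l powr p \<le> e / 3 * l" by (simp add: mult.assoc)
  have "\<exists>s\<in>S. K - e / 3 * l < s"
    unfolding K_def using S0 e l by (intro less_cSupD) auto
  then obtain f' where f': "f' \<in> lp_functions p N" "lp_norm p N f' \<le> 1" "K - e / 3 * l < cmod (F f')"
    unfolding S_def by blast
  obtain c where c: "cmod c = 1" "c * F f' = complex_of_real (cmod (F f'))"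
    using rotate_to_real by blast
  define f where "f = (\<lambda>x. c * f' x)"
  have f: "f \<in> lp_functions p N" unfolding f_def by (rule lp_functions_cmult[OF f'(1)])
  have fn: "(\<integral>x. cmod (f x) powr p \<partial>N) \<le> 1"
    using f'(2) c lp_norm_le_iff[OF p0, of 1 N f'] by (simp add: f_def norm_mult)
  have Ff: "F f = complex_of_real (cmod (F f'))" unfolding f_def scale[OF f'(1)] c(2) ..
  \<comment> \<open>Bound for the norm of the piece of \<open>f\<close> cut away on
    \<open>A\<close>, with \<open>K * k \<le> e / 3 * l\<close>. The near-maximizer, this cut and
    the norm growth each lose \<open>e / 3 * l\<close>, in total \<open>e * l\<close>.\<close>
  define k where "k = e / 3 * l / (K + 1)"
  have k: "k > 0" using e l K0 by (simp add: k_def)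
  obtain r where r: "r > 0"
    "\<And>A. A \<in> sets N \<Longrightarrow> emeasure N A < ennreal r \<Longrightarrow> (\<integral>x. indicator A x * (cmod (f x) powr p) \<partial>N) < k powr p"
    using integral_small_sets[OF lp_functionsD(2)[OF f], of "k powr p"] k by auto
  have "cmod (F h) \<le> e" if A: "A \<in> sets N" and h: "h \<in> lp_functions p N" and small: "emeasure N A < ennreal r"
    and supp: "\<And>x. x \<in> space N - A \<Longrightarrow> h x = 0" and hn: "lp_norm p N h \<le> 1" for A h
  proof -
    obtain b where b: "cmod b = 1" "b * F h = complex_of_real (cmod (F h))"
      using rotate_to_real by blast
    define f1 where "f1 = (\<lambda>x. indicator A x * f x)"
    define f2 where "f2 = (\<lambda>x. indicator (space N - A) x * f x)"
    define h' where "h' = (\<lambda>x. complex_of_real l * b * h x)"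
    define g where "g = (\<lambda>x. f2 x + h' x)"
    have f1: "f1 \<in> lp_functions p N" unfolding f1_def by (rule lp_functions_indicator[OF p0 f A])
    have f2: "f2 \<in> lp_functions p N" unfolding f2_def using A by (intro lp_functions_indicator[OF p0 f]) auto
    have h': "h' \<in> lp_functions p N" unfolding h'_def by (rule lp_functions_cmult[OF h])
    have g: "g \<in> lp_functions p N" unfolding g_def by (rule lp_functions_add[OF p0 f2 h'])
    have "(\<lambda>x. cmod (f1 x) powr p) = (\<lambda>x. indicator A x * (cmod (f x) powr p))"
      by (auto simp: f1_def fun_eq_iff split: split_indicator)
    then have "lp_norm p N f1 powr p \<le> k powr p"
      using r(2)[OF A small] unfolding lp_norm_powr[OF p0] by simp
    then have "lp_norm p N f1 \<le> k"
      using lp_norm_le_iff[OF p0, of k N f1] k lp_norm_powr[OF p0, of N f1] by simp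
    then have "K * lp_norm p N f1 \<le> K * k" using K0 by (intro mult_left_mono)
    also have "\<dots> \<le> e / 3 * l" using e l K0 by (simp add: k_def field_simps)
    finally have Ff1: "cmod (F f1) \<le> e / 3 * l" using FK[OF f1] by simp
    \<comment> \<open>\<open>f2\<close> and \<open>h'\<close> have disjoint supports in
      \<open>space N\<close>, so their p-th powers add.\<close>
    have "(\<integral>x. cmod (g x) powr p \<partial>N) \<le> (\<integral>x. cmod (f x) powr p + l powr p * cmod (h x) powr p \<partial>N)"
    proof (rule integral_mono)
      show "integrable N (\<lambda>x. cmod (g x) powr p)" by (rule lp_functionsD(2)[OF g])
      show "integrable N (\<lambda>x. cmod (f x) powr p + l powr p * cmod (h x) powr p)"
        using lp_functionsD(2)[OF f] lp_functionsD(2)[OF h] by auto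
      fix x assume "x \<in> space N"
      then show "cmod (g x) powr p \<le> cmod (f x) powr p + l powr p * cmod (h x) powr p"
        using supp[of x] l b by (auto simp: g_def f2_def h'_def indicator_def norm_mult powr_mult)
    qed
    also have "\<dots> = (\<integral>x. cmod (f x) powr p \<partial>N) + l powr p * (\<integral>x. cmod (h x) powr p \<partial>N)"
      using lp_functionsD(2)[OF f] lp_functionsD(2)[OF h] by simp
    also have "\<dots> \<le> 1 + l powr p * 1"
      using fn hn lp_norm_le_iff[OF p0, of 1 N h] by (intro add_mono mult_left_mono) auto
    finally have "(\<integral>x. cmod (g x) powr p \<partial>N) \<le> 1 + l powr p" by simp
    \<comment> \<open>Enlarging \<open>1 + l powr p\<close> to its p-th power gives a norm bound
      without roots that still exceeds 1 only by \<open>l powr p\<close>.\<close>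
    also have "\<dots> = (1 + l powr p) powr 1" using l by simp
    also have "\<dots> \<le> (1 + l powr p) powr p" using p by (intro powr_mono) auto
    finally have "lp_norm p N g \<le> 1 + l powr p" using lp_norm_le_iff[OF p0, of "1 + l powr p" N g] by simp
    then have "K * lp_norm p N g \<le> K * (1 + l powr p)" using K0 by (intro mult_left_mono)
    then have Fg: "cmod (F g) \<le> K + e / 3 * l" using FK[OF g] Kl by (simp add: distrib_left)
    \<comment> \<open>\<open>f\<close> and \<open>f1 + f2\<close> need to agree only on
      \<open>space N\<close>. \<open>F\<close> acts on functions rather than classes, but its bound
      makes it vanish on a difference of norm 0.\<close>
    have "F f = F (\<lambda>x. f1 x + f2 x)"
    proof -
      have "lp_norm p N (\<lambda>x. f1 x + f2 x + (-1) * f x) = 0"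
      proof -
        have "(\<integral>x. cmod (f1 x + f2 x + (-1) * f x) powr p \<partial>N) = (\<integral>x. 0 \<partial>N)"
          by (rule Bochner_Integration.integral_cong) (auto simp: f1_def f2_def indicator_def)
        then show ?thesis by (simp add: lp_norm_def)
      qed
      then have "F (\<lambda>x. f1 x + f2 x + (-1) * f x) = 0"
        using FK[OF lp_functions_add[OF p0 lp_functions_add[OF p0 f1 f2] lp_functions_cmult[OF f, of "-1"]]] by simp
      then show ?thesis
        using add[OF lp_functions_add[OF p0 f1 f2] lp_functions_cmult[OF f, of "-1"]] scale[OF f, of "-1"]
        by simp
    qed
    also have "\<dots> = F f1 + F f2" by (rule add[OF f1 f2])
    finally have "F f2 = complex_of_real (cmod (F f')) - F f1" using Ff by simp
    moreover have "F g = F f2 + F h'" unfolding g_def by (rule add[OF f2 h'])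
    moreover have "F h' = complex_of_real (l * cmod (F h))"
      unfolding h'_def scale[OF h] using b(2) by (simp add: mult.assoc)
    ultimately have "F g = complex_of_real (cmod (F f')) - F f1 + complex_of_real (l * cmod (F h))"
      by simp
    then have "Re (F g) = cmod (F f') - Re (F f1) + l * cmod (F h)" by simp
    moreover have "Re (F g) \<le> cmod (F g)" "Re (F f1) \<le> cmod (F f1)" by (rule complex_Re_le_cmod)+
    ultimately have "l * cmod (F h) \<le> e * l" using Fg Ff1 f'(3) by simp
    then show ?thesis using l by (simp add: mult.commute)
  qed
  then show ?thesis using r(1) by blast
qed

section \<open>Densities of bounded functionals on a finite measure space\<close>

lemma (in finite_measure) integrable_indicator_finite:
  assumes "A \<in> sets M"
  shows "integrable M (indicator A :: 'a \<Rightarrow> 'b::{banach, second_countable_topology, real_normed_algebra_1})"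
  using assms by (intro integrable_const_bound[where B = 1]) (auto split: split_indicator)

text \<open>Adding \<open>c\<close> times the measure makes \<open>r\<close> nonnegative. The
  domination yields continuity at the empty set, hence countable additivity, and absolute
  continuity; the Radon-Nikodym density is then shifted back by \<open>c\<close>.\<close>

lemma (in finite_measure) bounded_additive_density:
  fixes r :: "'a set \<Rightarrow> real"
  assumes add: "\<And>A B. A \<in> sets M \<Longrightarrow> B \<in> sets M \<Longrightarrow> A \<inter> B = {} \<Longrightarrow> r (A \<union> B) = r A + r B"
    and bound: "\<And>A. A \<in> sets M \<Longrightarrow> \<bar>r A\<bar> \<le> c * measure M A"
  shows "\<exists>h. integrable M h \<and> (\<forall>A\<in>sets M. r A = (\<integral>x. indicator A x * h x \<partial>M))"
proof -
  define \<mu> where "\<mu> A = ennreal (r A + c * measure M A)" for A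
  have nonneg: "0 \<le> r A + c * measure M A" if "A \<in> sets M" for A
    using bound[OF that] by simp
  have pos: "positive (sets M) \<mu>"
    using bound[of "{}"] by (simp add: positive_def \<mu>_def)
  have "countably_additive (sets M) \<mu>"
  proof (rule sets.empty_continuous_imp_countably_additive[OF pos])
    show "additive (sets M) \<mu>"
      unfolding additive_def
    proof (intro ballI impI)
      fix A B assume AB: "A \<in> sets M" "B \<in> sets M" "A \<inter> B = {}"
      then have "r (A \<union> B) + c * measure M (A \<union> B) = (r A + c * measure M A) + (r B + c * measure M B)"
        by (simp add: add finite_measure_Union distrib_left)
      then show "\<mu> (A \<union> B) = \<mu> A + \<mu> B"
        unfolding \<mu>_def using nonneg AB by (simp add: ennreal_plus)
    qed
    show "\<forall>A\<in>sets M. \<mu> A \<noteq> \<infinity>" by (simp add: \<mu>_def)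
    fix A :: "nat \<Rightarrow> 'a set"
    assume A: "range A \<subseteq> sets M" "decseq A" "(\<Inter>i. A i) = {}"
    have "(\<lambda>i. measure M (A i)) \<longlonglongrightarrow> 0"
      using finite_Lim_measure_decseq[OF A(1,2)] A(3) by simp
    then have "(\<lambda>i. ennreal (2 * c * measure M (A i))) \<longlonglongrightarrow> ennreal (2 * c * 0)"
      by (intro tendsto_intros)
    then have L: "(\<lambda>i. ennreal (2 * c * measure M (A i))) \<longlonglongrightarrow> 0" by simp
    have "\<mu> (A i) \<le> ennreal (2 * c * measure M (A i))" for i
    proof -
      have "A i \<in> sets M" using A(1) by blast
      then show ?thesis unfolding \<mu>_def using bound by (intro ennreal_leI) (auto dest!: abs_le_D1)
    qed
    then show "(\<lambda>i. \<mu> (A i)) \<longlonglongrightarrow> 0"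
      by (intro tendsto_sandwich[OF _ _ tendsto_const L]) auto
  qed
  define N where "N = measure_of (space M) (sets M) \<mu>"
  have setsN: "sets N = sets M" by (simp add: N_def)
  have emN: "emeasure N A = \<mu> A" if "A \<in> sets M" for A
    unfolding N_def
    using emeasure_measure_of_sigma[OF sets.sigma_algebra_axioms pos \<open>countably_additive (sets M) \<mu>\<close> that] .
  have "absolutely_continuous M N"
    unfolding absolutely_continuous_def
  proof
    fix A assume "A \<in> null_sets M"
    then have A: "A \<in> sets M" "measure M A = 0" by (auto simp: measure_def)
    then have "r A = 0" using bound[of A] by simp
    then show "A \<in> null_sets N" using A emN[of A] by (simp add: null_sets_def setsN \<mu>_def)
  qed
  then obtain f where f: "f \<in> borel_measurable M" "density M f = N"
    using Radon_Nikodym setsN by blast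
  have fA: "(\<integral>\<^sup>+x. f x * indicator A x \<partial>M) = ennreal (r A + c * measure M A)" if "A \<in> sets M" for A
    using emeasure_density[OF f(1) that] emN[OF that] f(2) by (simp add: \<mu>_def)
  have "(\<integral>\<^sup>+x. f x \<partial>M) = (\<integral>\<^sup>+x. f x * indicator (space M) x \<partial>M)"
    by (rule nn_integral_cong) simp
  then have "(\<integral>\<^sup>+x. f x \<partial>M) \<noteq> \<infinity>" using fA[of "space M"] by simp
  then have "AE x in M. f x \<noteq> \<infinity>" by (rule nn_integral_PInf_AE[OF f(1)])
  then have ffin: "AE x in M. f x = ennreal (enn2real (f x))"
    by eventually_elim (simp add: less_top)
  define h' where "h' = (\<lambda>x. enn2real (f x))"
  have h'm: "h' \<in> borel_measurable M" unfolding h'_def using f(1) by measurable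
  have h'A: "(\<integral>\<^sup>+x. ennreal (indicator A x * h' x) \<partial>M) = ennreal (r A + c * measure M A)"
    if "A \<in> sets M" for A
  proof -
    have "(\<integral>\<^sup>+x. ennreal (indicator A x * h' x) \<partial>M) = (\<integral>\<^sup>+x. f x * indicator A x \<partial>M)"
      by (rule nn_integral_cong_AE, use ffin in eventually_elim)
        (auto simp: h'_def split: split_indicator)
    then show ?thesis using fA[OF that] by simp
  qed
  have int_eq: "(\<integral>x. indicator A x * h' x \<partial>M) = r A + c * measure M A" if A: "A \<in> sets M" for A
  proof -
    have "(\<integral>x. indicator A x * h' x \<partial>M) = enn2real (\<integral>\<^sup>+x. ennreal (indicator A x * h' x) \<partial>M)"
      using h'm A by (intro integral_eq_nn_integral) (auto simp: h'_def)
    then show ?thesis using h'A[OF A] nonneg[OF A] by simp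
  qed
  have h'int: "integrable M h'"
  proof (rule integrableI_nonneg[OF h'm])
    have "(\<integral>\<^sup>+x. ennreal (h' x) \<partial>M) = (\<integral>\<^sup>+x. ennreal (indicator (space M) x * h' x) \<partial>M)"
      by (rule nn_integral_cong) simp
    then show "(\<integral>\<^sup>+x. ennreal (h' x) \<partial>M) < \<infinity>" using h'A[of "space M"] by simp
  qed (simp add: h'_def)
  have "r A = (\<integral>x. indicator A x * (h' x - c) \<partial>M)" if A: "A \<in> sets M" for A
  proof -
    have "(\<integral>x. indicator A x * (h' x - c) \<partial>M) = (\<integral>x. indicator A x * h' x - c * indicator A x \<partial>M)"
      by (rule Bochner_Integration.integral_cong) (auto simp: algebra_simps)
    also have "\<dots> = (\<integral>x. indicator A x * h' x \<partial>M) - c * measure M A"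
      using integrable_mult_indicator[OF A h'int] A
        integrable_indicator_finite[OF A, where ?'b = real]
      by (subst Bochner_Integration.integral_diff) auto
    finally show ?thesis using int_eq[OF A] by simp
  qed
  moreover have "integrable M (\<lambda>x. h' x - c)" using h'int by auto
  ultimately show ?thesis by blast
qed

text \<open>The set \<open>E\<close> is a level set of the density representing the functional modulo constants.\<close>

lemma (in finite_measure) mean_zero_functional_localized:
  fixes F :: "('a \<Rightarrow> complex) \<Rightarrow> complex"
  assumes pos: "measure M (space M) > 0"
    and add: "\<And>f g. integrable M f \<Longrightarrow> integrable M g \<Longrightarrow> (\<integral>x. f x \<partial>M) = 0 \<Longrightarrow> (\<integral>x. g x \<partial>M) = 0 \<Longrightarrow>
      F (\<lambda>x. f x + g x) = F f + F g"
    and scale: "\<And>c f. integrable M f \<Longrightarrow> (\<integral>x. f x \<partial>M) = 0 \<Longrightarrow> F (\<lambda>x. c * f x) = c * F f"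
    and bound: "\<And>f. integrable M f \<Longrightarrow> (\<integral>x. f x \<partial>M) = 0 \<Longrightarrow> cmod (F f) \<le> C * (\<integral>x. cmod (f x) \<partial>M)"
    and e: "e > 0"
  shows "\<exists>E\<in>sets M. emeasure M E > 0 \<and> (\<forall>k. integrable M k \<longrightarrow> (\<integral>x. k x \<partial>M) = 0 \<longrightarrow>
    (\<forall>x\<in>space M - E. k x = 0) \<longrightarrow> cmod (F k) \<le> e * (\<integral>x. cmod (k x) \<partial>M))"
proof -
  define m where "m = complex_of_real (measure M (space M))"
  have m: "m \<noteq> 0" using pos by (simp add: m_def)
  \<comment> \<open>\<open>F\<close> is controlled only on functions of mean zero. Composing it with
    the projection along the constants gives a functional \<open>G\<close> on all integrable
    functions, at the price of a factor 2 in the bound.\<close>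
  define cen where "cen k = (\<lambda>x. k x - (\<integral>y. k y \<partial>M) / m)" for k :: "'a \<Rightarrow> complex"
  define G where "G k = F (cen k)" for k
  have cen_int: "integrable M (cen k)" if "integrable M k" for k
    using that by (simp add: cen_def)
  have cen_0: "(\<integral>x. cen k x \<partial>M) = 0" if k: "integrable M k" for k
    using k m by (simp add: cen_def m_def scaleR_conv_of_real)
  have G_add: "G (\<lambda>x. f x + g x) = G f + G g" if fg: "integrable M f" "integrable M g" for f g
  proof -
    have "cen (\<lambda>x. f x + g x) = (\<lambda>x. cen f x + cen g x)"
      using fg by (simp add: cen_def add_divide_distrib fun_eq_iff)
    then show ?thesis unfolding G_def by (simp add: add cen_int cen_0 fg)
  qed
  have G_scale: "G (\<lambda>x. c * f x) = c * G f" if f: "integrable M f" for c f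
  proof -
    have "cen (\<lambda>x. c * f x) = (\<lambda>x. c * cen f x)"
      using f by (simp add: cen_def right_diff_distrib fun_eq_iff)
    then show ?thesis unfolding G_def by (simp add: scale cen_int cen_0 f)
  qed
  have G_bound: "cmod (G f) \<le> 2 * \<bar>C\<bar> * (\<integral>x. cmod (f x) \<partial>M)" if f: "integrable M f" for f
  proof -
    have "(\<integral>x. cmod (cen f x) \<partial>M) \<le> (\<integral>x. cmod (f x) + cmod ((\<integral>y. f y \<partial>M) / m) \<partial>M)"
      using f cen_int[OF f] by (intro integral_mono) (auto simp: cen_def norm_triangle_ineq4)
    also have "\<dots> = (\<integral>x. cmod (f x) \<partial>M) + cmod (\<integral>y. f y \<partial>M)"
      using f pos by (simp add: m_def norm_divide)
    also have "\<dots> \<le> 2 * (\<integral>x. cmod (f x) \<partial>M)" by simp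
    finally have *: "(\<integral>x. cmod (cen f x) \<partial>M) \<le> 2 * (\<integral>x. cmod (f x) \<partial>M)" .
    have "cmod (G f) \<le> C * (\<integral>x. cmod (cen f x) \<partial>M)"
      unfolding G_def by (intro bound cen_int cen_0 f)
    also have "\<dots> \<le> \<bar>C\<bar> * (\<integral>x. cmod (cen f x) \<partial>M)" by (intro mult_right_mono) auto
    also have "\<dots> \<le> \<bar>C\<bar> * (2 * (\<integral>x. cmod (f x) \<partial>M))" using * by (intro mult_left_mono) auto
    finally show ?thesis by simp
  qed
  define a where "a A = G (\<lambda>x. indicator A x)" for A :: "'a set"
  have a_add: "a (A \<union> B) = a A + a B" if AB: "A \<in> sets M" "B \<in> sets M" "A \<inter> B = {}" for A B
  proof -
    have "(\<lambda>x. indicator (A \<union> B) x :: complex) = (\<lambda>x. indicator A x + indicator B x)"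
      using AB(3) by (auto simp: fun_eq_iff split: split_indicator)
    moreover have "integrable M (\<lambda>x. indicator A x :: complex)" "integrable M (\<lambda>x. indicator B x :: complex)"
      using AB by (auto intro: integrable_indicator_finite)
    ultimately show ?thesis unfolding a_def using G_add by simp
  qed
  have a_bound: "cmod (a A) \<le> 2 * \<bar>C\<bar> * measure M A" if A: "A \<in> sets M" for A
  proof -
    have "(\<integral>x. cmod (indicator A x) \<partial>M) = (\<integral>x. indicator A x \<partial>M)"
      by (rule Bochner_Integration.integral_cong) (auto split: split_indicator)
    also have "\<dots> = measure M A" using A by simp
    finally show ?thesis
      using G_bound[OF integrable_indicator_finite[OF A]] by (simp add: a_def)
  qed
  have "\<exists>h. integrable M h \<and> (\<forall>A\<in>sets M. Re (a A) = (\<integral>x. indicator A x * h x \<partial>M))"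
  proof (rule bounded_additive_density)
    show "\<bar>Re (a A)\<bar> \<le> (2 * \<bar>C\<bar>) * measure M A" if "A \<in> sets M" for A
      using a_bound[OF that] abs_Re_le_cmod[of "a A"] by linarith
  qed (simp add: a_add)
  then obtain h1 where h1: "integrable M h1" "\<And>A. A \<in> sets M \<Longrightarrow> Re (a A) = (\<integral>x. indicator A x * h1 x \<partial>M)"
    by blast
  have "\<exists>h. integrable M h \<and> (\<forall>A\<in>sets M. Im (a A) = (\<integral>x. indicator A x * h x \<partial>M))"
  proof (rule bounded_additive_density)
    show "\<bar>Im (a A)\<bar> \<le> (2 * \<bar>C\<bar>) * measure M A" if "A \<in> sets M" for A
      using a_bound[OF that] abs_Im_le_cmod[of "a A"] by linarith
  qed (simp add: a_add)
  then obtain h2 where h2: "integrable M h2" "\<And>A. A \<in> sets M \<Longrightarrow> Im (a A) = (\<integral>x. indicator A x * h2 x \<partial>M)"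
    by blast
  note [measurable] = borel_measurable_integrable[OF h1(1)] borel_measurable_integrable[OF h2(1)]
  \<comment> \<open>Mesh of a grid in the complex plane. Real and imaginary parts deviate from a
    corner of their cell by at most \<open>q\<close> each, together by at most \<open>e\<close>.
    There are countably many cells, so one of the preimages \<open>Ekl\<close> has positive
    measure.\<close>
  define q where "q = e / 2"
  have q: "q > 0" using e by (simp add: q_def)
  define Ekl where "Ekl = (\<lambda>(k::int, l::int). {x\<in>space M. \<lfloor>h1 x / q\<rfloor> = k \<and> \<lfloor>h2 x / q\<rfloor> = l})"
  have Em: "Ekl z \<in> sets M" for z unfolding Ekl_def by (cases z) simp
  have "\<exists>z. emeasure M (Ekl z) \<noteq> 0"
  proof (rule ccontr)
    assume "\<not> ?thesis"
    then have "(\<Union>z. Ekl z) \<in> null_sets M" using Em by (intro null_sets_UN) (auto simp: null_sets_def)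
    moreover have "(\<Union>z. Ekl z) = space M" by (auto simp: Ekl_def)
    ultimately show False using pos by (auto simp: measure_def null_sets_def)
  qed
  then obtain k0 l0 where kl: "emeasure M (Ekl (k0, l0)) \<noteq> 0" by (metis surj_pair)
  define E where "E = Ekl (k0, l0)"
  have E[measurable]: "E \<in> sets M" unfolding E_def by (rule Em)
  define H where "H x = complex_of_real (h1 x) + \<i> * complex_of_real (h2 x)" for x
  define c where "c = complex_of_real (q * k0) + \<i> * complex_of_real (q * l0)"
  have Hc: "cmod (H x - c) \<le> e" if "x \<in> E" for x
  proof -
    have fl: "\<lfloor>h1 x / q\<rfloor> = k0" "\<lfloor>h2 x / q\<rfloor> = l0" using that by (auto simp: E_def Ekl_def)
    have 1: "\<bar>h1 x - q * k0\<bar> \<le> q" "\<bar>h2 x - q * l0\<bar> \<le> q"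
      using fl q floor_correct[of "h1 x / q"] floor_correct[of "h2 x / q"]
      by (auto simp: field_simps abs_le_iff)
    have "H x - c = complex_of_real (h1 x - q * k0) + \<i> * complex_of_real (h2 x - q * l0)"
      by (simp add: H_def c_def algebra_simps)
    then have "cmod (H x - c) \<le> \<bar>h1 x - q * k0\<bar> + \<bar>h2 x - q * l0\<bar>"
      using norm_triangle_ineq[of "complex_of_real (h1 x - q * k0)" "\<i> * complex_of_real (h2 x - q * l0)"]
      by (simp only: norm_mult norm_ii norm_of_real mult_1_left)
    then show ?thesis using 1 by (simp add: q_def)
  qed
  \<comment> \<open>\<open>H\<close> is only known to be integrable. Cut off to \<open>E\<close> it
    is bounded, so it can be integrated against every integrable function, and the formula
    \<open>rep\<close> passes from indicators to limits.\<close>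
  define HE where "HE = (\<lambda>x. indicator E x * H x)"
  have HEm[measurable]: "HE \<in> borel_measurable M" unfolding HE_def H_def by measurable
  define B where "B = e + cmod c"
  have HEb: "cmod (HE x) \<le> B" for x
  proof (cases "x \<in> E")
    case True
    have "cmod (H x) \<le> cmod (H x - c) + cmod c" using norm_triangle_ineq[of "H x - c" c] by simp
    then show ?thesis using Hc[OF True] True by (simp add: HE_def B_def)
  qed (use e in \<open>simp add: HE_def B_def add_nonneg_nonneg less_imp_le\<close>)
  have B0: "B \<ge> 0" using e by (simp add: B_def)
  have HEint: "integrable M (\<lambda>x. HE x * k x)" if k: "integrable M k" for k :: "'a \<Rightarrow> complex"
  proof (rule Bochner_Integration.integrable_bound)
    show "integrable M (\<lambda>x. B * cmod (k x))" using k by auto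
    show "(\<lambda>x. HE x * k x) \<in> borel_measurable M" using borel_measurable_integrable[OF k] by measurable
    show "AE x in M. norm (HE x * k x) \<le> norm (B * cmod (k x))"
      using HEb B0 by (intro AE_I2) (auto simp: norm_mult abs_mult intro!: mult_right_mono)
  qed
  have indint: "integrable M (\<lambda>x. indicator E x * k x)" if "integrable M k" for k :: "'a \<Rightarrow> complex"
    using integrable_mult_indicator[OF E that]
    by (simp add: scaleR_conv_of_real of_real_indicator)
  have rep: "G (\<lambda>x. indicator E x * k x) = (\<integral>x. HE x * k x \<partial>M)" if "integrable M k" for k
    using that
  proof (induct rule: integrable_induct)
    case (base A z)
    have AE': "A \<inter> E \<in> sets M" using base E by blast
    have 1: "(\<lambda>x. indicator E x * (indicat_real A x *\<^sub>R z)) = (\<lambda>x. z * indicator (A \<inter> E) x)"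
      by (auto simp: fun_eq_iff split: split_indicator)
    have "G (\<lambda>x. indicator E x * (indicat_real A x *\<^sub>R z)) = z * a (A \<inter> E)"
      unfolding 1 a_def by (intro G_scale integrable_indicator_finite AE')
    moreover have "(\<integral>x. HE x * (indicat_real A x *\<^sub>R z) \<partial>M) = z * a (A \<inter> E)"
    proof -
      have i1: "integrable M (\<lambda>x. indicator (A \<inter> E) x * h1 x)"
        using integrable_mult_indicator[OF AE' h1(1)] by simp
      have i2: "integrable M (\<lambda>x. indicator (A \<inter> E) x * h2 x)"
        using integrable_mult_indicator[OF AE' h2(1)] by simp
      have "(\<integral>x. HE x * (indicat_real A x *\<^sub>R z) \<partial>M) =
          (\<integral>x. z * (complex_of_real (indicator (A \<inter> E) x * h1 x) + \<i> * complex_of_real (indicator (A \<inter> E) x * h2 x)) \<partial>M)"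
        by (rule Bochner_Integration.integral_cong)
          (auto simp: HE_def H_def scaleR_conv_of_real split: split_indicator)
      also have "\<dots> = z * (complex_of_real (Re (a (A \<inter> E))) + \<i> * complex_of_real (Im (a (A \<inter> E))))"
        using i1 i2 h1(2)[OF AE'] h2(2)[OF AE']
        by (simp del: of_real_mult)
      also have "\<dots> = z * a (A \<inter> E)" by (simp flip: complex_eq)
      finally show ?thesis .
    qed
    ultimately show ?case by simp
  next
    case (add f g)
    have "(\<lambda>x. indicator E x * (f x + g x)) = (\<lambda>x. indicator E x * f x + indicator E x * g x)"
      by (simp add: distrib_left)
    then show ?case
      using add G_add[OF indint[OF add(1)] indint[OF add(3)]] HEint[OF add(1)] HEint[OF add(3)]
      by (simp add: distrib_left)
  next
    case (lim f s)
    have sf: "(\<lambda>i. \<integral>x. cmod (s i x - f x) \<partial>M) \<longlonglongrightarrow> (\<integral>x. 0 \<partial>M)"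
    proof (rule integral_dominated_convergence[where w = "\<lambda>x. 3 * cmod (f x)"])
      show "AE x in M. (\<lambda>i. cmod (s i x - f x)) \<longlonglongrightarrow> 0"
        using lim(3) by (intro AE_I2 tendsto_norm_zero) (simp add: LIM_zero_iff)
      show "AE x in M. norm (cmod (s i x - f x)) \<le> 3 * cmod (f x)" for i
      proof (rule AE_I2)
        fix x assume "x \<in> space M"
        then show "norm (cmod (s i x - f x)) \<le> 3 * cmod (f x)"
          using lim(4)[of x i] norm_triangle_ineq4[of "s i x" "f x"] by simp
      qed
    qed (use lim in auto)
    have diff: "integrable M (\<lambda>x. s i x - f x)" for i using lim by auto
    have "(\<lambda>i. G (\<lambda>x. indicator E x * (s i x - f x))) \<longlonglongrightarrow> 0"
    proof (rule Lim_null_comparison)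
      show "\<forall>\<^sub>F i in sequentially. norm (G (\<lambda>x. indicator E x * (s i x - f x)))
          \<le> 2 * \<bar>C\<bar> * (\<integral>x. cmod (s i x - f x) \<partial>M)"
      proof (rule always_eventually, rule allI)
        fix i
        have "cmod (G (\<lambda>x. indicator E x * (s i x - f x)))
            \<le> 2 * \<bar>C\<bar> * (\<integral>x. cmod (indicator E x * (s i x - f x)) \<partial>M)"
          by (rule G_bound[OF indint[OF diff]])
        also have "\<dots> \<le> 2 * \<bar>C\<bar> * (\<integral>x. cmod (s i x - f x) \<partial>M)"
          by (intro mult_left_mono integral_mono integrable_norm indint diff)
            (auto split: split_indicator)
        finally show "norm (G (\<lambda>x. indicator E x * (s i x - f x)))
          \<le> 2 * \<bar>C\<bar> * (\<integral>x. cmod (s i x - f x) \<partial>M)" .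
      qed
      show "(\<lambda>i. 2 * \<bar>C\<bar> * (\<integral>x. cmod (s i x - f x) \<partial>M)) \<longlonglongrightarrow> 0"
        using tendsto_mult_right_zero[OF sf[simplified]] .
    qed
    moreover have "G (\<lambda>x. indicator E x * (s i x - f x)) =
        G (\<lambda>x. indicator E x * s i x) - G (\<lambda>x. indicator E x * f x)" for i
    proof -
      have "(\<lambda>x. indicator E x * s i x) = (\<lambda>x. indicator E x * (s i x - f x) + indicator E x * f x)"
        by (simp add: algebra_simps)
      then show ?thesis using G_add[OF indint[OF diff[of i]] indint[OF lim(5)]] by simp
    qed
    ultimately have L1: "(\<lambda>i. G (\<lambda>x. indicator E x * s i x)) \<longlonglongrightarrow> G (\<lambda>x. indicator E x * f x)"
      by (simp add: LIM_zero_iff)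
    have L2: "(\<lambda>i. \<integral>x. HE x * s i x \<partial>M) \<longlonglongrightarrow> (\<integral>x. HE x * f x \<partial>M)"
    proof (rule integral_dominated_convergence[where w = "\<lambda>x. B * (2 * cmod (f x))"])
      show "AE x in M. (\<lambda>i. HE x * s i x) \<longlonglongrightarrow> HE x * f x"
        using lim(3) by (intro AE_I2 tendsto_mult tendsto_const) auto
      show "AE x in M. norm (HE x * s i x) \<le> B * (2 * cmod (f x))" for i
        using lim(4) HEb B0 by (intro AE_I2) (auto simp: norm_mult intro!: mult_mono)
    qed (use lim HEint borel_measurable_integrable in auto)
    show ?case using L1 L2 lim(2) LIMSEQ_unique by auto
  qed
  show ?thesis
  proof (intro bexI[of _ E] conjI allI impI)
    show "E \<in> sets M" by (rule E)
    show "emeasure M E > 0" using kl by (simp add: E_def zero_less_iff_neq_zero)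
    fix k :: "'a \<Rightarrow> complex" assume k: "integrable M k" "(\<integral>x. k x \<partial>M) = 0" "\<forall>x\<in>space M - E. k x = 0"
    have kE: "integrable M (\<lambda>x. indicator E x * k x)" by (rule indint[OF k(1)])
    have "cen k = k" using k(2) by (simp add: cen_def)
    then have "F k = G k" by (simp add: G_def)
    also have "G k = G (\<lambda>x. indicator E x * k x)"
    proof -
      have d: "integrable M (\<lambda>x. k x - indicator E x * k x)" using k(1) kE by auto
      have "(\<integral>x. cmod (k x - indicator E x * k x) \<partial>M) = (\<integral>x. 0 \<partial>M)"
        using k(3) by (intro Bochner_Integration.integral_cong) (auto split: split_indicator)
      then have "G (\<lambda>x. k x - indicator E x * k x) = 0" using G_bound[OF d] by simp
      moreover have "k = (\<lambda>x. (k x - indicator E x * k x) + indicator E x * k x)" by simp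
      ultimately show ?thesis using G_add[OF d kE] by simp
    qed
    also have "\<dots> = (\<integral>x. HE x * k x \<partial>M)" by (rule rep[OF k(1)])
    \<comment> \<open>Here mean zero is used: subtracting \<open>c\<close> times the integral of
      \<open>k\<close> changes nothing, and on \<open>E\<close> the remaining factor
      \<open>H - c\<close> is at most \<open>e\<close> in modulus.\<close>
    also have "\<dots> = (\<integral>x. HE x * k x \<partial>M) - c * (\<integral>x. k x \<partial>M)" using k(2) by simp
    also have "\<dots> = (\<integral>x. HE x * k x - c * k x \<partial>M)"
      using HEint[OF k(1)] k(1) by simp
    finally have "cmod (F k) \<le> (\<integral>x. cmod (HE x * k x - c * k x) \<partial>M)" by simp
    also have "\<dots> \<le> (\<integral>x. e * cmod (k x) \<partial>M)"
    proof (rule integral_mono)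
      fix x assume x: "x \<in> space M"
      show "cmod (HE x * k x - c * k x) \<le> e * cmod (k x)"
      proof (cases "x \<in> E")
        case True
        then have "HE x * k x - c * k x = (H x - c) * k x" by (simp add: HE_def algebra_simps)
        then show ?thesis using Hc[OF True] by (simp add: norm_mult mult_right_mono)
      qed (use k(3) x in simp)
    qed (use HEint[OF k(1)] k(1) in auto)
    also have "\<dots> = e * (\<integral>x. cmod (k x) \<partial>M)" by simp
    finally show "cmod (F k) \<le> e * (\<integral>x. cmod (k x) \<partial>M)" .
  qed
qed

section \<open>Spaces of almost-everywhere classes\<close>

lemma mem_ae_class: "f \<in> borel_measurable N \<Longrightarrow> f \<in> ae_class N f"
  by (simp add: ae_class_def)

lemma ae_class_eqI:
  assumes "AE x in N. f x = g x"
  shows "ae_class N f = ae_class N g"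
proof -
  have "(AE x in N. h x = f x) \<longleftrightarrow> (AE x in N. h x = g x)" for h
    using assms by (rule eventually_subst[OF eventually_mono]) auto
  then show ?thesis by (simp add: ae_class_def)
qed

lemma ae_classD: "h \<in> ae_class N f \<Longrightarrow> AE x in N. h x = f x" "h \<in> ae_class N f \<Longrightarrow> h \<in> borel_measurable N"
  by (simp_all add: ae_class_def)

text \<open>Collapses the unions over representatives by which operations on classes are defined,
  once \<open>T\<close> respects equality almost everywhere.\<close>

lemma UN_ae_class:
  assumes f: "f \<in> borel_measurable N"
    and cong: "\<And>h. AE x in N. h x = f x \<Longrightarrow> AE x in N. T h x = T f x"
  shows "(\<Union>h\<in>ae_class N f. ae_class N (T h)) = ae_class N (T f)"
proof -
  have "ae_class N (T h) = ae_class N (T f)" if "h \<in> ae_class N f" for h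
    using ae_class_eqI[OF cong[OF ae_classD(1)[OF that]]] .
  then show ?thesis using mem_ae_class[OF f] by blast
qed

lemma vadd_Lp:
  assumes f: "f \<in> borel_measurable N" and g: "g \<in> borel_measurable N"
  shows "vadd (Lp_space p N) (ae_class N f) (ae_class N g) = ae_class N (\<lambda>x. f x + g x)"
proof -
  have "(\<Union>k\<in>ae_class N g. ae_class N (\<lambda>x. h x + k x)) = ae_class N (\<lambda>x. h x + g x)" for h
    by (rule UN_ae_class[OF g]) (erule eventually_mono, simp)
  moreover have "(\<Union>h\<in>ae_class N f. ae_class N (\<lambda>x. h x + g x)) = ae_class N (\<lambda>x. f x + g x)"
    by (rule UN_ae_class[OF f]) (erule eventually_mono, simp)
  ultimately show ?thesis by (simp add: Lp_space_def)
qed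

lemma vscale_Lp:
  assumes f: "f \<in> borel_measurable N"
  shows "vscale (Lp_space p N) c (ae_class N f) = ae_class N (\<lambda>x. c * f x)"
proof -
  have "(\<Union>h\<in>ae_class N f. ae_class N (\<lambda>x. c * h x)) = ae_class N (\<lambda>x. c * f x)"
    by (rule UN_ae_class[OF f]) (erule eventually_mono, simp)
  then show ?thesis by (simp add: Lp_space_def)
qed

lemma vnorm_Lp:
  assumes f: "f \<in> borel_measurable N"
  shows "vnorm (Lp_space p N) (ae_class N f) = lp_norm p N f"
proof -
  have "lp_norm p N h = lp_norm p N f" if "h \<in> ae_class N f" for h
  proof -
    have m: "h \<in> borel_measurable N" by (rule ae_classD(2)[OF that])
    have "(\<integral>x. cmod (h x) powr p \<partial>N) = (\<integral>x. cmod (f x) powr p \<partial>N)"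
      using ae_classD(1)[OF that] m f by (intro integral_cong_AE) auto
    then show ?thesis by (simp add: lp_norm_def)
  qed
  then have "lp_norm p N ` ae_class N f = (\<lambda>_. lp_norm p N f) ` ae_class N f"
    by (rule image_cong[OF refl])
  also have "\<dots> = {lp_norm p N f}" by (rule image_constant[OF mem_ae_class[OF f]])
  finally have "lp_norm p N ` ae_class N f = {lp_norm p N f}" .
  then show ?thesis by (simp add: Lp_space_def)
qed

lemma carrier_Lp: "carrier (Lp_space p N) = ae_class N ` lp_functions p N"
  by (simp add: Lp_space_def)

lemma lp_functions_1: "f \<in> lp_functions 1 N \<longleftrightarrow> integrable N f"
  by (auto simp: lp_functions_def integrable_norm_iff)

lemma carrier_L1_zero:
  "carrier (L1_zero_space N) = ae_class N ` {f. integrable N f \<and> (\<integral>x. f x \<partial>N) = 0}"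
proof -
  have "(\<forall>h\<in>ae_class N f. (\<integral>x. h x \<partial>N) = 0) \<longleftrightarrow> (\<integral>x. f x \<partial>N) = 0" if f: "integrable N f" for f
  proof -
    have "(\<integral>x. h x \<partial>N) = (\<integral>x. f x \<partial>N)" if "h \<in> ae_class N f" for h
      using ae_classD[OF that] f by (intro integral_cong_AE) auto
    moreover have "f \<in> ae_class N f" using f by (intro mem_ae_class) simp
    ultimately show ?thesis by metis
  qed
  then show ?thesis
    by (auto simp: L1_zero_space_def carrier_Lp lp_functions_1)
qed

lemma L1_zero_simps [simp]:
  "vadd (L1_zero_space N) = vadd (Lp_space 1 N)"
  "vscale (L1_zero_space N) = vscale (Lp_space 1 N)"
  "vnorm (L1_zero_space N) = vnorm (Lp_space 1 N)"
  by (simp_all add: L1_zero_space_def Lp_space_def)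

lemma lp_norm_1: "lp_norm 1 N f = (\<integral>x. cmod (f x) \<partial>N)"
  by (simp add: lp_norm_def)

section \<open>The visual metric on the boundary\<close>

locale visual_metric =
  fixes \<epsilon> :: real and w :: "'x::metric_space"
  assumes eps: "\<epsilon> > 0"
    and hyp: "strongly_hyperbolic TYPE('x) \<epsilon>"
begin

text \<open>Strong hyperbolicity is the triangle inequality for this kernel, and its limit at two
  boundary points is the visual metric. It is not a metric on the space itself, since
  \<open>ker x x = exp (- \<epsilon> * dist w x)\<close>.\<close>

definition ker :: "'x \<Rightarrow> 'x \<Rightarrow> real" where
  "ker x y = exp (- \<epsilon> * gp w x y)"

text \<open>The same kernel with one argument at infinity; small values mean that \<xi> and
  \<open>x\<close> are close as seen from \<open>w\<close>. Unlike the distance on the boundary it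
  never vanishes.\<close>

definition bker :: "(nat \<Rightarrow> 'x) set \<Rightarrow> 'x \<Rightarrow> real" where
  "bker \<xi> x = exp (- \<epsilon> * gp_boundary_point w \<xi> x)"

abbreviation bdry :: "(nat \<Rightarrow> 'x) set set" where
  "bdry \<equiv> gromov_boundary w"

abbreviation bdist :: "(nat \<Rightarrow> 'x) set \<Rightarrow> (nat \<Rightarrow> 'x) set \<Rightarrow> real" where
  "bdist \<equiv> boundary_dist \<epsilon> w"

lemma gp_commute: "gp v x y = gp v y x"
  by (simp add: gromov_product_def dist_commute)

lemma ker_commute: "ker x y = ker y x"
  unfolding ker_def by (subst gp_commute) simp

lemma ker_pos: "0 < ker x y"
  by (simp add: ker_def)

lemma gp_nonneg: "0 \<le> gp v x y"
  using dist_triangle3[of x y v] by (simp add: gromov_product_def)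

lemma gp_le_dist: "gp v x y \<le> dist v y"
  using dist_triangle[of v x y] by (simp add: gromov_product_def dist_commute)

lemma ker_le_1: "ker x y \<le> 1"
  using eps gp_nonneg[of w x y] by (simp add: ker_def)

lemma ker_ge: "exp (- \<epsilon> * dist w y) \<le> ker x y"
  using eps gp_le_dist[of w x y] by (simp add: ker_def)

lemma ker_triangle: "ker x y \<le> ker x z + ker z y"
  using hyp unfolding strongly_hyperbolic_def ker_def by blast

lemma gp_ker: "gp w x y = - ln (ker x y) / \<epsilon>"
  using eps by (simp add: ker_def)

lemma gp_ge_iff_ker_le: "C \<le> gp w x y \<longleftrightarrow> ker x y \<le> exp (- \<epsilon> * C)"
  using eps by (simp add: ker_def)

lemma filterlim_gp_iff_ker:
  "filterlim (\<lambda>i. gp w (f i) (h i)) at_top F \<longleftrightarrow> ((\<lambda>i. ker (f i) (h i)) \<longlongrightarrow> 0) F"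
proof
  assume L: "filterlim (\<lambda>i. gp w (f i) (h i)) at_top F"
  have "filterlim (\<lambda>i. - \<epsilon> * gp w (f i) (h i)) at_bot F"
    using filterlim_tendsto_pos_mult_at_top[OF tendsto_const eps L]
    by (simp add: filterlim_uminus_at_bot)
  then show "((\<lambda>i. ker (f i) (h i)) \<longlongrightarrow> 0) F"
    unfolding ker_def by (rule filterlim_compose[OF exp_at_bot])
next
  assume L: "((\<lambda>i. ker (f i) (h i)) \<longlongrightarrow> 0) F"
  show "filterlim (\<lambda>i. gp w (f i) (h i)) at_top F"
    unfolding filterlim_at_top
  proof
    fix C
    have "\<forall>\<^sub>F i in F. ker (f i) (h i) < exp (- \<epsilon> * C)"
      using order_tendstoD(2)[OF L] by simp
    then show "\<forall>\<^sub>F i in F. C \<le> gp w (f i) (h i)"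
      by eventually_elim (simp add: gp_ge_iff_ker_le)
  qed
qed

text \<open>A Cauchy condition for the kernel. It includes \<open>i = j\<close>, which forces
  \<open>dist w (u i)\<close> to infinity.\<close>

lemma converges_to_infinity_iff_ker:
  "converges_to_infinity w u \<longleftrightarrow> (\<forall>e>0. \<exists>N. \<forall>i\<ge>N. \<forall>j\<ge>N. ker (u i) (u j) < e)"
proof -
  have "converges_to_infinity w u \<longleftrightarrow>
      ((\<lambda>p. ker (u (fst p)) (u (snd p))) \<longlongrightarrow> 0) (sequentially \<times>\<^sub>F sequentially)"
    unfolding converges_to_infinity_def case_prod_beta by (rule filterlim_gp_iff_ker)
  also have "\<dots> \<longleftrightarrow> (\<forall>e>0. \<exists>N. \<forall>i\<ge>N. \<forall>j\<ge>N. ker (u i) (u j) < e)"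
    unfolding tendsto_iff eventually_prod_sequentially
    using ker_pos ker_commute by (simp add: abs_of_pos)
  finally show ?thesis .
qed

lemma boundary_rel_iff:
  "(u, v) \<in> boundary_rel w \<longleftrightarrow> converges_to_infinity w u \<and> converges_to_infinity w v \<and>
     (\<lambda>n. ker (u n) (v n)) \<longlonglongrightarrow> 0"
  by (simp add: boundary_rel_def filterlim_gp_iff_ker)

lemma equiv_boundary_rel: "equiv {u. converges_to_infinity w u} (boundary_rel w)"
proof (rule equivI)
  show "boundary_rel w \<subseteq> {u. converges_to_infinity w u} \<times> {u. converges_to_infinity w u}"
    by (auto simp: boundary_rel_iff)
  show "refl_on {u. converges_to_infinity w u} (boundary_rel w)"
  proof (rule refl_onI)
    fix u assume u: "u \<in> {u. converges_to_infinity w u}"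
    have "(\<lambda>n. ker (u n) (u n)) \<longlonglongrightarrow> 0"
      unfolding LIMSEQ_iff
    proof safe
      fix e :: real assume "e > 0"
      then obtain N where "\<forall>i\<ge>N. \<forall>j\<ge>N. ker (u i) (u j) < e"
        using u converges_to_infinity_iff_ker by blast
      then show "\<exists>N. \<forall>n\<ge>N. norm (ker (u n) (u n) - 0) < e"
        using ker_pos by (auto simp: abs_of_pos)
    qed
    then show "(u, u) \<in> boundary_rel w" using u by (simp add: boundary_rel_iff)
  qed
  show "sym (boundary_rel w)"
    by (rule symI) (auto simp: boundary_rel_iff ker_commute)
  show "trans (boundary_rel w)"
  proof (rule transI)
    fix u v z assume uv: "(u, v) \<in> boundary_rel w" and vz: "(v, z) \<in> boundary_rel w"
    have "(\<lambda>n. ker (u n) (v n) + ker (v n) (z n)) \<longlonglongrightarrow> 0 + 0"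
      using uv vz unfolding boundary_rel_iff by (intro tendsto_add) auto
    then have L: "(\<lambda>n. ker (u n) (v n) + ker (v n) (z n)) \<longlonglongrightarrow> 0" by simp
    have "(\<lambda>n. ker (u n) (z n)) \<longlonglongrightarrow> 0"
      by (rule tendsto_sandwich[OF _ _ tendsto_const L])
        (auto intro!: always_eventually simp: ker_triangle less_imp_le[OF ker_pos])
    then show "(u, z) \<in> boundary_rel w" using uv vz by (auto simp: boundary_rel_iff)
  qed
qed

section \<open>Boundary points and limits of the kernel\<close>

lemma bdry_nonempty: "\<xi> \<in> bdry \<Longrightarrow> \<exists>u. u \<in> \<xi>"
  unfolding gromov_boundary_def using in_quotient_imp_non_empty[OF equiv_boundary_rel] by blast

lemma bdry_rel: "\<xi> \<in> bdry \<Longrightarrow> u \<in> \<xi> \<Longrightarrow> v \<in> \<xi> \<Longrightarrow> (u, v) \<in> boundary_rel w"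
  unfolding gromov_boundary_def using quotient_eq_iff[OF equiv_boundary_rel] by blast

lemma bdry_conv: "\<xi> \<in> bdry \<Longrightarrow> u \<in> \<xi> \<Longrightarrow> converges_to_infinity w u"
  using bdry_rel[of \<xi> u u] by (simp add: boundary_rel_iff)

lemma bdry_eqI: "\<lbrakk>\<xi> \<in> bdry; \<eta> \<in> bdry; u \<in> \<xi>; v \<in> \<eta>; (u, v) \<in> boundary_rel w\<rbrakk> \<Longrightarrow> \<xi> = \<eta>"
  unfolding gromov_boundary_def using quotient_eq_iff[OF equiv_boundary_rel] by blast

lemma bdry_closed: "\<lbrakk>\<xi> \<in> bdry; u \<in> \<xi>; (u, v) \<in> boundary_rel w\<rbrakk> \<Longrightarrow> v \<in> \<xi>"
  unfolding gromov_boundary_def using in_quotient_imp_closed[OF equiv_boundary_rel] by blast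

lemma bdry_class: "converges_to_infinity w u \<Longrightarrow> boundary_rel w `` {u} \<in> bdry"
  unfolding gromov_boundary_def by (rule quotientI) simp

text \<open>Two applications of \<open>ker_triangle\<close> bound the change of
  \<open>ker (u n) (v n)\<close> between two indices \<open>m\<close> and \<open>n\<close> by
  \<open>ker (u m) (u n) + ker (v m) (v n)\<close>.\<close>

lemma convergent_ker:
  assumes "converges_to_infinity w u" "converges_to_infinity w v"
  shows "convergent (\<lambda>n. ker (u n) (v n))"
  unfolding Cauchy_convergent_iff[symmetric]
proof (rule CauchyI)
  fix e :: real assume "e > 0"
  then have "e / 2 > 0" by simp
  then obtain N M where N: "\<forall>i\<ge>N. \<forall>j\<ge>N. ker (u i) (u j) < e / 2"
    and M: "\<forall>i\<ge>M. \<forall>j\<ge>M. ker (v i) (v j) < e / 2"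
    using assms unfolding converges_to_infinity_iff_ker by meson
  show "\<exists>N. \<forall>m\<ge>N. \<forall>n\<ge>N. norm (ker (u m) (v m) - ker (u n) (v n)) < e"
  proof (intro exI allI impI)
    fix m n assume mn: "max N M \<le> m" "max N M \<le> n"
    have *: "ker (u m) (v m) - ker (u n) (v n) \<le> ker (u m) (u n) + ker (v m) (v n)" for m n
      using ker_triangle[of "u m" "v m" "u n"] ker_triangle[of "u n" "v m" "v n"]
      by (simp add: ker_commute)
    have "ker (u m) (u n) < e / 2" "ker (v m) (v n) < e / 2"
      using N M mn by auto
    then show "norm (ker (u m) (v m) - ker (u n) (v n)) < e"
      using *[of m n] *[of n m] by (simp add: ker_commute abs_if)
  qed
qed

lemma convergent_bker:
  assumes "converges_to_infinity w u"
  shows "convergent (\<lambda>n. ker (u n) x)"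
  unfolding Cauchy_convergent_iff[symmetric]
proof (rule CauchyI)
  fix e :: real assume "e > 0"
  then obtain N where N: "\<forall>i\<ge>N. \<forall>j\<ge>N. ker (u i) (u j) < e"
    using assms unfolding converges_to_infinity_iff_ker by meson
  show "\<exists>N. \<forall>m\<ge>N. \<forall>n\<ge>N. norm (ker (u m) x - ker (u n) x) < e"
  proof (intro exI allI impI)
    fix m n assume "N \<le> m" "N \<le> n"
    then have "ker (u m) (u n) < e" using N by auto
    then show "norm (ker (u m) x - ker (u n) x) < e"
      using ker_triangle[of "u m" x "u n"] ker_triangle[of "u n" x "u m"]
      by (simp add: ker_commute[of "u n" "u m"] abs_if)
  qed
qed

lemma ker_diff_tendsto_0:
  assumes "(\<lambda>n. ker (u n) (u' n)) \<longlonglongrightarrow> 0" "(\<lambda>n. ker (v n) (v' n)) \<longlonglongrightarrow> 0"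
    and L: "(\<lambda>n. ker (u n) (v n)) \<longlonglongrightarrow> L"
  shows "(\<lambda>n. ker (u' n) (v' n)) \<longlonglongrightarrow> L"
proof -
  have S: "(\<lambda>n. ker (u n) (u' n) + ker (v n) (v' n)) \<longlonglongrightarrow> 0"
    using tendsto_add[OF assms(1,2)] by simp
  have *: "ker (u' n) (v' n) - ker (u n) (v n) \<le> ker (u n) (u' n) + ker (v n) (v' n)"
    "ker (u n) (v n) - ker (u' n) (v' n) \<le> ker (u n) (u' n) + ker (v n) (v' n)" for n
    using ker_triangle[of "u' n" "v' n" "u n"] ker_triangle[of "u n" "v' n" "v n"]
      ker_triangle[of "u n" "v n" "u' n"] ker_triangle[of "u' n" "v n" "v' n"]
    by (simp_all add: ker_commute)
  have "(\<lambda>n. ker (u' n) (v' n) - ker (u n) (v n)) \<longlonglongrightarrow> 0"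
  proof (rule Lim_null_comparison[OF _ S], rule always_eventually, rule allI)
    fix n show "norm (ker (u' n) (v' n) - ker (u n) (v n)) \<le> ker (u n) (u' n) + ker (v n) (v' n)"
      using *[of n] by (simp add: abs_if)
  qed
  from tendsto_add[OF this L] show ?thesis by simp
qed

text \<open>The two \<open>THE\<close> descriptions in the boundary Gromov products are well defined: strong
  hyperbolicity makes the kernel itself, rather than a bounded perturbation of it, Cauchy.\<close>

lemma bdist_tendsto:
  assumes \<xi>: "\<xi> \<in> bdry" "u \<in> \<xi>" and \<eta>: "\<eta> \<in> bdry" "v \<in> \<eta>"
  shows "(\<lambda>n. ker (u n) (v n)) \<longlonglongrightarrow> bdist \<xi> \<eta>"
proof -
  obtain L where L: "(\<lambda>n. ker (u n) (v n)) \<longlonglongrightarrow> L"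
    using convergent_ker[OF bdry_conv[OF \<xi>] bdry_conv[OF \<eta>]] unfolding convergent_def by blast
  have L0: "0 \<le> L"
    by (rule LIMSEQ_le_const[OF L]) (auto intro: less_imp_le ker_pos)
  define G where "G = (if L = 0 then \<infinity> else ereal (- ln L / \<epsilon>))"
  have conv: "(\<lambda>n. ereal (gp w (u' n) (v' n))) \<longlonglongrightarrow> G" if u': "u' \<in> \<xi>" and v': "v' \<in> \<eta>" for u' v'
  proof -
    have L': "(\<lambda>n. ker (u' n) (v' n)) \<longlonglongrightarrow> L"
      using bdry_rel[OF \<xi> u'] bdry_rel[OF \<eta> v']
      by (intro ker_diff_tendsto_0[OF _ _ L]) (auto simp: boundary_rel_iff)
    show ?thesis
    proof (cases "L = 0")
      case True
      then have "filterlim (\<lambda>n. gp w (u' n) (v' n)) at_top sequentially"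
        using L' by (simp add: filterlim_gp_iff_ker)
      then show ?thesis using True by (simp add: G_def tendsto_PInfty_eq_at_top)
    next
      case False
      have "(\<lambda>n. - ln (ker (u' n) (v' n)) / \<epsilon>) \<longlonglongrightarrow> - ln L / \<epsilon>"
        using False eps by (intro tendsto_intros L') auto
      then show ?thesis using False by (simp add: G_def gp_ker)
    qed
  qed
  have "gp_boundary w \<xi> \<eta> = G"
    unfolding gp_boundary_def
    by (rule the_equality) (use conv \<xi> \<eta> LIMSEQ_unique in blast)+
  then have "bdist \<xi> \<eta> = L"
    using L0 eps by (simp add: boundary_dist_def G_def)
  with L show ?thesis by simp
qed

lemma bker_tendsto:
  assumes \<xi>: "\<xi> \<in> bdry" "u \<in> \<xi>"
  shows "(\<lambda>n. gp w (u n) x) \<longlonglongrightarrow> gp_boundary_point w \<xi> x"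
    and "(\<lambda>n. ker (u n) x) \<longlonglongrightarrow> bker \<xi> x"
proof -
  obtain L where L: "(\<lambda>n. ker (u n) x) \<longlonglongrightarrow> L"
    using convergent_bker[OF bdry_conv[OF \<xi>]] unfolding convergent_def by blast
  \<comment> \<open>The limit stays away from 0, so the logarithm is continuous there and the Gromov
    product converges to a finite number.\<close>
  have "exp (- \<epsilon> * dist w x) \<le> L"
    by (rule LIMSEQ_le_const[OF L]) (use ker_ge in blast)
  then have L0: "0 < L" using exp_gt_zero less_le_trans by blast
  have conv: "(\<lambda>n. gp w (u' n) x) \<longlonglongrightarrow> - ln L / \<epsilon>" if u': "u' \<in> \<xi>" for u'
  proof -
    have S: "(\<lambda>n. ker (u n) (u' n)) \<longlonglongrightarrow> 0"
      using bdry_rel[OF \<xi> u'] by (simp add: boundary_rel_iff)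
    have "(\<lambda>n. ker (u' n) x - ker (u n) x) \<longlonglongrightarrow> 0"
    proof (rule Lim_null_comparison[OF _ S], rule always_eventually, rule allI)
      fix n show "norm (ker (u' n) x - ker (u n) x) \<le> ker (u n) (u' n)"
        using ker_triangle[of "u n" x "u' n"] ker_triangle[of "u' n" x "u n"]
        by (simp add: ker_commute[of "u' n" "u n"] abs_if)
    qed
    from tendsto_add[OF this L] have "(\<lambda>n. ker (u' n) x) \<longlonglongrightarrow> L" by simp
    then show ?thesis
      unfolding gp_ker using L0 eps by (intro tendsto_intros) auto
  qed
  have "gp_boundary_point w \<xi> x = - ln L / \<epsilon>"
    unfolding gp_boundary_point_def
    by (rule the_equality) (use conv \<xi> LIMSEQ_unique in blast)+
  then show "(\<lambda>n. gp w (u n) x) \<longlonglongrightarrow> gp_boundary_point w \<xi> x"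
    using conv[OF \<xi>(2)] by simp
  then show "(\<lambda>n. ker (u n) x) \<longlonglongrightarrow> bker \<xi> x"
    unfolding ker_def bker_def by (intro tendsto_intros)
qed

lemma bdist_nonneg: "0 \<le> bdist \<xi> \<eta>"
  by (simp add: boundary_dist_def)

lemma bdist_commute: "bdist \<xi> \<eta> = bdist \<eta> \<xi>"
proof -
  have "(\<forall>u\<in>\<xi>. \<forall>v\<in>\<eta>. (\<lambda>n. ereal (gp w (u n) (v n))) \<longlonglongrightarrow> L) \<longleftrightarrow>
        (\<forall>u\<in>\<eta>. \<forall>v\<in>\<xi>. (\<lambda>n. ereal (gp w (u n) (v n))) \<longlonglongrightarrow> L)" for L
    by (subst gp_commute) blast
  then show ?thesis by (simp add: boundary_dist_def gp_boundary_def)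
qed

lemma bdist_triangle:
  assumes "\<xi> \<in> bdry" "\<eta> \<in> bdry" "\<zeta> \<in> bdry"
  shows "bdist \<xi> \<zeta> \<le> bdist \<xi> \<eta> + bdist \<eta> \<zeta>"
proof -
  obtain u v z where "u \<in> \<xi>" "v \<in> \<eta>" "z \<in> \<zeta>" using assms bdry_nonempty by meson
  then show ?thesis
    using assms ker_triangle
    by (intro LIMSEQ_le[OF bdist_tendsto tendsto_add[OF bdist_tendsto bdist_tendsto]]) auto
qed

lemma bdist_eq_0_iff:
  assumes "\<xi> \<in> bdry" "\<eta> \<in> bdry"
  shows "bdist \<xi> \<eta> = 0 \<longleftrightarrow> \<xi> = \<eta>"
proof -
  obtain u v where uv: "u \<in> \<xi>" "v \<in> \<eta>" using assms bdry_nonempty by meson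
  have L: "(\<lambda>n. ker (u n) (v n)) \<longlonglongrightarrow> bdist \<xi> \<eta>"
    by (rule bdist_tendsto) (use assms uv in auto)
  show ?thesis
  proof
    assume "bdist \<xi> \<eta> = 0"
    then have "(u, v) \<in> boundary_rel w"
      using L bdry_conv assms uv by (simp add: boundary_rel_iff)
    then show "\<xi> = \<eta>" using bdry_eqI assms uv by blast
  next
    assume "\<xi> = \<eta>"
    then have "(\<lambda>n. ker (u n) (v n)) \<longlonglongrightarrow> 0"
      using bdry_rel assms uv by (auto simp: boundary_rel_iff)
    then show "bdist \<xi> \<eta> = 0" using L LIMSEQ_unique by blast
  qed
qed

lemma bdist_le_1: "\<xi> \<in> bdry \<Longrightarrow> \<eta> \<in> bdry \<Longrightarrow> bdist \<xi> \<eta> \<le> 1"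
  using LIMSEQ_le_const2[OF bdist_tendsto] ker_le_1 bdry_nonempty by meson

sublocale Metric_space bdry bdist
  by unfold_locales (auto simp: bdist_nonneg bdist_commute bdist_eq_0_iff bdist_triangle)

lemma bker_pos: "0 < bker \<xi> x"
  by (simp add: bker_def)

lemma bker_le_1:
  assumes "\<xi> \<in> bdry" shows "bker \<xi> x \<le> 1"
  using LIMSEQ_le_const2[OF bker_tendsto(2)] ker_le_1 bdry_nonempty assms by meson

lemma bker_ge:
  assumes "\<xi> \<in> bdry" shows "exp (- \<epsilon> * dist w x) \<le> bker \<xi> x"
  using LIMSEQ_le_const[OF bker_tendsto(2)] ker_ge bdry_nonempty assms by meson

text \<open>First of three mixed triangle inequalities, all limits of \<open>ker_triangle\<close>.
  Two boundary points close to the same \<open>x\<close> are close to each other; this bounds the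
  diameters of shadows.\<close>

lemma bdist_le_bker:
  assumes "\<xi> \<in> bdry" "\<eta> \<in> bdry"
  shows "bdist \<xi> \<eta> \<le> bker \<xi> x + bker \<eta> x"
proof -
  obtain u v where "u \<in> \<xi>" "v \<in> \<eta>" using assms bdry_nonempty by meson
  then show ?thesis
    using assms ker_triangle[of "u _" "v _" x] ker_commute[of x]
    by (intro LIMSEQ_le[OF bdist_tendsto tendsto_add[OF bker_tendsto(2) bker_tendsto(2)]]) auto
qed

lemma bker_le_bdist:
  assumes "\<xi> \<in> bdry" "\<eta> \<in> bdry"
  shows "bker \<xi> x \<le> bdist \<xi> \<eta> + bker \<eta> x"
proof -
  obtain u v where "u \<in> \<xi>" "v \<in> \<eta>" using assms bdry_nonempty by meson
  then show ?thesis
    using assms ker_triangle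
    by (intro LIMSEQ_le[OF bker_tendsto(2) tendsto_add[OF bdist_tendsto bker_tendsto(2)]]) auto
qed

lemma bker_le_ker:
  assumes "\<xi> \<in> bdry"
  shows "bker \<xi> x \<le> bker \<xi> y + ker y x"
proof -
  obtain u where "u \<in> \<xi>" using assms bdry_nonempty by meson
  then show ?thesis
    using assms ker_triangle
    by (intro LIMSEQ_le[OF bker_tendsto(2) tendsto_add[OF bker_tendsto(2) tendsto_const]]) auto
qed

lemma bker_sequence_small:
  assumes "\<xi> \<in> bdry" "u \<in> \<xi>" "e > 0"
  shows "\<exists>N. \<forall>n\<ge>N. bker \<xi> (u n) \<le> e"
proof -
  obtain N where N: "\<forall>i\<ge>N. \<forall>j\<ge>N. ker (u i) (u j) < e"
    using bdry_conv[OF assms(1,2)] assms(3) unfolding converges_to_infinity_iff_ker by blast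
  have "bker \<xi> (u n) \<le> e" if "n \<ge> N" for n
    by (rule LIMSEQ_le_const2[OF bker_tendsto(2)[OF assms(1,2)]])
      (use N that less_imp_le in blast)
  then show ?thesis by blast
qed

lemma openin_bdryI:
  assumes "U \<subseteq> bdry"
    and "\<And>\<xi>. \<xi> \<in> U \<Longrightarrow> \<exists>r>0. \<forall>\<eta>\<in>bdry. bdist \<xi> \<eta> < r \<longrightarrow> \<eta> \<in> U"
  shows "openin mtopology U"
  unfolding openin_mtopology
proof (intro conjI allI impI assms(1))
  fix \<xi> assume "\<xi> \<in> U"
  then obtain r where "r > 0" "\<forall>\<eta>\<in>bdry. bdist \<xi> \<eta> < r \<longrightarrow> \<eta> \<in> U" using assms(2) by blast
  then show "\<exists>r>0. mball \<xi> r \<subseteq> U" by (auto simp: in_mball)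
qed

lemma openin_bker_less: "openin mtopology {\<xi> \<in> bdry. bker \<xi> x < a}"
proof (rule openin_bdryI, simp, goal_cases)
  case (1 \<xi>)
  have "bker \<eta> x < a" if "\<eta> \<in> bdry" "bdist \<xi> \<eta> < a - bker \<xi> x" for \<eta>
    using bker_le_bdist[of \<eta> \<xi> x] bdist_commute that 1 by fastforce
  then show ?case using 1 by (intro exI[of _ "a - bker \<xi> x"]) auto
qed

end

locale boundary_action = visual_metric \<epsilon> w + group \<Gamma>
  for \<epsilon> :: real and w :: "'x::metric_space" and \<Gamma> :: "('g, 'm) monoid_scheme" (structure) +
  fixes \<phi> :: "'g \<Rightarrow> 'x \<Rightarrow> 'x"
  assumes isom: "isometric_action \<Gamma> \<phi>"
begin

abbreviation bmap :: "'g \<Rightarrow> (nat \<Rightarrow> 'x) set \<Rightarrow> (nat \<Rightarrow> 'x) set" where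
  "bmap g \<equiv> boundary_map (\<phi> g)"

abbreviation jac :: "'g \<Rightarrow> (nat \<Rightarrow> 'x) set \<Rightarrow> real" where
  "jac \<equiv> metric_derivative \<Gamma> \<phi> \<epsilon> w"

lemma act_mult: "g \<in> carrier \<Gamma> \<Longrightarrow> h \<in> carrier \<Gamma> \<Longrightarrow> \<phi> (g \<otimes> h) x = \<phi> g (\<phi> h x)"
  using isom group_action.composition_rule[of \<Gamma> UNIV \<phi> x g h]
  by (simp add: isometric_action_def)

lemma act_one: "\<phi> \<one> x = x"
proof -
  have "(\<lambda>x\<in>UNIV. x) = \<phi> \<one>"
    using isom group_action.id_eq_one[of \<Gamma> UNIV \<phi>] by (simp add: isometric_action_def)
  then show ?thesis by (metis restrict_apply' UNIV_I)
qed

lemma act_inv [simp]: "g \<in> carrier \<Gamma> \<Longrightarrow> \<phi> g (\<phi> (inv g) x) = x"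
  "g \<in> carrier \<Gamma> \<Longrightarrow> \<phi> (inv g) (\<phi> g x) = x"
  by (simp_all flip: act_mult add: act_one)

lemma act_dist: "g \<in> carrier \<Gamma> \<Longrightarrow> dist (\<phi> g x) (\<phi> g y) = dist x y"
  using isom by (simp add: isometric_action_def)

lemma act_dist_inv: "g \<in> carrier \<Gamma> \<Longrightarrow> dist (\<phi> (inv g) x) y = dist x (\<phi> g y)"
  using act_dist[of g "\<phi> (inv g) x" y] by simp

text \<open>Moving by \<open>g\<close> amounts to changing the base point to the image of
  \<open>w\<close> under \<open>inv g\<close>. Up to a constant, the correction is a term in
  \<open>x\<close> plus a term in \<open>y\<close>, which is why the boundary action is conformal
  exactly and not merely up to bounded factors.\<close>

lemma gp_act:
  assumes "g \<in> carrier \<Gamma>"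
  shows "gp w (\<phi> g x) (\<phi> g y) = gp w x y + dist w (\<phi> (inv g) w)
     - gp w x (\<phi> (inv g) w) - gp w y (\<phi> (inv g) w)"
  using act_dist_inv[OF assms, of w x] act_dist_inv[OF assms, of w y] act_dist[OF assms, of x y]
  by (simp add: gromov_product_def dist_commute field_simps)

lemma ker_act:
  assumes "g \<in> carrier \<Gamma>"
  shows "ker (\<phi> g x) (\<phi> g y) = ker x y * (exp (- \<epsilon> * dist w (\<phi> (inv g) w)) /
     (ker x (\<phi> (inv g) w) * ker y (\<phi> (inv g) w)))"
  unfolding ker_def gp_act[OF assms] by (simp flip: exp_add exp_diff add: algebra_simps)

lemma ker_act_le:
  assumes "g \<in> carrier \<Gamma>"
  shows "ker (\<phi> g x) (\<phi> g y) \<le> exp (\<epsilon> * dist w (\<phi> (inv g) w)) * ker x y"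
proof -
  let ?y = "\<phi> (inv g) w"
  have "gp w x ?y + gp w y ?y \<le> 2 * dist w ?y"
    using gp_le_dist[of w x ?y] gp_le_dist[of w y ?y] by simp
  then have "gp w x y - dist w ?y \<le> gp w (\<phi> g x) (\<phi> g y)"
    unfolding gp_act[OF assms] by simp
  then have "\<epsilon> * (gp w x y - dist w ?y) \<le> \<epsilon> * gp w (\<phi> g x) (\<phi> g y)"
    using eps by simp
  then show ?thesis unfolding ker_def by (simp flip: exp_add add: algebra_simps)
qed

lemma converges_act:
  assumes g: "g \<in> carrier \<Gamma>" and u: "converges_to_infinity w u"
  shows "converges_to_infinity w (\<lambda>n. \<phi> g (u n))"
  unfolding converges_to_infinity_iff_ker
proof (intro allI impI)
  fix e :: real assume "e > 0"
  define c where "c = exp (\<epsilon> * dist w (\<phi> (inv g) w))"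
  have c: "c > 0" by (simp add: c_def)
  then obtain N where N: "\<forall>i\<ge>N. \<forall>j\<ge>N. ker (u i) (u j) < e / c"
    using u \<open>e > 0\<close> unfolding converges_to_infinity_iff_ker by (meson divide_pos_pos)
  have "ker (\<phi> g (u i)) (\<phi> g (u j)) < e" if "i \<ge> N" "j \<ge> N" for i j
  proof -
    have "c * ker (u i) (u j) < e" using N that c by (simp add: field_simps)
    then show ?thesis using ker_act_le[OF g, of "u i" "u j"] by (simp add: c_def)
  qed
  then show "\<exists>N. \<forall>i\<ge>N. \<forall>j\<ge>N. ker (\<phi> g (u i)) (\<phi> g (u j)) < e" by blast
qed

lemma boundary_rel_act:
  assumes g: "g \<in> carrier \<Gamma>" and uv: "(u, v) \<in> boundary_rel w"
  shows "((\<lambda>n. \<phi> g (u n)), (\<lambda>n. \<phi> g (v n))) \<in> boundary_rel w"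
proof -
  have "(\<lambda>n. ker (u n) (v n)) \<longlonglongrightarrow> 0" using uv by (simp add: boundary_rel_iff)
  then have L: "(\<lambda>n. exp (\<epsilon> * dist w (\<phi> (inv g) w)) * ker (u n) (v n)) \<longlonglongrightarrow> 0"
    using tendsto_mult_right_zero by blast
  have "(\<lambda>n. ker (\<phi> g (u n)) (\<phi> g (v n))) \<longlonglongrightarrow> 0"
    by (rule tendsto_sandwich[OF _ _ tendsto_const L])
      (auto intro!: always_eventually less_imp_le[OF ker_pos] ker_act_le[OF g])
  then show ?thesis using uv converges_act[OF g] by (simp add: boundary_rel_iff)
qed

lemma bmap_mem: "u \<in> \<xi> \<Longrightarrow> (\<lambda>n. \<phi> g (u n)) \<in> bmap g \<xi>"
  by (simp add: boundary_map_def)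

text \<open>The image of a class lies in one class because \<open>g\<close> respects the
  equivalence; applying \<open>inv g\<close> shows that it is all of that class.\<close>

lemma bmap_in:
  assumes g: "g \<in> carrier \<Gamma>" and \<xi>: "\<xi> \<in> bdry"
  shows "bmap g \<xi> \<in> bdry"
proof -
  obtain u where u: "u \<in> \<xi>" using bdry_nonempty[OF \<xi>] by blast
  have conv: "converges_to_infinity w (\<lambda>n. \<phi> g (u n))"
    using converges_act[OF g bdry_conv[OF \<xi> u]] .
  have "bmap g \<xi> = boundary_rel w `` {\<lambda>n. \<phi> g (u n)}"
  proof
    show "bmap g \<xi> \<subseteq> boundary_rel w `` {\<lambda>n. \<phi> g (u n)}"
      using boundary_rel_act[OF g bdry_rel[OF \<xi> u]] by (auto simp: boundary_map_def)
    show "boundary_rel w `` {\<lambda>n. \<phi> g (u n)} \<subseteq> bmap g \<xi>"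
    proof
      fix v assume "v \<in> boundary_rel w `` {\<lambda>n. \<phi> g (u n)}"
      then have "(u, \<lambda>n. \<phi> (inv g) (v n)) \<in> boundary_rel w"
        using boundary_rel_act[of "inv g" "\<lambda>n. \<phi> g (u n)" v] g by simp
      then have "(\<lambda>n. \<phi> (inv g) (v n)) \<in> \<xi>" by (rule bdry_closed[OF \<xi> u])
      moreover have "v = (\<lambda>n. \<phi> g (\<phi> (inv g) (v n)))" using g by simp
      ultimately show "v \<in> bmap g \<xi>" by (metis bmap_mem)
    qed
  qed
  then show ?thesis using bdry_class[OF conv] by simp
qed

lemma bmap_mult: "g \<in> carrier \<Gamma> \<Longrightarrow> h \<in> carrier \<Gamma> \<Longrightarrow> bmap (g \<otimes> h) \<xi> = bmap g (bmap h \<xi>)"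
  by (simp add: boundary_map_def act_mult image_image)

lemma bmap_one [simp]: "bmap \<one> \<xi> = \<xi>"
  by (simp add: boundary_map_def act_one)

lemma bmap_inv [simp]: "g \<in> carrier \<Gamma> \<Longrightarrow> bmap g (bmap (inv g) \<xi>) = \<xi>"
  "g \<in> carrier \<Gamma> \<Longrightarrow> bmap (inv g) (bmap g \<xi>) = \<xi>"
  by (simp_all flip: bmap_mult)

section \<open>The metric derivative as a conformal factor\<close>

lemma jac_bker: "jac g \<xi> = exp (- \<epsilon> * dist w (\<phi> (inv g) w)) / (bker \<xi> (\<phi> (inv g) w))\<^sup>2"
  by (simp add: metric_derivative_def bker_def dist_commute power2_eq_square
      flip: exp_add exp_diff)

lemma jac_pos: "0 < jac g \<xi>"
  by (simp add: metric_derivative_def)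

text \<open>The metric derivative is the exponential of a Busemann cocycle, whence the chain rule.\<close>

lemma jac_tendsto:
  assumes g: "g \<in> carrier \<Gamma>" and \<xi>: "\<xi> \<in> bdry" "u \<in> \<xi>"
  shows "(\<lambda>n. exp (\<epsilon> * (dist w (u n) - dist w (\<phi> g (u n))))) \<longlonglongrightarrow> jac g \<xi>"
proof -
  have "\<epsilon> * (dist w (u n) - dist w (\<phi> g (u n))) =
      2 * \<epsilon> * gp w (u n) (\<phi> (inv g) w) - \<epsilon> * dist (\<phi> (inv g) w) w" for n
    using act_dist_inv[OF g, of w "u n"]
    by (simp add: gromov_product_def dist_commute algebra_simps)
  then show ?thesis
    unfolding metric_derivative_def by (simp only:) (intro tendsto_intros bker_tendsto(1)[OF \<xi>])
qed

lemma jac_mult: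
  assumes g: "g \<in> carrier \<Gamma>" and h: "h \<in> carrier \<Gamma>" and \<xi>: "\<xi> \<in> bdry"
  shows "jac (g \<otimes> h) \<xi> = jac g (bmap h \<xi>) * jac h \<xi>"
proof -
  obtain u where u: "u \<in> \<xi>" using bdry_nonempty[OF \<xi>] by blast
  have "(\<lambda>n. exp (\<epsilon> * (dist w (\<phi> h (u n)) - dist w (\<phi> g (\<phi> h (u n))))) *
        exp (\<epsilon> * (dist w (u n) - dist w (\<phi> h (u n))))) \<longlonglongrightarrow> jac g (bmap h \<xi>) * jac h \<xi>"
    by (intro tendsto_mult jac_tendsto bmap_in bmap_mem g h \<xi> u)
  then have "(\<lambda>n. exp (\<epsilon> * (dist w (u n) - dist w (\<phi> (g \<otimes> h) (u n)))))
      \<longlonglongrightarrow> jac g (bmap h \<xi>) * jac h \<xi>"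
    by (simp flip: exp_add distrib_left add: act_mult g h)
  moreover have "(\<lambda>n. exp (\<epsilon> * (dist w (u n) - dist w (\<phi> (g \<otimes> h) (u n)))))
      \<longlonglongrightarrow> jac (g \<otimes> h) \<xi>"
    by (intro jac_tendsto \<xi> u m_closed g h)
  ultimately show ?thesis using LIMSEQ_unique by blast
qed

lemma jac_one:
  assumes \<xi>: "\<xi> \<in> bdry" shows "jac \<one> \<xi> = 1"
  using jac_mult[OF one_closed one_closed \<xi>] jac_pos[of \<one> \<xi>] by simp

text \<open>\<open>bker\<close> at the orbit point lies between
  \<open>exp (- \<epsilon> * dist w (\<phi> g w))\<close> and 1; its lower bound gives this
  estimate, its upper bound the next one.\<close>

lemma jac_le:
  assumes g: "g \<in> carrier \<Gamma>" and \<xi>: "\<xi> \<in> bdry"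
  shows "jac g \<xi> \<le> exp (\<epsilon> * dist w (\<phi> g w))"
proof -
  have d: "dist w (\<phi> (inv g) w) = dist w (\<phi> g w)"
    using act_dist_inv[OF g, of w w] by (simp add: dist_commute)
  have "(exp (- \<epsilon> * dist w (\<phi> g w)))\<^sup>2 \<le> (bker \<xi> (\<phi> (inv g) w))\<^sup>2"
    using bker_ge[OF \<xi>, of "\<phi> (inv g) w"] unfolding d by (intro power_mono) auto
  then have "exp (- \<epsilon> * dist w (\<phi> g w)) / (bker \<xi> (\<phi> (inv g) w))\<^sup>2
      \<le> exp (- \<epsilon> * dist w (\<phi> g w)) / (exp (- \<epsilon> * dist w (\<phi> g w)))\<^sup>2"
    using bker_pos[of \<xi> "\<phi> (inv g) w"] by (intro divide_left_mono) auto
  also have "\<dots> = exp (\<epsilon> * dist w (\<phi> g w))"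
    by (simp add: power2_eq_square exp_minus inverse_eq_divide)
  finally show ?thesis unfolding jac_bker d .
qed

lemma jac_ge:
  assumes g: "g \<in> carrier \<Gamma>" and \<xi>: "\<xi> \<in> bdry"
  shows "exp (- \<epsilon> * dist w (\<phi> g w)) \<le> jac g \<xi>"
proof -
  have d: "dist w (\<phi> (inv g) w) = dist w (\<phi> g w)"
    using act_dist_inv[OF g, of w w] by (simp add: dist_commute)
  have "(bker \<xi> (\<phi> (inv g) w))\<^sup>2 \<le> 1"
    using bker_le_1[OF \<xi>, of "\<phi> (inv g) w"] bker_pos[of \<xi> "\<phi> (inv g) w"]
    by (simp add: power_le_one less_imp_le)
  then have "exp (- \<epsilon> * dist w (\<phi> g w)) / 1
      \<le> exp (- \<epsilon> * dist w (\<phi> g w)) / (bker \<xi> (\<phi> (inv g) w))\<^sup>2"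
    using bker_pos[of \<xi> "\<phi> (inv g) w"] by (intro divide_left_mono) auto
  then show ?thesis unfolding jac_bker d by simp
qed

lemma bdist_bmap:
  assumes g: "g \<in> carrier \<Gamma>" and \<xi>: "\<xi> \<in> bdry" and \<eta>: "\<eta> \<in> bdry"
  shows "bdist (bmap g \<xi>) (bmap g \<eta>) = sqrt (jac g \<xi>) * sqrt (jac g \<eta>) * bdist \<xi> \<eta>"
proof -
  let ?y = "\<phi> (inv g) w" and ?c = "exp (- \<epsilon> * dist w (\<phi> (inv g) w))"
  obtain u v where u: "u \<in> \<xi>" and v: "v \<in> \<eta>" using bdry_nonempty \<xi> \<eta> by meson
  have "(\<lambda>n. ker (u n) (v n) * (?c / (ker (u n) ?y * ker (v n) ?y)))
      \<longlonglongrightarrow> bdist \<xi> \<eta> * (?c / (bker \<xi> ?y * bker \<eta> ?y))"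
    using bker_pos[of \<xi> ?y] bker_pos[of \<eta> ?y]
    by (intro tendsto_mult tendsto_divide tendsto_const bdist_tendsto bker_tendsto(2) \<xi> \<eta> u v) auto
  moreover have "(\<lambda>n. ker (\<phi> g (u n)) (\<phi> g (v n))) \<longlonglongrightarrow> bdist (bmap g \<xi>) (bmap g \<eta>)"
    by (intro bdist_tendsto bmap_in bmap_mem g \<xi> \<eta> u v)
  ultimately have "bdist (bmap g \<xi>) (bmap g \<eta>) = bdist \<xi> \<eta> * (?c / (bker \<xi> ?y * bker \<eta> ?y))"
    unfolding ker_act[OF g] using LIMSEQ_unique by blast
  moreover have "sqrt (jac g \<xi>) * sqrt (jac g \<eta>) = ?c / (bker \<xi> ?y * bker \<eta> ?y)"
    unfolding jac_bker using bker_pos[of \<xi> ?y] bker_pos[of \<eta> ?y]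
    by (simp add: real_sqrt_divide)
  ultimately show ?thesis by simp
qed

lemma bdist_bmap_le:
  assumes g: "g \<in> carrier \<Gamma>" and \<xi>: "\<xi> \<in> bdry" and \<eta>: "\<eta> \<in> bdry"
    and "jac g \<xi> \<le> L" "jac g \<eta> \<le> L"
  shows "bdist (bmap g \<xi>) (bmap g \<eta>) \<le> L * bdist \<xi> \<eta>"
proof -
  have "sqrt (jac g \<xi>) * sqrt (jac g \<eta>) \<le> sqrt L * sqrt L"
    using assms(4,5) jac_pos[of g \<xi>] jac_pos[of g \<eta>] by (intro mult_mono) auto
  also have "\<dots> = L" using assms(4) jac_pos[of g \<xi>] by simp
  finally show ?thesis unfolding bdist_bmap[OF g \<xi> \<eta>] by (intro mult_right_mono bdist_nonneg)
qed

lemma bdist_bmap_le_exp: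
  assumes g: "g \<in> carrier \<Gamma>" and \<xi>: "\<xi> \<in> bdry" and \<eta>: "\<eta> \<in> bdry"
  shows "bdist (bmap g \<xi>) (bmap g \<eta>) \<le> exp (\<epsilon> * dist w (\<phi> g w)) * bdist \<xi> \<eta>"
  by (intro bdist_bmap_le jac_le assms)

text \<open>North-south dynamics: points far from \<open>g w\<close> as seen from \<open>w\<close> are moved by \<open>g\<inverse>\<close> close to
  \<open>g\<inverse> w\<close>.\<close>

lemma bker_bmap_inv:
  assumes g: "g \<in> carrier \<Gamma>" and \<xi>: "\<xi> \<in> bdry"
  shows "bker (bmap (inv g) \<xi>) (\<phi> (inv g) w) * bker \<xi> (\<phi> g w) = exp (- \<epsilon> * dist w (\<phi> g w))"
proof -
  obtain u where u: "u \<in> \<xi>" using bdry_nonempty \<xi> by meson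
  have "(\<lambda>n. ker (\<phi> (inv g) (u n)) (\<phi> (inv g) w) * ker (u n) (\<phi> g w))
      \<longlonglongrightarrow> bker (bmap (inv g) \<xi>) (\<phi> (inv g) w) * bker \<xi> (\<phi> g w)"
    by (intro tendsto_mult bker_tendsto(2) bmap_in bmap_mem \<xi> u inv_closed g)
  moreover have "ker (\<phi> (inv g) (u n)) (\<phi> (inv g) w) * ker (u n) (\<phi> g w)
      = exp (- \<epsilon> * dist w (\<phi> g w))" for n
  proof -
    have "gp w (\<phi> (inv g) (u n)) (\<phi> (inv g) w) + gp w (u n) (\<phi> g w) = dist w (\<phi> g w)"
      using act_dist_inv[OF g, of "u n" w] act_dist_inv[OF g, of w w]
        act_dist[OF inv_closed[OF g], of "u n" w]
      by (simp add: gromov_product_def dist_commute field_simps)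
    then have "- \<epsilon> * gp w (\<phi> (inv g) (u n)) (\<phi> (inv g) w) + - \<epsilon> * gp w (u n) (\<phi> g w)
        = - \<epsilon> * dist w (\<phi> g w)"
      by (metis distrib_left)
    then show ?thesis unfolding ker_def by (metis exp_add)
  qed
  ultimately show ?thesis using LIMSEQ_unique[OF tendsto_const] by (simp add: LIMSEQ_const_iff)
qed

lemma openin_bmap_vimage:
  assumes g: "g \<in> carrier \<Gamma>" and U: "openin mtopology U"
  shows "openin mtopology (bmap g -` U \<inter> bdry)"
proof (rule openin_bdryI, simp, goal_cases)
  case (1 \<xi>)
  then obtain r where r: "r > 0" "mball (bmap g \<xi>) r \<subseteq> U"
    using U unfolding openin_mtopology by blast
  define c where "c = exp (\<epsilon> * dist w (\<phi> g w))"
  have c: "c > 0" by (simp add: c_def)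
  have "bmap g \<eta> \<in> U" if \<eta>: "\<eta> \<in> bdry" and "bdist \<xi> \<eta> < r / c" for \<eta>
  proof -
    have "bdist (bmap g \<xi>) (bmap g \<eta>) \<le> c * bdist \<xi> \<eta>"
      unfolding c_def using 1 \<eta> by (intro bdist_bmap_le_exp g) auto
    also have "\<dots> < r" using that(2) c by (simp add: field_simps)
    finally have "bmap g \<eta> \<in> mball (bmap g \<xi>) r"
      using 1 \<eta> bmap_in[OF g] by (simp add: in_mball)
    then show ?thesis using r by blast
  qed
  then show ?case using r c by (intro exI[of _ "r / c"]) auto
qed

end

section \<open>The action on the measured boundary\<close>

context boundary_action
begin

lemma gp_dist_le: "\<bar>gp v x y - gp v x z\<bar> \<le> dist y z"
  using dist_triangle2[of v y z] dist_triangle2[of v z y] dist_triangle2[of x y z] dist_triangle2[of x z y]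
  by (simp add: gromov_product_def dist_commute abs_le_iff field_simps)

text \<open>Every boundary point is conical, at every scale \<open>t\<close>: follow a rough
  geodesic from \<open>w\<close> towards a far point \<open>z\<close> of a sequence representing
  \<xi>, stop at length \<open>R = - ln t / \<epsilon>\<close>, and move to an orbit point that
  cocompactness provides nearby.\<close>

lemma conical_approach:
  assumes rg: "roughly_geodesic TYPE('x)" and cc: "cocompact_action \<Gamma> \<phi>"
  shows "\<exists>C\<ge>1. \<forall>\<xi>\<in>bdry. \<forall>t. 0 < t \<longrightarrow> t \<le> 1 \<longrightarrow> (\<exists>g\<in>carrier \<Gamma>. bker \<xi> (\<phi> g w) \<le> C * t \<and>
    t / C \<le> exp (- \<epsilon> * dist w (\<phi> g w)) \<and> exp (- \<epsilon> * dist w (\<phi> g w)) \<le> C * t)"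
proof -
  obtain C0 where C0: "C0 \<ge> 0" "\<And>x y :: 'x. \<exists>a b :: real. \<exists>\<gamma> :: real \<Rightarrow> 'x. a \<le> b \<and> \<gamma> a = x \<and> \<gamma> b = y \<and>
       (\<forall>s\<in>{a..b}. \<forall>s'\<in>{a..b}.
          \<bar>s - s'\<bar> - C0 \<le> dist (\<gamma> s) (\<gamma> s') \<and> dist (\<gamma> s) (\<gamma> s') \<le> \<bar>s - s'\<bar> + C0)"
    using rg unfolding roughly_geodesic_def by blast
  obtain K where K: "compact K" "(\<Union>g\<in>carrier \<Gamma>. \<phi> g ` K) = UNIV"
    using cc unfolding cocompact_action_def by blast
  obtain C1' where "\<forall>y\<in>K. dist w y \<le> C1'"
    using compact_imp_bounded[OF K(1)] bounded_any_center[of K w] by blast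
  then obtain C1 where C1: "C1 \<ge> 0" "\<forall>y\<in>K. dist w y \<le> C1" by (metis le_max_iff_disj max.cobounded2 order_trans)
  have net: "\<exists>g\<in>carrier \<Gamma>. dist (\<phi> g w) x \<le> C1" for x
  proof -
    have "x \<in> (\<Union>g\<in>carrier \<Gamma>. \<phi> g ` K)" using K(2) by simp
    then obtain g y where "g \<in> carrier \<Gamma>" "y \<in> K" "x = \<phi> g y" by blast
    then show ?thesis using C1(2) act_dist by (intro bexI[of _ g]) auto
  qed
  \<comment> \<open>\<open>2 * C0\<close> covers the loss along the rough geodesic and
    \<open>C1\<close> the distance to the orbit; the summand 1 pays for passing from
    \<open>z\<close> to \<xi>.\<close>
  define C where "C = 1 + exp (\<epsilon> * (2 * C0 + C1))"
  have C: "C \<ge> 1" by (simp add: C_def)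
  have "\<exists>g\<in>carrier \<Gamma>. bker \<xi> (\<phi> g w) \<le> C * t \<and>
    t / C \<le> exp (- \<epsilon> * dist w (\<phi> g w)) \<and> exp (- \<epsilon> * dist w (\<phi> g w)) \<le> C * t"
    if \<xi>: "\<xi> \<in> bdry" and t: "0 < t" "t \<le> 1" for \<xi> t
  proof -
    define R where "R = - ln t / \<epsilon>"
    have R0: "R \<ge> 0" using t eps by (simp add: R_def divide_nonpos_pos)
    have tR: "t = exp (- \<epsilon> * R)" using t eps by (simp add: R_def)
    obtain u where u: "u \<in> \<xi>" using bdry_nonempty[OF \<xi>] by blast
    obtain N1 where N1: "\<forall>n\<ge>N1. bker \<xi> (u n) \<le> t" using bker_sequence_small[OF \<xi> u t(1)] by blast
    have "exp (- \<epsilon> * (R + C0)) > 0" by simp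
    then obtain N2 where N2: "\<forall>i\<ge>N2. \<forall>j\<ge>N2. ker (u i) (u j) < exp (- \<epsilon> * (R + C0))"
      using bdry_conv[OF \<xi> u] unfolding converges_to_infinity_iff_ker by blast
    \<comment> \<open>Far enough for two purposes: \<open>bker\<close> at \<open>z\<close> is at
      most \<open>t\<close>, and the diagonal bound on \<open>ker z z\<close> gives
      \<open>dist w z > R + C0\<close>, so the rough geodesic has parameter length at least
      \<open>R\<close>.\<close>
    define z where "z = u (max N1 N2)"
    have z1: "bker \<xi> z \<le> t" using N1 by (simp add: z_def)
    have "ker z z < exp (- \<epsilon> * (R + C0))" using N2 by (simp add: z_def)
    then have z2: "dist w z > R + C0" using eps by (simp add: ker_def gromov_product_def)
    obtain a b \<gamma> where \<gamma>: "a \<le> b" "\<gamma> a = w" "\<gamma> b = z"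
      "\<And>s s'. s \<in> {a..b} \<Longrightarrow> s' \<in> {a..b} \<Longrightarrow>
          \<bar>s - s'\<bar> - C0 \<le> dist (\<gamma> s) (\<gamma> s') \<and> dist (\<gamma> s) (\<gamma> s') \<le> \<bar>s - s'\<bar> + C0"
      using C0(2)[of w z] by blast
    have wz: "b - a - C0 \<le> dist w z" "dist w z \<le> b - a + C0"
      using \<gamma>(4)[of a b] \<gamma>(1-3) by auto
    then have Rb: "R \<le> b - a" using z2 by simp
    define x where "x = \<gamma> (a + R)"
    have wx: "R - C0 \<le> dist w x" "dist w x \<le> R + C0"
      using \<gamma>(4)[of a "a + R"] \<gamma>(1,2) R0 Rb by (auto simp: x_def)
    have xz: "dist x z \<le> b - a - R + C0"
      using \<gamma>(4)[of "a + R" b] \<gamma>(1,3) R0 Rb by (auto simp: x_def)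
    have zx: "gp w z x \<ge> R - 2 * C0"
      using wz wx xz C0(1) by (simp add: gromov_product_def dist_commute)
    obtain g where g: "g \<in> carrier \<Gamma>" "dist (\<phi> g w) x \<le> C1" using net by blast
    have "gp w z (\<phi> g w) \<ge> R - (2 * C0 + C1)"
      using gp_dist_le[of w z x "\<phi> g w"] zx g(2) by (simp add: dist_commute)
    then have "ker z (\<phi> g w) \<le> exp (- \<epsilon> * (R - (2 * C0 + C1)))" by (simp add: gp_ge_iff_ker_le)
    also have "\<dots> = t * exp (\<epsilon> * (2 * C0 + C1))"
      unfolding tR by (simp add: algebra_simps flip: exp_add)
    finally have 1: "bker \<xi> (\<phi> g w) \<le> C * t"
      using bker_le_ker[OF \<xi>, of "\<phi> g w" z] z1 by (simp add: C_def algebra_simps)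
    have dg: "\<bar>dist w (\<phi> g w) - R\<bar> \<le> 2 * C0 + C1"
      using wx g(2) dist_triangle2[of w "\<phi> g w" x] dist_triangle2[of w x "\<phi> g w"] C0(1)
      by (simp add: dist_commute abs_le_iff)
    have "exp (- \<epsilon> * dist w (\<phi> g w)) \<le> exp (- \<epsilon> * (R - (2 * C0 + C1)))"
      using dg eps by (simp add: abs_le_iff)
    also have "\<dots> = t * exp (\<epsilon> * (2 * C0 + C1))"
      unfolding tR by (simp add: algebra_simps flip: exp_add)
    also have "\<dots> \<le> C * t" using t by (simp add: C_def algebra_simps)
    finally have 2: "exp (- \<epsilon> * dist w (\<phi> g w)) \<le> C * t" .
    have "t / C \<le> t / exp (\<epsilon> * (2 * C0 + C1))"
      using t by (intro divide_left_mono) (auto simp: C_def add_pos_pos)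
    also have "\<dots> = exp (- \<epsilon> * (R + (2 * C0 + C1)))"
      unfolding tR by (simp add: algebra_simps flip: exp_diff)
    also have "\<dots> \<le> exp (- \<epsilon> * dist w (\<phi> g w))"
      using dg eps by (simp add: abs_le_iff)
    finally show ?thesis using 1 2 g(1) by blast
  qed
  then show ?thesis using C by blast
qed

end

locale boundary_measure = boundary_action \<epsilon> w \<Gamma> \<phi>
  for \<epsilon> :: real and w :: "'x::metric_space" and \<Gamma> :: "('g, 'm) monoid_scheme" (structure)
    and \<phi> :: "'g \<Rightarrow> 'x \<Rightarrow> 'x" +
  fixes D :: real
  assumes proper: "proper_action \<Gamma> \<phi>"
    and dim_nonneg: "D \<ge> 0"
    and ahlfors: "ahlfors_regular bdry bdist D (hausdorff_measure bdry bdist D)"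
begin

abbreviation \<nu> :: "(nat \<Rightarrow> 'x) set measure" where
  "\<nu> \<equiv> hausdorff_measure bdry bdist D"

text \<open>Turns \<open>g\<close> leaving finite sets into \<open>dist w (\<phi> g w)\<close>
  tending to infinity. The absolute value in the proof keeps \<open>w\<close> in the ball when
  \<open>R < 0\<close>.\<close>

lemma finite_orbit_ball: "finite {g \<in> carrier \<Gamma>. dist w (\<phi> g w) \<le> R}"
proof (rule finite_subset)
  show "finite {g \<in> carrier \<Gamma>. \<phi> g ` cball w \<bar>R\<bar> \<inter> cball w \<bar>R\<bar> \<noteq> {}}"
    using proper bounded_cball unfolding proper_action_def by blast
  show "{g \<in> carrier \<Gamma>. dist w (\<phi> g w) \<le> R} \<subseteq> {g \<in> carrier \<Gamma>. \<phi> g ` cball w \<bar>R\<bar> \<inter> cball w \<bar>R\<bar> \<noteq> {}}"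
  proof clarify
    fix g assume g: "dist w (\<phi> g w) \<le> R" "\<phi> g ` cball w \<bar>R\<bar> \<inter> cball w \<bar>R\<bar> = {}"
    have "\<phi> g w \<in> \<phi> g ` cball w \<bar>R\<bar>" by (intro imageI) simp
    moreover have "\<phi> g w \<in> cball w \<bar>R\<bar>" using g(1) by simp
    ultimately show False using g(2) by blast
  qed
qed

lemma measurable_bmap: "g \<in> carrier \<Gamma> \<Longrightarrow> bmap g \<in> measurable \<nu> \<nu>"
  by (rule measurable_hausdorff_measureI) (auto intro: bmap_in openin_bmap_vimage)

lemma borel_measurable_bker [measurable]: "(\<lambda>\<xi>. bker \<xi> x) \<in> borel_measurable \<nu>"
  unfolding borel_measurable_iff_less using openin_bker_less[of x] openin_hausdorff_measure by simp

lemma borel_measurable_jac [measurable]: "jac g \<in> borel_measurable \<nu>"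
  unfolding jac_bker[abs_def] by measurable

text \<open>The conformal change of variables with \<open>inv g\<close> as the map and
  \<open>g\<close> as its inverse: the push-forward under \<open>g\<close> carries the Jacobian of
  \<open>inv g\<close>, which is the factor in the representation.\<close>

lemma distr_bmap:
  assumes g: "g \<in> carrier \<Gamma>"
  shows "distr \<nu> \<nu> (bmap g) = density \<nu> (\<lambda>\<xi>. ennreal (jac (inv g) \<xi> powr D))"
proof (rule hausdorff_measure_conformal)
  show "0 < exp (- \<epsilon> * dist w (\<phi> (inv g) w))" by simp
  show "exp (- \<epsilon> * dist w (\<phi> (inv g) w)) \<le> jac (inv g) \<xi>" if "\<xi> \<in> bdry" for \<xi>
    by (intro jac_ge inv_closed g that)
  show "bdist (bmap (inv g) \<xi>) (bmap (inv g) \<eta>) = sqrt (jac (inv g) \<xi>) * sqrt (jac (inv g) \<eta>) * bdist \<xi> \<eta>"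
    if "\<xi> \<in> bdry" "\<eta> \<in> bdry" for \<xi> \<eta>
    by (intro bdist_bmap inv_closed g that)
qed (use g in \<open>auto intro: bdist_le_1 dim_nonneg measurable_bmap\<close>)

section \<open>Ahlfors regularity and sets of small diameter\<close>

definition diam :: real where
  "diam = (SUP (\<xi>, \<eta>)\<in>bdry \<times> bdry. bdist \<xi> \<eta>)"

lemma bdist_le_diam:
  assumes "\<xi> \<in> bdry" "\<eta> \<in> bdry" shows "bdist \<xi> \<eta> \<le> diam"
proof -
  have "bdd_above ((\<lambda>(\<xi>, \<eta>). bdist \<xi> \<eta>) ` (bdry \<times> bdry))"
    using bdist_le_1 by (auto simp: bdd_above_def)
  from cSUP_upper[OF _ this, of "(\<xi>, \<eta>)"] show ?thesis using assms by (simp add: diam_def)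
qed

lemma mcball_sets [measurable]: "mcball \<xi> r \<in> sets \<nu>"
proof -
  have "bdry - mcball \<xi> r \<in> sets \<nu>"
    using closedin_mcball[of \<xi> r] by (intro openin_hausdorff_measure) (simp add: closedin_def)
  then have "space \<nu> - (bdry - mcball \<xi> r) \<in> sets \<nu>" by (rule sets.compl_sets)
  moreover have "space \<nu> - (bdry - mcball \<xi> r) = mcball \<xi> r"
    using mcball_subset_mspace[of \<xi> r] by auto
  ultimately show ?thesis by simp
qed

text \<open>A ball of radius beyond the diameter is the whole boundary, so the upper bound extends
  to all radii by monotonicity of \<open>r powr D\<close>.\<close>

lemma ahlfors_constant:
  obtains c where "c > 0"
    "\<And>\<xi> r. \<xi> \<in> bdry \<Longrightarrow> 0 \<le> r \<Longrightarrow> r \<le> diam \<Longrightarrow> ennreal (r powr D / c) \<le> emeasure \<nu> (mcball \<xi> r)"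
    "\<And>\<xi> r. \<xi> \<in> bdry \<Longrightarrow> 0 \<le> r \<Longrightarrow> emeasure \<nu> (mcball \<xi> r) \<le> ennreal (c * r powr D)"
proof -
  obtain c where c: "c > 0"
    "\<And>\<xi> r. \<xi> \<in> bdry \<Longrightarrow> 0 \<le> r \<Longrightarrow> r \<le> diam \<Longrightarrow> ennreal (r powr D / c) \<le> emeasure \<nu> (mcball \<xi> r)"
    "\<And>\<xi> r. \<xi> \<in> bdry \<Longrightarrow> 0 \<le> r \<Longrightarrow> r \<le> diam \<Longrightarrow> emeasure \<nu> (mcball \<xi> r) \<le> ennreal (c * r powr D)"
    using ahlfors unfolding ahlfors_regular_def diam_def[symmetric] by blast
  have "emeasure \<nu> (mcball \<xi> r) \<le> ennreal (c * r powr D)" if \<xi>: "\<xi> \<in> bdry" and r: "0 \<le> r" for \<xi> r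
  proof (cases "r \<le> diam")
    case False
    have d0: "0 \<le> diam" using bdist_le_diam[OF \<xi> \<xi>] \<xi> by simp
    have "mcball \<xi> r \<subseteq> mcball \<xi> diam" using bdist_le_diam by auto
    then have "emeasure \<nu> (mcball \<xi> r) \<le> emeasure \<nu> (mcball \<xi> diam)"
      by (intro emeasure_mono mcball_sets)
    also have "\<dots> \<le> ennreal (c * diam powr D)" by (intro c(3) \<xi> d0) simp
    also have "\<dots> \<le> ennreal (c * r powr D)"
      using False c(1) d0 dim_nonneg by (intro ennreal_leI mult_left_mono powr_mono2) auto
    finally show ?thesis .
  qed (use c(3) \<xi> r in blast)
  then show thesis using that c by blast
qed

lemma finite_measure_nu: "finite_measure \<nu>"
proof
  show "emeasure \<nu> (space \<nu>) \<noteq> \<infinity>"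
  proof (cases "bdry = {}")
    case False
    then obtain \<xi> where \<xi>: "\<xi> \<in> bdry" by blast
    obtain c where "\<And>\<xi> r. \<xi> \<in> bdry \<Longrightarrow> 0 \<le> r \<Longrightarrow> emeasure \<nu> (mcball \<xi> r) \<le> ennreal (c * r powr D)"
      using ahlfors_constant by metis
    from this[OF \<xi>, of 1] have "emeasure \<nu> (mcball \<xi> 1) \<le> ennreal c" by simp
    moreover have "mcball \<xi> 1 = bdry" using \<xi> bdist_le_1 by auto
    ultimately show ?thesis by (auto simp: top_unique)
  next
    case True
    have "emeasure \<nu> (space \<nu>) = emeasure \<nu> {}" unfolding space_hausdorff_measure using True by (rule arg_cong)
    then show ?thesis by simp
  qed
qed

text \<open>With \<open>D = 0\<close> a point would have mass at least 1, and a boundary of diameter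
  0 would be a single null point. Positivity of \<open>D\<close> allows solving for \<open>s\<close>
  in \<open>s powr D\<close>; positivity of \<open>diam\<close> leaves room for the radii of the
  lower regularity bound.\<close>

lemma dim_diam_pos:
  assumes "emeasure \<nu> bdry \<noteq> 0"
  shows "D > 0" "diam > 0"
proof -
  have "bdry \<noteq> {}" using assms by auto
  then obtain \<xi> where \<xi>: "\<xi> \<in> bdry" by blast
  have "\<eta> = \<xi>" if "\<eta> \<in> bdry" "bdist \<xi> \<eta> \<le> 0" for \<eta>
  proof -
    have "bdist \<xi> \<eta> = 0" using that(2) nonneg[of \<xi> \<eta>] by linarith
    then show ?thesis using zero[OF \<xi> that(1)] by simp
  qed
  then have c0: "mcball \<xi> 0 = {\<xi>}" using \<xi> by (intro equalityI subsetI) auto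
  obtain c where "\<And>\<xi> r. \<xi> \<in> bdry \<Longrightarrow> 0 \<le> r \<Longrightarrow> emeasure \<nu> (mcball \<xi> r) \<le> ennreal (c * r powr D)"
    using ahlfors_constant by metis
  \<comment> \<open>Since \<open>0 powr 0 = 0\<close>, the upper bound at radius \<open>0\<close> excludes atoms even when \<open>D = 0\<close>.\<close>
  from this[OF \<xi>, of 0] have null: "emeasure \<nu> {\<xi>} = 0" by (simp add: c0)
  have sing: "{\<xi>} \<in> sets \<nu>" using mcball_sets[of \<xi> 0] c0 by simp
  show "D > 0"
  proof (rule ccontr)
    assume "\<not> D > 0"
    then have "D = 0" using dim_nonneg by simp
    then show False
      using emeasure_hausdorff_measure_cases[of D] hausdorff_outer_0_ge_1[of "{\<xi>}"] sing null assms by auto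
  qed
  show "diam > 0"
  proof (rule ccontr)
    assume "\<not> diam > 0"
    then have eq0: "bdist \<xi> \<eta> = 0" if "\<eta> \<in> bdry" for \<eta>
      using bdist_le_diam[OF \<xi> that] nonneg[of \<xi> \<eta>] by linarith
    have "\<eta> = \<xi>" if "\<eta> \<in> bdry" for \<eta>
      using zero[OF \<xi> that] eq0[OF that] by simp
    then have "bdry = {\<xi>}" using \<xi> by blast
    then show False using null assms by simp
  qed
qed

lemma small_diameter_small_measure:
  assumes e: "e > 0"
  shows "\<exists>s>0. \<forall>A\<in>sets \<nu>. (\<forall>\<xi>\<in>A. \<forall>\<eta>\<in>A. bdist \<xi> \<eta> \<le> s) \<longrightarrow> emeasure \<nu> A < ennreal e"
proof (cases "emeasure \<nu> bdry = 0")
  case True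
  have "emeasure \<nu> A = 0" if "A \<in> sets \<nu>" for A
    using emeasure_space[of \<nu> A] True by simp
  then show ?thesis using e by (intro exI[of _ 1]) auto
next
  case False
  note pos = dim_diam_pos[OF False]
  obtain c where c: "c > 0" "\<And>\<xi> r. \<xi> \<in> bdry \<Longrightarrow> 0 \<le> r \<Longrightarrow> emeasure \<nu> (mcball \<xi> r) \<le> ennreal (c * r powr D)"
    using ahlfors_constant by metis
  \<comment> \<open>Solves \<open>c * s powr D = e / 2\<close>; a nonempty set of diameter at most
    \<open>s\<close> lies in the closed ball of radius \<open>s\<close> around any of its
    points.\<close>
  define s where "s = (e / (2 * c)) powr (1 / D)"
  have s: "s > 0" using e c by (simp add: s_def)
  have "s powr D = e / (2 * c)" using pos e c by (simp add: s_def powr_powr)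
  then have cs: "c * s powr D < e" using e c by (simp add: field_simps)
  have "emeasure \<nu> A < ennreal e" if A: "A \<in> sets \<nu>" and dA: "\<forall>\<xi>\<in>A. \<forall>\<eta>\<in>A. bdist \<xi> \<eta> \<le> s" for A
  proof (cases "A = {}")
    case False
    then obtain \<xi> where \<xi>: "\<xi> \<in> A" by blast
    have AZ: "A \<subseteq> bdry" using sets.sets_into_space[OF A] by simp
    have "A \<subseteq> mcball \<xi> s" using \<xi> AZ dA by auto
    then have "emeasure \<nu> A \<le> emeasure \<nu> (mcball \<xi> s)" by (intro emeasure_mono mcball_sets)
    also have "\<dots> \<le> ennreal (c * s powr D)" using \<xi> AZ s by (intro c(2)) auto
    also have "\<dots> < ennreal e" using cs c(1) by (intro ennreal_lessI) (use e in auto)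
    finally show ?thesis .
  qed (use e in simp)
  then show ?thesis using s by blast
qed

text \<open>The shadow of the orbit point \<open>g w\<close> seen from \<open>w\<close>. The size
  \<open>s\<close> is measured by the kernel instead of a radius around \<open>g w\<close>, so the
  diameter is at most \<open>2 * s\<close> whatever \<open>g\<close> is.\<close>

definition shadow :: "'g \<Rightarrow> real \<Rightarrow> (nat \<Rightarrow> 'x) set set" where
  "shadow g s = {\<xi> \<in> bdry. bker \<xi> (\<phi> g w) \<le> s}"

lemma shadow_sets [measurable]: "shadow g s \<in> sets \<nu>"
proof -
  have "{\<xi> \<in> space \<nu>. bker \<xi> (\<phi> g w) \<le> s} \<in> sets \<nu>" by measurable
  then show ?thesis by (simp add: shadow_def)
qed

lemma shadow_diam: "\<xi> \<in> shadow g s \<Longrightarrow> \<eta> \<in> shadow g s \<Longrightarrow> bdist \<xi> \<eta> \<le> 2 * s"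
  using bdist_le_bker[of \<xi> \<eta> "\<phi> g w"] by (simp add: shadow_def)

text \<open>The two kernels in \<open>bker_bmap_inv\<close> have a fixed product, at most
  \<open>s * t\<close> here; if one factor is at least \<open>t\<close>, the other is at most
  \<open>s\<close>.\<close>

lemma bmap_inv_shadow:
  assumes g: "g \<in> carrier \<Gamma>" and \<xi>: "\<xi> \<in> bdry" and t: "t > 0" "t \<le> bker \<xi> (\<phi> g w)"
    and s: "exp (- \<epsilon> * dist w (\<phi> g w)) \<le> s * t"
  shows "bmap (inv g) \<xi> \<in> shadow (inv g) s"
proof -
  have "bker (bmap (inv g) \<xi>) (\<phi> (inv g) w) * t
      \<le> bker (bmap (inv g) \<xi>) (\<phi> (inv g) w) * bker \<xi> (\<phi> g w)"
    using t(2) bker_pos by (intro mult_left_mono) (auto intro: less_imp_le)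
  also have "\<dots> \<le> s * t" using s bker_bmap_inv[OF g \<xi>] by simp
  finally have "bker (bmap (inv g) \<xi>) (\<phi> (inv g) w) \<le> s" using t(1) by simp
  then show ?thesis using bmap_in[OF inv_closed[OF g] \<xi>] by (simp add: shadow_def)
qed

text \<open>A density point argument at a single scale, which replaces Lebesgue differentiation: a maximal
  \<open>2r\<close>-separated subset of the part of \<open>E\<close> deep inside an open neighbourhood \<open>U\<close> of \<open>E\<close> yields disjoint
  balls in \<open>U\<close> of total measure comparable to that of \<open>E\<close>, whereas \<open>U - E\<close> is as small as desired.\<close>

lemma dense_ball:
  assumes E: "E \<in> sets \<nu>" "measure \<nu> E > 0" and \<eta>: "\<eta> > 0"
  shows "\<exists>r0>0. \<forall>r. 0 < r \<longrightarrow> r < r0 \<longrightarrow> (\<exists>\<xi>\<in>bdry. measure \<nu> (mcball \<xi> r - E) \<le> \<eta> * r powr D)"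
proof -
  interpret finite_measure \<nu> by (rule finite_measure_nu)
  define m where "m = measure \<nu> E"
  have m: "m > 0" using E by (simp add: m_def)
  have EZ: "E \<subseteq> bdry" using sets.sets_into_space[OF E(1)] by simp
  have "emeasure \<nu> bdry \<noteq> 0"
    using emeasure_mono[of E bdry \<nu>] EZ E(2) sets.top[of \<nu>] by (auto simp: measure_def)
  note pos = dim_diam_pos[OF this]
  obtain c where c: "c > 0"
    "\<And>\<xi> r. \<xi> \<in> bdry \<Longrightarrow> 0 \<le> r \<Longrightarrow> r \<le> diam \<Longrightarrow> ennreal (r powr D / c) \<le> emeasure \<nu> (mcball \<xi> r)"
    "\<And>\<xi> r. \<xi> \<in> bdry \<Longrightarrow> 0 \<le> r \<Longrightarrow> emeasure \<nu> (mcball \<xi> r) \<le> ennreal (c * r powr D)"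
    using ahlfors_constant by metis
  have lower: "r powr D / c \<le> measure \<nu> (mcball \<xi> r)" if "\<xi> \<in> bdry" "0 \<le> r" "r \<le> diam" for \<xi> r
    using c(2)[OF that] by (simp add: emeasure_eq_measure)
  have upper: "measure \<nu> (mcball \<xi> r) \<le> c * r powr D" if "\<xi> \<in> bdry" "0 \<le> r" for \<xi> r
    using c(3)[OF that] c(1) by (simp add: emeasure_eq_measure)
  \<comment> \<open>Threshold at which two counts of the separated set \<open>P\<close> collide:
    covering \<open>E'\<close> by balls of radius \<open>2 * r\<close> needs
    \<open>card P > m / (2 * c * (2 * r) powr D)\<close>, while bad disjoint balls inside
    \<open>U\<close> force \<open>card P * (\<eta> * r powr D) < \<kappa>\<close>.\<close>
  define \<kappa> where "\<kappa> = \<eta> * m / (2 * c * 2 powr D)"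
  have \<kappa>: "\<kappa> > 0" using \<eta> m c(1) by (simp add: \<kappa>_def)
  obtain U where U: "openin mtopology U" "E \<subseteq> U" "measure \<nu> (U - E) < \<kappa>"
    using borel_outer_regular[OF finite_measure_nu sets_hausdorff_measure space_hausdorff_measure E(1) \<kappa>]
    by blast
  have UZ: "U \<subseteq> bdry" using openin_subset[OF U(1)] by simp
  have Us: "U \<in> sets \<nu>" by (rule openin_hausdorff_measure[OF U(1)])
  define V where "V n = (\<Union>y\<in>bdry - U. mball y (1 / real (Suc n)))" for n
  have V: "V n \<in> sets \<nu>" for n unfolding V_def by (intro openin_hausdorff_measure openin_Union) auto
  have inc: "incseq (\<lambda>n. E - V n)"
  proof (rule incseq_SucI)
    fix n
    have "mball y (1 / real (Suc (Suc n))) \<subseteq> mball y (1 / real (Suc n))" for y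
      by (rule mball_subset_concentric) (simp add: field_simps)
    then show "E - V n \<subseteq> E - V (Suc n)" unfolding V_def by blast
  qed
  have "(\<Union>n. E - V n) = E"
  proof
    show "E \<subseteq> (\<Union>n. E - V n)"
    proof
      fix x assume x: "x \<in> E"
      then obtain r where r: "r > 0" "mball x r \<subseteq> U" using U(1,2) unfolding openin_mtopology by blast
      then obtain n where n: "1 / real (Suc n) < r" using nat_approx_posE by blast
      have "x \<notin> V n"
      proof
        assume "x \<in> V n"
        then obtain y where y: "y \<in> bdry - U" "x \<in> mball y (1 / real (Suc n))" unfolding V_def by blast
        then have "y \<in> mball x r" using n commute[of y x] by (simp add: in_mball)
        then show False using r y by blast
      qed
      then show "x \<in> (\<Union>n. E - V n)" using x by blast
    qed
  qed blast
  then have "(\<lambda>n. measure \<nu> (E - V n)) \<longlonglongrightarrow> m"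
    using finite_Lim_measure_incseq[OF _ inc] E(1) V by (auto simp: m_def)
  then have "\<forall>\<^sub>F n in sequentially. m / 2 < measure \<nu> (E - V n)"
    using m by (intro order_tendstoD(1)) auto
  then obtain n where n: "m / 2 < measure \<nu> (E - V n)"
    by (meson eventually_sequentially order_refl)
  \<comment> \<open>The part of \<open>E\<close> at distance at least \<open>1 / (n + 1)\<close>
    from the complement of \<open>U\<close>; it carries more than half of the mass of
    \<open>E\<close>.\<close>
  define E' where "E' = E - V n"
  have E'Z: "E' \<subseteq> bdry" using EZ by (auto simp: E'_def)
  have E's: "E' \<in> sets \<nu>" using E(1) V by (simp add: E'_def)
  \<comment> \<open>Below the first entry, balls centred in \<open>E'\<close> stay inside
    \<open>U\<close>; below the second, the lower regularity bound applies.\<close>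
  define r0 where "r0 = min (1 / real (Suc n)) diam"
  have r0: "r0 > 0" using pos by (simp add: r0_def)
  have "\<exists>\<xi>\<in>bdry. measure \<nu> (mcball \<xi> r - E) \<le> \<eta> * r powr D" if r: "0 < r" "r < r0" for r
  proof (rule ccontr)
    assume "\<not> ?thesis"
    then have bad: "\<eta> * r powr D < measure \<nu> (mcball \<xi> r - E)" if "\<xi> \<in> bdry" for \<xi> using that by force
    have ballU: "mcball x r \<subseteq> U" if x: "x \<in> E'" for x
    proof
      fix z assume z: "z \<in> mcball x r"
      show "z \<in> U"
      proof (rule ccontr)
        assume "z \<notin> U"
        then have "x \<in> V n" unfolding V_def
          using z r commute[of x z] by (intro UN_I[of z]) (auto simp: r0_def in_mball simp del: of_nat_Suc)
        then show False using x by (simp add: E'_def)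
      qed
    qed
    define Q where "Q P \<longleftrightarrow> P \<subseteq> E' \<and> finite P \<and> (\<forall>x\<in>P. \<forall>y\<in>P. x \<noteq> y \<longrightarrow> bdist x y > 2 * r)" for P
    have disj: "disjoint_family_on (\<lambda>x. mcball x r) P" if "Q P" for P
      unfolding disjoint_family_on_def
    proof (intro ballI impI)
      fix x y assume xy: "x \<in> P" "y \<in> P" "x \<noteq> y"
      then have far: "bdist x y > 2 * r" using that by (simp add: Q_def)
      show "mcball x r \<inter> mcball y r = {}"
      proof (rule ccontr)
        assume "mcball x r \<inter> mcball y r \<noteq> {}"
        then obtain z where z: "x \<in> bdry" "y \<in> bdry" "z \<in> bdry" "bdist x z \<le> r" "bdist y z \<le> r" by auto
        then show False using triangle[of x z y] commute[of z y] far by linarith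
      qed
    qed
    have rpos: "r powr D > 0" using r by simp
    \<comment> \<open>Disjoint balls of measure at least \<open>r powr D / c\<close> fit into the
      boundary only finitely often, so a \<open>P\<close> of greatest cardinality exists. Its
      maximality makes the balls of radius \<open>2 * r\<close> cover \<open>E'\<close>.\<close>
    have card_bound: "card P \<le> nat \<lceil>measure \<nu> bdry * c / r powr D\<rceil>" if P: "Q P" for P
    proof -
      have fin: "finite P" "P \<subseteq> bdry" using P E'Z by (auto simp: Q_def)
      have "real (card P) * (r powr D / c) = (\<Sum>x\<in>P. r powr D / c)" by simp
      also have "\<dots> \<le> (\<Sum>x\<in>P. measure \<nu> (mcball x r))"
        using fin r by (intro sum_mono lower) (auto simp: r0_def)
      also have "\<dots> = measure \<nu> (\<Union>x\<in>P. mcball x r)"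
        using disj[OF P] fin by (intro finite_measure_finite_Union[symmetric]) auto
      also have "\<dots> \<le> measure \<nu> bdry"
        using bounded_measure[of "\<Union>x\<in>P. mcball x r"] by simp
      finally have "real (card P) \<le> measure \<nu> bdry * c / r powr D"
        using c(1) rpos by (simp add: field_simps)
      then show ?thesis by linarith
    qed
    have "Q {}" by (simp add: Q_def)
    moreover have "\<forall>P. Q P \<longrightarrow> card P < Suc (nat \<lceil>measure \<nu> bdry * c / r powr D\<rceil>)"
      using card_bound by (simp add: less_Suc_eq_le)
    ultimately have "\<exists>P. Q P \<and> (\<forall>P'. Q P' \<longrightarrow> card P' \<le> card P)" by (rule ex_has_greatest_nat)
    then obtain P where P: "Q P" "\<And>P'. Q P' \<Longrightarrow> card P' \<le> card P" by blast
    have fin: "finite P" "P \<subseteq> E'" "P \<subseteq> bdry" using P(1) E'Z by (auto simp: Q_def)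
    have "E' \<subseteq> (\<Union>x\<in>P. mcball x (2 * r))"
    proof
      fix x assume x: "x \<in> E'"
      show "x \<in> (\<Union>x\<in>P. mcball x (2 * r))"
      proof (rule ccontr)
        assume out: "x \<notin> (\<Union>x\<in>P. mcball x (2 * r))"
        have xZ: "x \<in> bdry" using x E'Z by blast
        have far: "bdist y x > 2 * r" if y: "y \<in> P" for y
        proof -
          have "y \<in> bdry" using y fin(3) by blast
          moreover have "x \<notin> mcball y (2 * r)" using out y by blast
          ultimately show ?thesis using xZ by simp
        qed
        have "x \<notin> P"
        proof
          assume "x \<in> P"
          then show False using far[of x] zero[OF xZ xZ] r by simp
        qed
        moreover have "Q (insert x P)"
          unfolding Q_def
        proof (intro conjI ballI impI)
          show "insert x P \<subseteq> E'" "finite (insert x P)" using x fin by auto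
          fix y z assume "y \<in> insert x P" "z \<in> insert x P" "y \<noteq> z"
          then consider "y \<in> P" "z \<in> P" | "y = x" "z \<in> P" | "y \<in> P" "z = x" by blast
          then show "2 * r < bdist y z"
          proof cases
            case 1
            then show ?thesis using P(1) \<open>y \<noteq> z\<close> by (simp add: Q_def)
          next
            case 2
            then show ?thesis using far[of z] commute[of x z] by simp
          next
            case 3
            then show ?thesis using far[of y] by simp
          qed
        qed
        ultimately show False using P(2)[of "insert x P"] fin(1) by simp
      qed
    qed
    then have "measure \<nu> E' \<le> measure \<nu> (\<Union>x\<in>P. mcball x (2 * r))"
      using fin by (intro finite_measure_mono) auto
    also have "\<dots> \<le> (\<Sum>x\<in>P. measure \<nu> (mcball x (2 * r)))"
      using fin by (intro finite_measure_subadditive_finite) auto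
    also have "\<dots> \<le> (\<Sum>x\<in>P. c * (2 * r) powr D)"
      using fin r by (intro sum_mono upper) auto
    also have "\<dots> = real (card P) * (c * 2 powr D * r powr D)" using r by (simp add: powr_mult)
    finally have cover: "m / 2 < real (card P) * (c * 2 powr D * r powr D)" using n by (simp add: E'_def)
    have "real (card P) * (\<eta> * r powr D) = (\<Sum>x\<in>P. \<eta> * r powr D)" by simp
    also have "\<dots> \<le> (\<Sum>x\<in>P. measure \<nu> (mcball x r - E))"
      using fin bad by (intro sum_mono less_imp_le) auto
    also have "\<dots> = measure \<nu> (\<Union>x\<in>P. mcball x r - E)"
      using disj[OF P(1)] fin E(1)
      by (intro finite_measure_finite_Union[symmetric]) (auto simp: disjoint_family_on_def)
    also have "\<dots> \<le> measure \<nu> (U - E)"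
      using ballU fin Us E(1) by (intro finite_measure_mono) auto
    finally have "real (card P) * (\<eta> * r powr D) < \<kappa>" using U(3) by linarith
    then have "real (card P) * (\<eta> * r powr D) * (c * 2 powr D) < \<kappa> * (c * 2 powr D)"
      using c(1) by (intro mult_strict_right_mono) auto
    also have "\<dots> = \<eta> * (m / 2)" using c(1) by (simp add: \<kappa>_def)
    also have "\<dots> < \<eta> * (real (card P) * (c * 2 powr D * r powr D))"
      using cover \<eta> by (rule mult_strict_left_mono)
    finally show False by (simp add: mult_ac)
  qed
  then show ?thesis using r0 by blast
qed

text \<open>Zoom in on a ball filled by \<open>E\<close> up to a small proportion, with a group element \<open>g\<close> such that \<open>g w\<close>
  lies on a ray towards its centre.\<close>

lemma expand_to_almost_everything:
  assumes rg: "roughly_geodesic TYPE('x)" and cc: "cocompact_action \<Gamma> \<phi>"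
    and E: "E \<in> sets \<nu>" "emeasure \<nu> E > 0" and e: "e > 0"
  shows "\<exists>g\<in>carrier \<Gamma>. emeasure \<nu> (bmap g -` (bdry - E) \<inter> bdry) < ennreal e"
proof -
  interpret finite_measure \<nu> by (rule finite_measure_nu)
  obtain C where C: "C \<ge> 1" "\<And>\<xi> t. \<xi> \<in> bdry \<Longrightarrow> 0 < t \<Longrightarrow> t \<le> 1 \<Longrightarrow>
    (\<exists>g\<in>carrier \<Gamma>. bker \<xi> (\<phi> g w) \<le> C * t \<and>
    t / C \<le> exp (- \<epsilon> * dist w (\<phi> g w)) \<and> exp (- \<epsilon> * dist w (\<phi> g w)) \<le> C * t)"
    using conical_approach[OF rg cc] by blast
  obtain s' where s': "s' > 0" "\<And>A. A \<in> sets \<nu> \<Longrightarrow> \<forall>\<xi>\<in>A. \<forall>\<eta>\<in>A. bdist \<xi> \<eta> \<le> s' \<Longrightarrow> emeasure \<nu> A < ennreal (e / 2)"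
    using small_diameter_small_measure[of "e / 2"] e by auto
  define s where "s = s' / 2"
  have s: "s > 0" using s' by (simp add: s_def)
  \<comment> \<open>Radius, in units of \<open>t\<close>, of the ball to be enlarged. Outside it
    \<open>bker\<close> at \<open>g w\<close> is at least \<open>(K - C) * t = C * t / s\<close>, so
    \<open>inv g\<close> sends the point into a shadow of size \<open>s\<close>.\<close>
  define K where "K = C + C / s"
  have K: "K > C" "K > 0" "C / s = K - C" using C s by (auto simp: K_def add_pos_pos)
  \<comment> \<open>\<open>inv g\<close> stretches distances by at most \<open>C / t\<close>, so the
    part of the ball outside \<open>E\<close>, of measure at most
    \<open>\<eta> * (K * t) powr D\<close>, grows to at most
    \<open>\<eta> * (C * K) powr D = e / 2\<close>.\<close>
  define \<eta> where "\<eta> = e / (2 * (C * K) powr D)"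
  have CK: "(C * K) powr D > 0" using C K by simp
  have \<eta>: "\<eta> > 0" using e CK by (simp add: \<eta>_def)
  have "measure \<nu> E > 0" using E(2) by (simp add: emeasure_eq_measure)
  then obtain r0 where r0: "r0 > 0"
    "\<And>r. 0 < r \<Longrightarrow> r < r0 \<Longrightarrow> (\<exists>\<xi>\<in>bdry. measure \<nu> (mcball \<xi> r - E) \<le> \<eta> * r powr D)"
    using dense_ball[OF E(1) _ \<eta>] by blast
  define t where "t = min 1 (r0 / (2 * K))"
  have t: "0 < t" "t \<le> 1" using r0 K by (auto simp: t_def)
  have "t \<le> r0 / (2 * K)" by (simp add: t_def)
  then have "K * t \<le> r0 / 2" using K by (simp add: field_simps)
  then have Kt: "0 < K * t" "K * t < r0" using K t r0 by auto
  obtain \<xi> where \<xi>: "\<xi> \<in> bdry" "measure \<nu> (mcball \<xi> (K * t) - E) \<le> \<eta> * (K * t) powr D"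
    using r0(2)[OF Kt] by blast
  obtain g where g: "g \<in> carrier \<Gamma>" and g1: "bker \<xi> (\<phi> g w) \<le> C * t"
    and g2: "t / C \<le> exp (- \<epsilon> * dist w (\<phi> g w))" and g3: "exp (- \<epsilon> * dist w (\<phi> g w)) \<le> C * t"
    using C(2)[OF \<xi>(1) t] by blast
  let ?B = "mcball \<xi> (K * t) - E"
  have Bs: "?B \<in> sets \<nu>" using E(1) by auto
  have img: "bmap (inv g) ` ?B = bmap g -` ?B \<inter> bdry"
  proof
    show "bmap (inv g) ` ?B \<subseteq> bmap g -` ?B \<inter> bdry"
      using g bmap_in[OF inv_closed[OF g]] by auto
    show "bmap g -` ?B \<inter> bdry \<subseteq> bmap (inv g) ` ?B"
    proof
      fix \<zeta> assume "\<zeta> \<in> bmap g -` ?B \<inter> bdry"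
      then show "\<zeta> \<in> bmap (inv g) ` ?B" using g by (intro image_eqI[of _ _ "bmap g \<zeta>"]) auto
    qed
  qed
  have imgs: "bmap (inv g) ` ?B \<in> sets \<nu>"
    unfolding img using measurable_sets[OF measurable_bmap[OF g] Bs] by simp
  have di: "dist w (\<phi> (inv g) w) = dist w (\<phi> g w)"
    using act_dist_inv[OF g, of w w] by (simp add: dist_commute)
  have sub: "bmap g -` (bdry - E) \<inter> bdry \<subseteq> shadow (inv g) s \<union> bmap (inv g) ` ?B"
  proof
    fix \<zeta> assume "\<zeta> \<in> bmap g -` (bdry - E) \<inter> bdry"
    then have \<zeta>: "\<zeta> \<in> bdry" "bmap g \<zeta> \<notin> E" "bmap g \<zeta> \<in> bdry" by auto
    show "\<zeta> \<in> shadow (inv g) s \<union> bmap (inv g) ` ?B"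
    proof (cases "bmap g \<zeta> \<in> mcball \<xi> (K * t)")
      case True
      then show ?thesis unfolding img using \<zeta> by blast
    next
      case False
      then have "K * t < bdist \<xi> (bmap g \<zeta>)" using \<xi> \<zeta> by simp
      then have "(K - C) * t \<le> bker (bmap g \<zeta>) (\<phi> g w)"
        using bdist_le_bker[OF \<xi>(1) \<zeta>(3), of "\<phi> g w"] g1 by (simp add: left_diff_distrib)
      moreover have "exp (- \<epsilon> * dist w (\<phi> g w)) \<le> s * ((K - C) * t)"
        using g3 s by (simp flip: K(3))
      ultimately have "bmap (inv g) (bmap g \<zeta>) \<in> shadow (inv g) s"
        using K(1) t by (intro bmap_inv_shadow[OF g \<zeta>(3), of "(K - C) * t"]) auto
      then show ?thesis using g by simp
    qed
  qed
  have small1: "emeasure \<nu> (shadow (inv g) s) < ennreal (e / 2)"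
    using shadow_diam[of _ "inv g" s] by (intro s'(2) shadow_sets) (auto simp: s_def)
  have exp_le: "exp (\<epsilon> * dist w (\<phi> g w)) \<le> C / t"
    using g2 C(1) t by (simp add: exp_minus field_simps)
  have "emeasure \<nu> (bmap (inv g) ` ?B) \<le> ennreal ((C / t) powr D) * emeasure \<nu> ?B"
  proof (rule emeasure_hausdorff_measure_lipschitz[where B = 1])
    fix \<zeta> \<zeta>' assume "\<zeta> \<in> ?B" "\<zeta>' \<in> ?B"
    then have "bdist (bmap (inv g) \<zeta>) (bmap (inv g) \<zeta>') \<le> exp (\<epsilon> * dist w (\<phi> g w)) * bdist \<zeta> \<zeta>'"
      using bdist_bmap_le_exp[OF inv_closed[OF g], of \<zeta> \<zeta>'] unfolding di by simp
    also have "\<dots> \<le> C / t * bdist \<zeta> \<zeta>'"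
      by (intro mult_right_mono bdist_nonneg exp_le)
    finally show "bdist (bmap (inv g) \<zeta>) (bmap (inv g) \<zeta>') \<le> C / t * bdist \<zeta> \<zeta>'" .
  qed (use C t Bs imgs dim_nonneg bdist_le_1 in auto)
  also have "\<dots> \<le> ennreal ((C / t) powr D) * ennreal (\<eta> * (K * t) powr D)"
    using \<xi>(2) by (intro mult_left_mono) (auto simp: emeasure_eq_measure intro: ennreal_leI)
  also have "\<dots> = ennreal ((C / t) powr D * (\<eta> * (K * t) powr D))"
    using \<eta> by (simp add: ennreal_mult)
  also have "(C / t) powr D * (\<eta> * (K * t) powr D) = \<eta> * (C * K) powr D"
    using C t K by (simp add: powr_mult powr_divide)
  also have "\<dots> = e / 2" using CK by (simp add: \<eta>_def)
  finally have small2: "emeasure \<nu> (bmap (inv g) ` ?B) \<le> ennreal (e / 2)" .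
  have "emeasure \<nu> (bmap g -` (bdry - E) \<inter> bdry) \<le> emeasure \<nu> (shadow (inv g) s \<union> bmap (inv g) ` ?B)"
    using sub imgs by (intro emeasure_mono) auto
  also have "\<dots> \<le> emeasure \<nu> (shadow (inv g) s) + emeasure \<nu> (bmap (inv g) ` ?B)"
    using imgs by (intro emeasure_subadditive) auto
  also have "\<dots> \<le> ennreal (e / 2) + emeasure \<nu> (shadow (inv g) s)"
    using small2 by (subst add.commute) (rule add_right_mono)
  also have "\<dots> < ennreal (e / 2) + ennreal (e / 2)"
    using small1 by (simp add: ennreal_add_left_cancel_less)
  also have "\<dots> = ennreal e" using e by (simp flip: ennreal_plus)
  finally show ?thesis using g by blast
qed

end

section \<open>The boundary representations\<close>

text \<open>The trivial subgroup is cyclic, and a finite group has finitely many cosets. Mixing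
  demands an infinite group, which non-elementarity supplies in this way.\<close>

lemma (in group) elementary_if_finite:
  assumes "finite (carrier G)" shows "elementary_group G"
proof -
  have "subgroup (generate G {\<one>}) G" by (rule generate_is_subgroup) simp
  moreover have "finite (rcosets (generate G {\<one>}))" using assms by (simp add: RCOSETS_def)
  ultimately show ?thesis unfolding elementary_group_def by blast
qed

context boundary_measure
begin

abbreviation rep_fun ("\<pi>") where
  "\<pi> \<equiv> boundary_rep_fun \<Gamma> \<phi> \<epsilon> w D"

abbreviation rep ("\<Pi>") where
  "\<Pi> \<equiv> boundary_rep \<Gamma> \<phi> \<epsilon> w D \<nu>"

section \<open>The representation on functions and on classes\<close>

lemma bdry_sets [simp]: "bdry \<in> sets \<nu>"
  using sets.top[of \<nu>] by simp

text \<open>Positivity of \<open>jac\<close> turns the complex power into the exponential of a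
  multiple of a real logarithm: measurability is immediate, and the chain rule becomes additivity of
  exponents.\<close>

lemma rep_fun_exp:
  "\<pi> p t g \<psi> \<xi> = exp ((complex_of_real (D / p) - \<i> * complex_of_real t) * complex_of_real (ln (jac (inv g) \<xi>)))
     * \<psi> (bmap (inv g) \<xi>)"
  using jac_pos[of "inv g" \<xi>] by (simp add: boundary_rep_fun_def powr_def Ln_of_real)

lemma cmod_rep_fun: "cmod (\<pi> p t g \<psi> \<xi>) = jac (inv g) \<xi> powr (D / p) * cmod (\<psi> (bmap (inv g) \<xi>))"
  using jac_pos[of "inv g" \<xi>] by (simp add: boundary_rep_fun_def norm_mult norm_powr_real_powr)

lemma rep_fun_measurable:
  assumes g: "g \<in> carrier \<Gamma>" and \<psi>: "\<psi> \<in> borel_measurable \<nu>"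
  shows "\<pi> p t g \<psi> \<in> borel_measurable \<nu>"
proof -
  have [measurable]: "(\<lambda>\<xi>. \<psi> (bmap (inv g) \<xi>)) \<in> borel_measurable \<nu>"
    using measurable_compose[OF measurable_bmap[OF inv_closed[OF g]] \<psi>] .
  show ?thesis unfolding rep_fun_exp[abs_def] by measurable
qed

text \<open>The push-forward of \<open>\<nu>\<close> has a density with respect to
  \<open>\<nu>\<close>, so preimages of null sets are null. This makes the representation well
  defined on classes.\<close>

lemma AE_bmap:
  assumes g: "g \<in> carrier \<Gamma>" and P: "AE \<xi> in \<nu>. P \<xi>"
  shows "AE \<xi> in \<nu>. P (bmap g \<xi>)"
proof (rule AE_distrD[OF measurable_bmap[OF g]])
  show "AE \<xi> in distr \<nu> \<nu> (bmap g). P \<xi>"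
    unfolding distr_bmap[OF g] using P by (subst AE_density) auto
qed

lemma boundary_rep_class:
  assumes g: "g \<in> carrier \<Gamma>" and \<psi>: "\<psi> \<in> borel_measurable \<nu>"
  shows "\<Pi> p t g (ae_class \<nu> \<psi>) = ae_class \<nu> (\<pi> p t g \<psi>)"
  unfolding boundary_rep_def
proof (rule UN_ae_class[OF \<psi>])
  fix h assume "AE x in \<nu>. h x = \<psi> x"
  then have "AE x in \<nu>. h (bmap (inv g) x) = \<psi> (bmap (inv g) x)"
    by (rule AE_bmap[OF inv_closed[OF g]])
  then show "AE x in \<nu>. \<pi> p t g h x = \<pi> p t g \<psi> x"
    by eventually_elim (simp add: boundary_rep_fun_def)
qed

lemma integral_bmap:
  fixes F :: "_ \<Rightarrow> 'b::{banach, second_countable_topology}"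
  assumes g: "g \<in> carrier \<Gamma>" and F: "F \<in> borel_measurable \<nu>"
  shows "integrable \<nu> (\<lambda>\<xi>. (jac (inv g) \<xi> powr D) *\<^sub>R F \<xi>) \<longleftrightarrow> integrable \<nu> (\<lambda>\<xi>. F (bmap g \<xi>))"
    and "(\<integral>\<xi>. (jac (inv g) \<xi> powr D) *\<^sub>R F \<xi> \<partial>\<nu>) = (\<integral>\<xi>. F (bmap g \<xi>) \<partial>\<nu>)"
proof -
  show "integrable \<nu> (\<lambda>\<xi>. (jac (inv g) \<xi> powr D) *\<^sub>R F \<xi>) \<longleftrightarrow> integrable \<nu> (\<lambda>\<xi>. F (bmap g \<xi>))"
    using integrable_distr_eq[OF measurable_bmap[OF g] F] F
    unfolding distr_bmap[OF g] by (subst (asm) integrable_density) auto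
  show "(\<integral>\<xi>. (jac (inv g) \<xi> powr D) *\<^sub>R F \<xi> \<partial>\<nu>) = (\<integral>\<xi>. F (bmap g \<xi>) \<partial>\<nu>)"
    using integral_distr[OF measurable_bmap[OF g] F] F
    unfolding distr_bmap[OF g] by (subst (asm) integral_density) auto
qed

text \<open>The p-th power of the modulus removes the imaginary exponent and turns
  \<open>D / p\<close> into \<open>D\<close>, leaving the Jacobian. The set \<open>A\<close> records
  where mass goes: what lies on \<open>A\<close> comes from the preimage of \<open>A\<close> under
  \<open>g\<close>. With \<open>A\<close> the whole boundary this is isometry.\<close>

lemma integral_rep_fun_powr:
  assumes g: "g \<in> carrier \<Gamma>" and p: "p > 0" and \<psi>: "\<psi> \<in> lp_functions p \<nu>" and A: "A \<in> sets \<nu>"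
  shows "integrable \<nu> (\<lambda>\<xi>. indicator A \<xi> * cmod (\<pi> p t g \<psi> \<xi>) powr p)"
    and "(\<integral>\<xi>. indicator A \<xi> * cmod (\<pi> p t g \<psi> \<xi>) powr p \<partial>\<nu>) =
      (\<integral>\<xi>. indicator (bmap g -` A \<inter> bdry) \<xi> * cmod (\<psi> \<xi>) powr p \<partial>\<nu>)"
proof -
  note lp = lp_functionsD[OF \<psi>]
  note [measurable] = A
  have [measurable]: "(\<lambda>\<xi>. \<psi> (bmap (inv g) \<xi>)) \<in> borel_measurable \<nu>"
    using measurable_compose[OF measurable_bmap[OF inv_closed[OF g]] lp(1)] .
  define F where "F = (\<lambda>\<xi>. indicator A \<xi> * cmod (\<psi> (bmap (inv g) \<xi>)) powr p :: real)"
  have F: "F \<in> borel_measurable \<nu>" unfolding F_def by measurable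
  have 1: "(\<lambda>\<xi>. indicator A \<xi> * cmod (\<pi> p t g \<psi> \<xi>) powr p) = (\<lambda>\<xi>. (jac (inv g) \<xi> powr D) *\<^sub>R F \<xi>)"
    using p by (simp add: F_def cmod_rep_fun powr_mult powr_powr mult_ac)
  have 2: "F (bmap g \<xi>) = indicator (bmap g -` A \<inter> bdry) \<xi> * cmod (\<psi> \<xi>) powr p" if "\<xi> \<in> space \<nu>" for \<xi>
    using that g by (simp add: F_def indicator_def)
  have pre: "bmap g -` A \<inter> bdry \<in> sets \<nu>" using measurable_sets[OF measurable_bmap[OF g] A] by simp
  have "integrable \<nu> (\<lambda>\<xi>. indicator (bmap g -` A \<inter> bdry) \<xi> * cmod (\<psi> \<xi>) powr p)"
    using integrable_mult_indicator[OF pre lp(2)] by simp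
  then have "integrable \<nu> (\<lambda>\<xi>. F (bmap g \<xi>))"
    by (subst Bochner_Integration.integrable_cong[OF refl 2]) auto
  then show "integrable \<nu> (\<lambda>\<xi>. indicator A \<xi> * cmod (\<pi> p t g \<psi> \<xi>) powr p)"
    unfolding 1 integral_bmap(1)[OF g F] .
  show "(\<integral>\<xi>. indicator A \<xi> * cmod (\<pi> p t g \<psi> \<xi>) powr p \<partial>\<nu>) =
      (\<integral>\<xi>. indicator (bmap g -` A \<inter> bdry) \<xi> * cmod (\<psi> \<xi>) powr p \<partial>\<nu>)"
    unfolding 1 integral_bmap(2)[OF g F] by (rule Bochner_Integration.integral_cong[OF refl 2])
qed

lemma rep_fun_lp:
  assumes g: "g \<in> carrier \<Gamma>" and p: "p > 0" and \<psi>: "\<psi> \<in> lp_functions p \<nu>"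
  shows "\<pi> p t g \<psi> \<in> lp_functions p \<nu>" and "lp_norm p \<nu> (\<pi> p t g \<psi>) = lp_norm p \<nu> \<psi>"
proof -
  have pre: "bmap g -` bdry \<inter> bdry = bdry" using bmap_in[OF g] by auto
  note * = integral_rep_fun_powr[OF g p \<psi> bdry_sets, of t]
  have "integrable \<nu> (\<lambda>\<xi>. cmod (\<pi> p t g \<psi> \<xi>) powr p)"
    using *(1) by (subst Bochner_Integration.integrable_cong[OF refl, of _ _
      "\<lambda>\<xi>. indicator bdry \<xi> * cmod (\<pi> p t g \<psi> \<xi>) powr p"]) auto
  then show "\<pi> p t g \<psi> \<in> lp_functions p \<nu>"
    using rep_fun_measurable[OF g lp_functionsD(1)[OF \<psi>]] by (simp add: lp_functions_def)
  have ind: "(\<integral>\<xi>. indicator bdry \<xi> * u \<xi> \<partial>\<nu>) = (\<integral>\<xi>. u \<xi> \<partial>\<nu>)" for u :: "_ \<Rightarrow> real"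
    by (rule Bochner_Integration.integral_cong) auto
  show "lp_norm p \<nu> (\<pi> p t g \<psi>) = lp_norm p \<nu> \<psi>"
    using *(2) unfolding pre ind by (simp add: lp_norm_def)
qed

text \<open>For \<open>p = 1\<close> and \<open>t = 0\<close> the factor is the Jacobian itself, so
  the integral and not only the norm is preserved; hence the mean-zero subspace is
  invariant.\<close>

lemma integral_rep_fun_1:
  assumes g: "g \<in> carrier \<Gamma>" and \<psi>: "integrable \<nu> \<psi>"
  shows "(\<integral>\<xi>. \<pi> 1 0 g \<psi> \<xi> \<partial>\<nu>) = (\<integral>\<xi>. \<psi> \<xi> \<partial>\<nu>)"
proof -
  have m: "(\<lambda>\<xi>. \<psi> (bmap (inv g) \<xi>)) \<in> borel_measurable \<nu>"
    using measurable_compose[OF measurable_bmap[OF inv_closed[OF g]] borel_measurable_integrable[OF \<psi>]] .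
  have "\<pi> 1 0 g \<psi> = (\<lambda>\<xi>. (jac (inv g) \<xi> powr D) *\<^sub>R \<psi> (bmap (inv g) \<xi>))"
    using jac_pos[of "inv g"]
    by (auto simp: boundary_rep_fun_def powr_of_real less_imp_le scaleR_conv_of_real)
  then have "(\<integral>\<xi>. \<pi> 1 0 g \<psi> \<xi> \<partial>\<nu>) = (\<integral>\<xi>. (jac (inv g) \<xi> powr D) *\<^sub>R \<psi> (bmap (inv g) \<xi>) \<partial>\<nu>)"
    by simp
  also have "\<dots> = (\<integral>\<xi>. \<psi> \<xi> \<partial>\<nu>)" using integral_bmap(2)[OF g m] g by simp
  finally show ?thesis .
qed

lemma rep_fun_mult:
  assumes g: "g \<in> carrier \<Gamma>" and h: "h \<in> carrier \<Gamma>" and \<xi>: "\<xi> \<in> bdry"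
  shows "\<pi> p t (g \<otimes> h) \<psi> \<xi> = \<pi> p t g (\<pi> p t h \<psi>) \<xi>"
proof -
  have "ln (jac (inv (g \<otimes> h)) \<xi>) = ln (jac (inv h) (bmap (inv g) \<xi>)) + ln (jac (inv g) \<xi>)"
    using g h jac_pos by (simp add: inv_mult_group jac_mult \<xi> ln_mult_pos)
  moreover have "bmap (inv (g \<otimes> h)) \<xi> = bmap (inv h) (bmap (inv g) \<xi>)"
    using g h by (simp add: inv_mult_group bmap_mult)
  ultimately show ?thesis
    by (simp add: rep_fun_exp distrib_left exp_add)
qed

lemma rep_fun_one: "\<xi> \<in> bdry \<Longrightarrow> \<pi> p t \<one> \<psi> \<xi> = \<psi> \<xi>"
  by (simp add: rep_fun_exp jac_one)

text \<open>An invariant set \<open>S\<close> of functions stands for the whole space or for the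
  functions of mean zero, so that one proof serves both. The laws for the unit and for products hold
  pointwise on the boundary, which suffices for classes.\<close>

lemma representation_Lp:
  assumes p: "p > 0" and S: "S \<subseteq> lp_functions p \<nu>"
    and carrier: "carrier V = ae_class \<nu> ` S"
    and ops: "vadd V = vadd (Lp_space p \<nu>)" "vscale V = vscale (Lp_space p \<nu>)" "vnorm V = vnorm (Lp_space p \<nu>)"
    and inv: "\<And>g \<psi>. g \<in> carrier \<Gamma> \<Longrightarrow> \<psi> \<in> S \<Longrightarrow> \<pi> p t g \<psi> \<in> S"
  shows "representation \<Gamma> V (\<Pi> p t)"
proof -
  have m: "\<psi> \<in> borel_measurable \<nu>" if "\<psi> \<in> S" for \<psi> using lp_functionsD S that by blast
  show ?thesis
    unfolding representation_def bounded_operators_def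
  proof (intro conjI ballI CollectI allI)
    fix g v assume g: "g \<in> carrier \<Gamma>" and "v \<in> carrier V"
    then obtain f where f: "f \<in> S" "v = ae_class \<nu> f" by (auto simp: carrier)
    show "\<Pi> p t g v \<in> carrier V"
      using f inv[OF g] by (simp add: boundary_rep_class g m carrier)
  next
    fix g v v' assume g: "g \<in> carrier \<Gamma>" and "v \<in> carrier V" "v' \<in> carrier V"
    then obtain f f' where f: "f \<in> S" "v = ae_class \<nu> f" "f' \<in> S" "v' = ae_class \<nu> f'"
      by (auto simp: carrier)
    have "\<pi> p t g (\<lambda>\<xi>. f \<xi> + f' \<xi>) = (\<lambda>\<xi>. \<pi> p t g f \<xi> + \<pi> p t g f' \<xi>)"
      by (rule ext) (simp add: boundary_rep_fun_def distrib_left)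
    moreover have "(\<lambda>\<xi>. f \<xi> + f' \<xi>) \<in> borel_measurable \<nu>"
      using f m by (intro borel_measurable_add) auto
    ultimately show "\<Pi> p t g (vadd V v v') = vadd V (\<Pi> p t g v) (\<Pi> p t g v')"
      using f g by (simp add: ops vadd_Lp boundary_rep_class m rep_fun_measurable)
  next
    fix g c v assume g: "g \<in> carrier \<Gamma>" and "v \<in> carrier V"
    then obtain f where f: "f \<in> S" "v = ae_class \<nu> f" by (auto simp: carrier)
    have "\<pi> p t g (\<lambda>\<xi>. c * f \<xi>) = (\<lambda>\<xi>. c * \<pi> p t g f \<xi>)"
      by (rule ext) (simp add: boundary_rep_fun_def mult_ac)
    moreover have "(\<lambda>\<xi>. c * f \<xi>) \<in> borel_measurable \<nu>"
      using f m by (intro borel_measurable_times) auto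
    ultimately show "\<Pi> p t g (vscale V c v) = vscale V c (\<Pi> p t g v)"
      using f g by (simp add: ops vscale_Lp boundary_rep_class m rep_fun_measurable)
  next
    fix g assume g: "g \<in> carrier \<Gamma>"
    have "vnorm V (\<Pi> p t g v) \<le> 1 * vnorm V v" if v: "v \<in> carrier V" for v
    proof -
      obtain f where f: "f \<in> S" "v = ae_class \<nu> f" using v by (auto simp: carrier)
      then show ?thesis
        using rep_fun_lp(2)[OF g p, of f] S g
        by (auto simp: ops vnorm_Lp boundary_rep_class m rep_fun_measurable)
    qed
    then show "\<exists>C. \<forall>v\<in>carrier V. vnorm V (\<Pi> p t g v) \<le> C * vnorm V v" by blast
  next
    fix v assume "v \<in> carrier V"
    then obtain f where f: "f \<in> S" "v = ae_class \<nu> f" by (auto simp: carrier)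
    have "AE \<xi> in \<nu>. \<pi> p t \<one> f \<xi> = f \<xi>" by (rule AE_I2) (simp add: rep_fun_one)
    then show "\<Pi> p t \<one> v = v" using f by (simp add: boundary_rep_class m ae_class_eqI)
  next
    fix g h v assume g: "g \<in> carrier \<Gamma>" and h: "h \<in> carrier \<Gamma>" and "v \<in> carrier V"
    then obtain f where f: "f \<in> S" "v = ae_class \<nu> f" by (auto simp: carrier)
    have "AE \<xi> in \<nu>. \<pi> p t (g \<otimes> h) f \<xi> = \<pi> p t g (\<pi> p t h f) \<xi>"
      by (rule AE_I2) (simp add: rep_fun_mult g h)
    then show "\<Pi> p t (g \<otimes> h) v = \<Pi> p t g (\<Pi> p t h v)"
      using f g h by (simp add: boundary_rep_class m rep_fun_measurable ae_class_eqI)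
  qed
qed

theorem mixing_Lp:
  assumes p: "p > 1" and inf: "infinite (carrier \<Gamma>)"
  shows "mixing \<Gamma> (Lp_space p \<nu>) (\<Pi> p t)"
  unfolding mixing_def
proof (intro conjI ballI)
  have p0: "p > 0" using p by simp
  show "representation \<Gamma> (Lp_space p \<nu>) (\<Pi> p t)"
    by (rule representation_Lp[OF p0 order_refl carrier_Lp]) (auto intro: rep_fun_lp(1) p0)
  show "infinite (carrier \<Gamma>)" by (rule inf)
  fix \<theta> v assume \<theta>: "\<theta> \<in> topological_dual (Lp_space p \<nu>)" and v: "v \<in> carrier (Lp_space p \<nu>)"
  then obtain \<psi> where \<psi>: "\<psi> \<in> lp_functions p \<nu>" "v = ae_class \<nu> \<psi>" by (auto simp: carrier_Lp)
  define F where "F f = \<theta> (ae_class \<nu> f)" for f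
  have F_add: "F (\<lambda>x. f x + h x) = F f + F h" if "f \<in> lp_functions p \<nu>" "h \<in> lp_functions p \<nu>" for f h
    using that \<theta> lp_functionsD(1)[OF that(1)] lp_functionsD(1)[OF that(2)]
    by (auto simp: F_def topological_dual_def carrier_Lp simp flip: vadd_Lp[of _ _ _ p])
  have F_scale: "F (\<lambda>x. c * f x) = c * F f" if "f \<in> lp_functions p \<nu>" for c f
    using that \<theta> lp_functionsD(1)[OF that]
    by (auto simp: F_def topological_dual_def carrier_Lp simp flip: vscale_Lp[of _ _ p])
  obtain C' where C': "\<And>v. v \<in> carrier (Lp_space p \<nu>) \<Longrightarrow> cmod (\<theta> v) \<le> C' * vnorm (Lp_space p \<nu>) v"
    using \<theta> unfolding topological_dual_def by blast
  define C where "C = \<bar>C'\<bar> + 1"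
  have C: "C > 0" by (simp add: C_def)
  have F_bound: "cmod (F f) \<le> C * lp_norm p \<nu> f" if f: "f \<in> lp_functions p \<nu>" for f
  proof -
    have "cmod (F f) \<le> C' * lp_norm p \<nu> f"
      using C'[of "ae_class \<nu> f"] f lp_functionsD(1)[OF f] by (simp add: F_def carrier_Lp vnorm_Lp)
    also have "\<dots> \<le> C * lp_norm p \<nu> f"
      by (intro mult_right_mono lp_norm_nonneg) (simp add: C_def)
    finally show ?thesis .
  qed
  show "((\<lambda>g. \<theta> (\<Pi> p t g v)) \<longlongrightarrow> 0) (inf cofinite (principal (carrier \<Gamma>)))"
  proof (rule tendstoI)
    fix e :: real assume e: "e > 0"
    define R where "R = lp_norm p \<nu> \<psi> + 1"
    have R: "R \<ge> 1" using lp_norm_nonneg[of p \<nu> \<psi>] by (simp add: R_def)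
    obtain r where r: "r > 0" "\<And>A h. A \<in> sets \<nu> \<Longrightarrow> h \<in> lp_functions p \<nu> \<Longrightarrow> emeasure \<nu> A < ennreal r \<Longrightarrow>
        (\<And>x. x \<in> space \<nu> - A \<Longrightarrow> h x = 0) \<Longrightarrow> lp_norm p \<nu> h \<le> 1 \<Longrightarrow> cmod (F h) \<le> e / (4 * R)"
    proof -
      have "e / (4 * R) > 0" using e R by simp
      from lp_functional_small_sets[OF p F_add F_scale F_bound this] show ?thesis using that by blast
    qed
    obtain s' where s': "s' > 0" "\<And>A. A \<in> sets \<nu> \<Longrightarrow> \<forall>\<xi>\<in>A. \<forall>\<eta>\<in>A. bdist \<xi> \<eta> \<le> s' \<Longrightarrow> emeasure \<nu> A < ennreal r"
      using small_diameter_small_measure[OF r(1)] by auto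
    \<comment> \<open>\<open>C * k = e / 4\<close> bounds the contribution from outside the
      shadow.\<close>
    define k where "k = e / (4 * C)"
    have k: "k > 0" using e C by (simp add: k_def)
    obtain r2 where r2: "r2 > 0" "\<And>A. A \<in> sets \<nu> \<Longrightarrow> emeasure \<nu> A < ennreal r2 \<Longrightarrow>
        (\<integral>x. indicator A x * (cmod (\<psi> x) powr p) \<partial>\<nu>) < k powr p"
      using integral_small_sets[OF lp_functionsD(2)[OF \<psi>(1)], of "k powr p"] k by auto
    obtain s2' where s2': "s2' > 0" "\<And>A. A \<in> sets \<nu> \<Longrightarrow> \<forall>\<xi>\<in>A. \<forall>\<eta>\<in>A. bdist \<xi> \<eta> \<le> s2' \<Longrightarrow> emeasure \<nu> A < ennreal r2"
      using small_diameter_small_measure[OF r2(1)] by auto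
    define s where "s = s' / 2"
    define s2 where "s2 = s2' / 2"
    have s: "s > 0" "s2 > 0" using s' s2' by (auto simp: s_def s2_def)
    \<comment> \<open>\<open>exp (- \<epsilon> * L) = s2 * s\<close>: for orbit points beyond
      \<open>L\<close>, whatever lies outside \<open>shadow g s\<close> is moved by
      \<open>inv g\<close> into \<open>shadow (inv g) s2\<close>.\<close>
    define L where "L = - ln (s2 * s) / \<epsilon>"
    have "cmod (\<theta> (\<Pi> p t g v)) < e" if g: "g \<in> carrier \<Gamma>" and far: "\<not> dist w (\<phi> g w) \<le> L" for g
    proof -
      have "exp (- \<epsilon> * dist w (\<phi> g w)) \<le> exp (- \<epsilon> * L)" using far eps by simp
      also have "\<dots> = s2 * s" using eps s by (simp add: L_def)
      finally have exp_le: "exp (- \<epsilon> * dist w (\<phi> g w)) \<le> s2 * s" .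
      \<comment> \<open>On \<open>A\<close> the functional is small because the set is small. Off
        \<open>A\<close> the norm itself is small: by change of variables it is the norm of
        \<open>\<psi>\<close> on the preimage under \<open>g\<close>, which lies in the other
        shadow.\<close>
      define A where "A = shadow g s"
      have A: "A \<in> sets \<nu>" by (simp add: A_def)
      have cA: "bdry - A \<in> sets \<nu>" using A by auto
      define f where "f = \<pi> p t g \<psi>"
      have f: "f \<in> lp_functions p \<nu>" unfolding f_def by (rule rep_fun_lp(1)[OF g p0 \<psi>(1)])
      define f1 where "f1 = (\<lambda>x. indicator A x * f x)"
      define f2 where "f2 = (\<lambda>x. indicator (bdry - A) x * f x)"
      have f1: "f1 \<in> lp_functions p \<nu>" unfolding f1_def by (rule lp_functions_indicator[OF p0 f A])
      have f2: "f2 \<in> lp_functions p \<nu>" unfolding f2_def by (rule lp_functions_indicator[OF p0 f cA])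
      have "F f = F (\<lambda>x. f1 x + f2 x)"
        unfolding F_def by (intro arg_cong[of _ _ \<theta>] ae_class_eqI AE_I2)
          (auto simp: f1_def f2_def indicator_def)
      also have "\<dots> = F f1 + F f2" by (rule F_add[OF f1 f2])
      finally have Ff: "cmod (F f) \<le> cmod (F f1) + cmod (F f2)" by (simp add: norm_triangle_ineq)
      have "lp_norm p \<nu> f1 powr p \<le> lp_norm p \<nu> f powr p"
        unfolding lp_norm_powr[OF p0]
      proof (rule integral_mono)
        show "cmod (f1 x) powr p \<le> cmod (f x) powr p" for x
          by (auto simp: f1_def split: split_indicator)
      qed (use lp_functionsD(2)[OF f1] lp_functionsD(2)[OF f] in auto)
      then have "lp_norm p \<nu> f1 \<le> lp_norm p \<nu> f"
        using lp_norm_le_iff[OF p0 lp_norm_nonneg, of \<nu> f1 p \<nu> f] lp_norm_powr[OF p0, of \<nu> f1] by simp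
      also have "\<dots> \<le> R" unfolding f_def rep_fun_lp(2)[OF g p0 \<psi>(1)] by (simp add: R_def)
      finally have n1: "lp_norm p \<nu> f1 \<le> R" .
      define h where "h = (\<lambda>x. complex_of_real (1 / R) * f1 x)"
      have h: "h \<in> lp_functions p \<nu>" unfolding h_def by (rule lp_functions_cmult[OF f1])
      have "lp_norm p \<nu> h = cmod (complex_of_real (1 / R)) * lp_norm p \<nu> f1"
        unfolding h_def by (rule lp_norm_cmult[OF p0])
      then have hn: "lp_norm p \<nu> h \<le> 1" using n1 R by (simp add: norm_divide)
      have "emeasure \<nu> A < ennreal r"
        using shadow_diam[of _ g s] by (intro s'(2) A) (auto simp: A_def s_def)
      then have "cmod (F h) \<le> e / (4 * R)"
        using hn by (intro r(2)[OF A h]) (auto simp: h_def f1_def)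
      moreover have "F h = complex_of_real (1 / R) * F f1" unfolding h_def by (rule F_scale[OF f1])
      ultimately have F1: "cmod (F f1) \<le> e / 4" using R by (simp add: norm_mult norm_divide field_simps)
      have pre: "bmap g -` (bdry - A) \<inter> bdry \<in> sets \<nu>"
        using measurable_sets[OF measurable_bmap[OF g] cA] by simp
      have "bmap g -` (bdry - A) \<inter> bdry \<subseteq> shadow (inv g) s2"
      proof
        fix \<xi> assume \<xi>: "\<xi> \<in> bmap g -` (bdry - A) \<inter> bdry"
        then have "s \<le> bker (bmap g \<xi>) (\<phi> g w)" by (auto simp: A_def shadow_def)
        then have "bmap (inv g) (bmap g \<xi>) \<in> shadow (inv g) s2"
          using \<xi> s exp_le by (intro bmap_inv_shadow[OF g]) auto
        then show "\<xi> \<in> shadow (inv g) s2" using g by simp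
      qed
      then have "emeasure \<nu> (bmap g -` (bdry - A) \<inter> bdry) \<le> emeasure \<nu> (shadow (inv g) s2)"
        by (intro emeasure_mono) auto
      also have "\<dots> < ennreal r2"
        using shadow_diam[of _ "inv g" s2] by (intro s2'(2)) (auto simp: s2_def)
      finally have small: "(\<integral>x. indicator (bmap g -` (bdry - A) \<inter> bdry) x * (cmod (\<psi> x) powr p) \<partial>\<nu>) < k powr p"
        by (rule r2(2)[OF pre])
      have "(\<lambda>x. cmod (f2 x) powr p) = (\<lambda>x. indicator (bdry - A) x * (cmod (\<pi> p t g \<psi> x) powr p))"
        by (auto simp: f2_def f_def fun_eq_iff split: split_indicator)
      then have "(\<integral>x. cmod (f2 x) powr p \<partial>\<nu>) \<le> k powr p"
        using small integral_rep_fun_powr(2)[OF g p0 \<psi>(1) cA, of t] by simp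
      then have "lp_norm p \<nu> f2 \<le> k" using lp_norm_le_iff[OF p0, of k \<nu> f2] k by simp
      then have "C * lp_norm p \<nu> f2 \<le> C * k" using C by (intro mult_left_mono) auto
      then have F2: "cmod (F f2) \<le> e / 4" using F_bound[OF f2] C by (simp add: k_def)
      have "\<theta> (\<Pi> p t g v) = F f"
        by (simp add: F_def f_def \<psi>(2) boundary_rep_class[OF g lp_functionsD(1)[OF \<psi>(1)]])
      then show ?thesis using Ff F1 F2 e by simp
    qed
    \<comment> \<open>Only the finitely many group elements that move \<open>w\<close> by at most
      \<open>L\<close> can fail.\<close>
    then have "{g. \<not> (g \<in> carrier \<Gamma> \<longrightarrow> dist (\<theta> (\<Pi> p t g v)) 0 < e)} \<subseteq> {g \<in> carrier \<Gamma>. dist w (\<phi> g w) \<le> L}"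
      by auto
    from finite_subset[OF this finite_orbit_ball]
    show "\<forall>\<^sub>F g in inf cofinite (principal (carrier \<Gamma>)). dist (\<theta> (\<Pi> p t g v)) 0 < e"
      unfolding eventually_inf_principal eventually_cofinite .
  qed
qed

theorem weakly_mixing_L1_zero:
  assumes rg: "roughly_geodesic TYPE('x)" and cc: "cocompact_action \<Gamma> \<phi>"
  shows "weakly_mixing \<Gamma> (L1_zero_space \<nu>) (\<Pi> 1 0)"
  unfolding weakly_mixing_def
proof (intro conjI ballI allI impI)
  let ?S = "{f. integrable \<nu> f \<and> (\<integral>x. f x \<partial>\<nu>) = 0} :: (_ \<Rightarrow> complex) set"
  have inv_S: "\<pi> 1 0 g \<psi> \<in> ?S" if "g \<in> carrier \<Gamma>" "\<psi> \<in> ?S" for g \<psi>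
    using that rep_fun_lp(1)[OF that(1), of 1 \<psi> 0] integral_rep_fun_1[OF that(1), of \<psi>]
    by (simp add: lp_functions_1)
  show "representation \<Gamma> (L1_zero_space \<nu>) (\<Pi> 1 0)"
    by (rule representation_Lp[OF _ _ carrier_L1_zero]) (use inv_S in \<open>auto simp: lp_functions_1\<close>)
  interpret finite_measure \<nu> by (rule finite_measure_nu)
  fix \<theta> v and e :: real
  assume \<theta>: "\<theta> \<in> topological_dual (L1_zero_space \<nu>)" and v: "v \<in> carrier (L1_zero_space \<nu>)" and e: "e > 0"
  then obtain \<psi> where \<psi>: "integrable \<nu> \<psi>" "(\<integral>x. \<psi> x \<partial>\<nu>) = 0" "v = ae_class \<nu> \<psi>"
    by (auto simp: carrier_L1_zero)
  define F where "F f = \<theta> (ae_class \<nu> f)" for f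
  have F_add: "F (\<lambda>x. f x + h x) = F f + F h"
    if "integrable \<nu> f" "integrable \<nu> h" "(\<integral>x. f x \<partial>\<nu>) = 0" "(\<integral>x. h x \<partial>\<nu>) = 0" for f h
    using that \<theta>
    by (auto simp: F_def topological_dual_def carrier_L1_zero simp flip: vadd_Lp[of _ _ _ 1])
  have F_scale: "F (\<lambda>x. c * f x) = c * F f" if "integrable \<nu> f" "(\<integral>x. f x \<partial>\<nu>) = 0" for c f
    using that \<theta> by (auto simp: F_def topological_dual_def carrier_L1_zero simp flip: vscale_Lp[of _ _ 1])
  obtain C' where C': "\<And>v. v \<in> carrier (L1_zero_space \<nu>) \<Longrightarrow> cmod (\<theta> v) \<le> C' * vnorm (L1_zero_space \<nu>) v"
    using \<theta> unfolding topological_dual_def by blast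
  define C where "C = \<bar>C'\<bar> + 1"
  have C: "C > 0" by (simp add: C_def)
  have F_bound: "cmod (F f) \<le> C * (\<integral>x. cmod (f x) \<partial>\<nu>)" if f: "integrable \<nu> f" "(\<integral>x. f x \<partial>\<nu>) = 0" for f
  proof -
    have "cmod (F f) \<le> C' * (\<integral>x. cmod (f x) \<partial>\<nu>)"
      using C'[of "ae_class \<nu> f"] f by (simp add: F_def carrier_L1_zero vnorm_Lp lp_norm_1)
    also have "\<dots> \<le> C * (\<integral>x. cmod (f x) \<partial>\<nu>)"
      by (intro mult_right_mono) (simp_all add: C_def)
    finally show ?thesis .
  qed
  have rep_class: "\<theta> (\<Pi> 1 0 g v) = F (\<pi> 1 0 g \<psi>)" if "g \<in> carrier \<Gamma>" for g
    using boundary_rep_class[OF that borel_measurable_integrable[OF \<psi>(1)]] by (simp add: F_def \<psi>(3))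
  define N where "N = (\<integral>x. cmod (\<psi> x) \<partial>\<nu>)"
  have N0: "N \<ge> 0" by (simp add: N_def)
  show "\<exists>g\<in>carrier \<Gamma>. cmod (\<theta> (\<Pi> 1 0 g v)) < e"
  proof (cases "measure \<nu> (space \<nu>) > 0")
    \<comment> \<open>If the boundary is a null set, every vector has norm 0 and the identity
      element serves.\<close>
    case False
    then have "measure \<nu> (space \<nu>) = 0" using measure_nonneg[of \<nu> "space \<nu>"] by linarith
    then have "emeasure \<nu> (space \<nu>) = 0" by (simp add: emeasure_eq_measure)
    then have "AE x in \<nu>. \<pi> 1 0 \<one> \<psi> x = 0" by (intro AE_I[of _ _ "space \<nu>"]) auto
    then have "(\<integral>x. cmod (\<pi> 1 0 \<one> \<psi> x) \<partial>\<nu>) = (\<integral>x. 0 \<partial>\<nu>)"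
      using inv_S[of \<one> \<psi>] \<psi> by (intro integral_cong_AE) auto
    then show ?thesis
      using F_bound[of "\<pi> 1 0 \<one> \<psi>"] inv_S[of \<one> \<psi>] \<psi> rep_class[of \<one>] e by (intro bexI[of _ \<one>]) auto
  next
    case True
    \<comment> \<open>The part \<open>k\<close> localized on \<open>E\<close> will have norm at most
      \<open>2 * (N + 1)\<close>, so it contributes at most \<open>e / 2\<close>.\<close>
    define e' where "e' = e / (4 * (N + 1))"
    have e': "e' > 0" using e N0 by (simp add: e'_def)
    obtain E where E: "E \<in> sets \<nu>" "emeasure \<nu> E > 0" and
      small: "\<forall>k. integrable \<nu> k \<longrightarrow> (\<integral>x. k x \<partial>\<nu>) = 0 \<longrightarrow>
        (\<forall>x\<in>space \<nu> - E. k x = 0) \<longrightarrow> cmod (F k) \<le> e' * (\<integral>x. cmod (k x) \<partial>\<nu>)"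
    proof -
      have "\<exists>E\<in>sets \<nu>. emeasure \<nu> E > 0 \<and> (\<forall>k. integrable \<nu> k \<longrightarrow> (\<integral>x. k x \<partial>\<nu>) = 0 \<longrightarrow>
          (\<forall>x\<in>space \<nu> - E. k x = 0) \<longrightarrow> cmod (F k) \<le> e' * (\<integral>x. cmod (k x) \<partial>\<nu>))"
        by (rule mean_zero_functional_localized[OF True _ _ _ e', where C = C])
          (rule F_add F_scale F_bound; assumption)+
      then show ?thesis using that by (elim bexE conjE)
    qed
    \<comment> \<open>The correction \<open>b\<close> will have norm at most
      \<open>2 * \<kappa>\<close>. The second entry makes \<open>F b\<close> at most
      \<open>e / 4\<close> in modulus; the first keeps the norm of \<open>k\<close> within
      \<open>2 * (N + 1)\<close>.\<close>
    define \<kappa> where "\<kappa> = min 1 (e / (8 * C))"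
    have \<kappa>: "\<kappa> > 0" "\<kappa> \<le> 1" "\<kappa> \<le> e / (8 * C)" using e C by (auto simp: \<kappa>_def)
    obtain r where r: "r > 0" "\<And>A. A \<in> sets \<nu> \<Longrightarrow> emeasure \<nu> A < ennreal r \<Longrightarrow>
        (\<integral>x. indicator A x * cmod (\<psi> x) \<partial>\<nu>) < \<kappa>"
      using integral_small_sets[of \<nu> "\<lambda>x. cmod (\<psi> x)" \<kappa>] \<psi>(1) \<kappa>(1) by auto
    obtain g where g: "g \<in> carrier \<Gamma>" "emeasure \<nu> (bmap g -` (bdry - E) \<inter> bdry) < ennreal r"
      using expand_to_almost_everything[OF rg cc E r(1)] by blast
    define f where "f = \<pi> 1 0 g \<psi>"
    have f: "integrable \<nu> f" "(\<integral>x. f x \<partial>\<nu>) = 0" using inv_S[OF g(1)] \<psi> by (auto simp: f_def)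
    have cE: "bdry - E \<in> sets \<nu>" using E(1) by auto
    have pre: "bmap g -` (bdry - E) \<inter> bdry \<in> sets \<nu>"
      using measurable_sets[OF measurable_bmap[OF g(1)] cE] by simp
    have \<psi>1: "\<psi> \<in> lp_functions 1 \<nu>" using \<psi>(1) by (simp add: lp_functions_1)
    have out: "(\<integral>x. indicator (bdry - E) x * cmod (f x) \<partial>\<nu>) < \<kappa>"
      using r(2)[OF pre g(2)] integral_rep_fun_powr(2)[OF g(1) _ \<psi>1 cE, of 0]
      by (simp add: f_def)
    have nf: "(\<integral>x. cmod (f x) \<partial>\<nu>) = N"
      using rep_fun_lp(2)[OF g(1) _ \<psi>1, of 0] by (simp add: lp_norm_1 f_def N_def)
    \<comment> \<open>The part of \<open>f\<close> that misses \<open>E\<close>. Removing it alone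
      would destroy mean zero.\<close>
    define q where "q = (\<lambda>x. indicator (bdry - E) x * f x)"
    have q: "integrable \<nu> q"
      using integrable_mult_indicator[OF cE f(1)] by (simp add: q_def scaleR_conv_of_real of_real_indicator)
    have q1: "(\<integral>x. cmod (q x) \<partial>\<nu>) < \<kappa>"
    proof -
      have "(\<lambda>x. cmod (q x)) = (\<lambda>x. indicator (bdry - E) x * cmod (f x))"
        by (auto simp: q_def fun_eq_iff split: split_indicator)
      then show ?thesis using out by simp
    qed
    have Es: "E \<inter> bdry = E" using sets.Int_space_eq2[OF E(1)] by simp
    define mE where "mE = measure \<nu> E"
    have mE: "mE > 0" using E(2) by (simp add: mE_def emeasure_eq_measure)
    \<comment> \<open>\<open>c\<close> times the indicator of \<open>E\<close> has the same integral
      as \<open>q\<close> and no larger norm. Thus \<open>b = q - z\<close> has mean zero, and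
      \<open>k = f - b\<close> has mean zero and vanishes off \<open>E\<close>.\<close>
    define c where "c = (\<integral>x. q x \<partial>\<nu>) / complex_of_real mE"
    define z where "z = (\<lambda>x. c * indicator E x)"
    have z: "integrable \<nu> z" unfolding z_def using E(1) by (intro integrable_mult_right integrable_indicator_finite)
    have zi: "(\<integral>x. z x \<partial>\<nu>) = (\<integral>x. q x \<partial>\<nu>)"
    proof -
      have "(\<integral>x. indicator E x \<partial>\<nu>) = (\<integral>x. complex_of_real (indicator E x) \<partial>\<nu>)"
        by (rule Bochner_Integration.integral_cong) (auto split: split_indicator)
      also have "\<dots> = complex_of_real (\<integral>x. indicator E x \<partial>\<nu>)" by (rule integral_complex_of_real)
      also have "\<dots> = complex_of_real mE" using E(1) Es by (simp add: mE_def)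
      finally show ?thesis using mE by (simp add: z_def c_def)
    qed
    have z1: "(\<integral>x. cmod (z x) \<partial>\<nu>) \<le> (\<integral>x. cmod (q x) \<partial>\<nu>)"
    proof -
      have "(\<integral>x. cmod (z x) \<partial>\<nu>) = (\<integral>x. cmod c * indicator E x \<partial>\<nu>)"
        by (rule Bochner_Integration.integral_cong) (auto simp: z_def norm_mult split: split_indicator)
      also have "\<dots> = cmod c * mE" using E(1) Es by (simp add: mE_def)
      also have "\<dots> = cmod (\<integral>x. q x \<partial>\<nu>)" using mE by (simp add: c_def norm_divide)
      also have "\<dots> \<le> (\<integral>x. cmod (q x) \<partial>\<nu>)" by simp
      finally show ?thesis .
    qed
    define b where "b = (\<lambda>x. q x - z x)"
    define k where "k = (\<lambda>x. f x - b x)"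
    have b: "integrable \<nu> b" "(\<integral>x. b x \<partial>\<nu>) = 0" using q z zi by (auto simp: b_def)
    have k: "integrable \<nu> k" "(\<integral>x. k x \<partial>\<nu>) = 0" using f b by (auto simp: k_def)
    have b1: "(\<integral>x. cmod (b x) \<partial>\<nu>) \<le> 2 * \<kappa>"
    proof -
      have "(\<integral>x. cmod (b x) \<partial>\<nu>) \<le> (\<integral>x. cmod (q x) + cmod (z x) \<partial>\<nu>)"
        using b(1) q z by (intro integral_mono) (auto simp: b_def norm_triangle_ineq4)
      also have "\<dots> = (\<integral>x. cmod (q x) \<partial>\<nu>) + (\<integral>x. cmod (z x) \<partial>\<nu>)"
        using q z by simp
      finally show ?thesis using q1 z1 by linarith
    qed
    have "(\<integral>x. cmod (k x) \<partial>\<nu>) \<le> (\<integral>x. cmod (f x) + cmod (b x) \<partial>\<nu>)"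
      using k(1) f(1) b(1) by (intro integral_mono) (auto simp: k_def norm_triangle_ineq4)
    also have "\<dots> = N + (\<integral>x. cmod (b x) \<partial>\<nu>)" using f b nf by simp
    also have "\<dots> \<le> 2 * (N + 1)" using b1 \<kappa>(2) N0 by argo
    finally have k1: "e' * (\<integral>x. cmod (k x) \<partial>\<nu>) \<le> e' * (2 * (N + 1))" using e' by (intro mult_left_mono) auto
    have "cmod (F k) \<le> e' * (\<integral>x. cmod (k x) \<partial>\<nu>)"
      by (rule small[rule_format, OF k]) (auto simp: k_def b_def q_def z_def)
    also have "\<dots> \<le> e' * (2 * (N + 1))" by (rule k1)
    also have "\<dots> = e / 2" using N0 by (simp add: e'_def field_simps)
    finally have Fk: "cmod (F k) \<le> e / 2" .
    have "C * (\<integral>x. cmod (b x) \<partial>\<nu>) \<le> C * (2 * (e / (8 * C)))" using b1 \<kappa>(3) C by (intro mult_left_mono) auto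
    then have Fb: "cmod (F b) \<le> e / 4" using F_bound[OF b] C by simp
    have "F f = F (\<lambda>x. k x + b x)" by (simp add: k_def)
    also have "\<dots> = F k + F b" by (rule F_add[OF k(1) b(1) k(2) b(2)])
    finally have "cmod (F f) \<le> cmod (F k) + cmod (F b)" by (simp add: norm_triangle_ineq)
    then have "cmod (\<theta> (\<Pi> 1 0 g v)) < e" using rep_class[OF g(1)] Fk Fb e by (simp add: f_def)
    then show ?thesis using g(1) by blast
  qed
qed

end

theorem proposition1p4:
  fixes \<Gamma> :: "('g, 'm) monoid_scheme"
    and \<phi> :: "'g \<Rightarrow> 'x::metric_space \<Rightarrow> 'x"
    and \<epsilon> D :: real
    and x0 :: 'x
    and Z :: "(nat \<Rightarrow> 'x) set set"
    and d :: "(nat \<Rightarrow> 'x) set \<Rightarrow> (nat \<Rightarrow> 'x) set \<Rightarrow> real"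
    and \<nu> :: "(nat \<Rightarrow> 'x) set measure"
  assumes "hyperbolic_group \<Gamma>" and "\<not> elementary_group \<Gamma>"
    and "roughly_geodesic TYPE('x)"
    and "\<epsilon> > 0" and "strongly_hyperbolic TYPE('x) \<epsilon>"
    and "isometric_action \<Gamma> \<phi>" and "proper_action \<Gamma> \<phi>" and "cocompact_action \<Gamma> \<phi>"
    and "Z = gromov_boundary x0"
    and "d = boundary_dist \<epsilon> x0"
    and "ereal D = hausdorff_dim Z d"
    and "\<nu> = hausdorff_measure Z d D"
    and "ahlfors_regular Z d D \<nu>"
  shows "(\<forall>p t. 1 < p \<longrightarrow> mixing \<Gamma> (Lp_space p \<nu>) (boundary_rep \<Gamma> \<phi> \<epsilon> x0 D \<nu> p t)) \<and>
         weakly_mixing \<Gamma> (L1_zero_space \<nu>) (boundary_rep \<Gamma> \<phi> \<epsilon> x0 D \<nu> 1 0)"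
proof -
  have grp: "group \<Gamma>" using assms(1) by (simp add: hyperbolic_group_def)
  have "0 \<le> ereal D"
    unfolding assms(11) hausdorff_dim_def by (rule Inf_greatest) auto
  then have D: "0 \<le> D" by simp
  interpret boundary_measure \<epsilon> x0 \<Gamma> \<phi> D
    using assms(4-7,13) D grp
    by (intro boundary_measure.intro boundary_action.intro visual_metric.intro
        boundary_action_axioms.intro boundary_measure_axioms.intro) (simp_all add: assms(9,10,12))
  have "infinite (carrier \<Gamma>)" using elementary_if_finite assms(2) by blast
  then show ?thesis
    using mixing_Lp weakly_mixing_L1_zero[OF assms(3,8)] by (simp add: assms(9,10,12))
qed

end
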